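(* Let $M,N$ be fixed positive integers and let $\alpha\in(0,1)$ with $\alpha>\frac12$. Let $\xi_t$ and $\tilde\xi_t$ be the two-shock half-line open TASEPs with boundary rate $\alpha$ described in the context, let $g(t)$ be the position of the unique second-class particle of $\xi_t$, and let $\mathsf{N}_3(1,t)$ be the number of third-class particles present in $\tilde\xi_t$ at time $t$. For integers $m,n$ let $$B_{m,n}=\Big\{\eta\in\{0,1\}^{2M+2N+1}:\ \sum_{i=1}^{M+N}\eta_i=m,\ \sum_{j=M+N+1}^{2M+2N+1}\eta_j=n\Big\}.$$ Then, with $\Psi_1(\eta)$ and $Z_k(\eta)$ as defined in the context, $$\lim_{t\to\infty}\mathbb{P}(g(t)>0)=\sum_{m=0}^{N-1}\sum_{n=0}^{M+N-m}\sum_{\eta\in B_{m,n}}\sum_{k=0}^{\Psi_1(\eta)}\frac{Z_k(\eta)}{2^k}\left(1+\frac{\alpha-\frac12}{\alpha}k\right)+\sum_{m=N}^{M+N}\sum_{n=0}^{M}\sum_{\eta\in B_{m,n}}\sum_{k=0}^{\Psi_1(\eta)}\frac{Z_k(\eta)}{2^k}\left(1+\frac{\alpha-\frac12}{\alpha}k\right).$$ Moreover, for every integer $0\le s\le N$, $$\lim_{t\to\infty}\mathbb{P}(\mathsf{N}_3(1,t)=s)=\sum_{n=1}^{s}\sum_{\eta\in B_{N-n,\,M+N+1-s+n}}\sum_{k=0}^{\Psi_1(\eta)}\frac{Z_k(\eta)}{2^k}\left(1+\frac{\alpha-\frac12}{\alpha}k\right)+\sum_{m=N}^{M+N}\sum_{\eta\in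 B_{m,\,M+N+1-s}}\sum_{k=0}^{\Psi_1(\eta)}\frac{Z_k(\eta)}{2^k}\left(1+\frac{\alpha-\frac12}{\alpha}k\right).$$
   Context: Multi-color half-line open TASEP: a continuous-time Markov process on configurations $\eta:\mathbb{Z}_{>0}\to\{1,2,3,+\infty\}$, where $1,2,3$ denote first-, second- and third-class particles and $+\infty$ a hole. Dynamics: independently for each $x\ge1$, at rate $1$ the contents of sites $x$ and $x+1$ are exchanged if $\eta(x)<\eta(x+1)$ (nothing happens otherwise); at rate $\alpha$, if $\eta(1)>1$, the content of site $1$ is replaced by a first-class particle (nothing happens otherwise). In particular, a second- or third-class particle at site $1$ that is replaced in this way leaves the system permanently. Initial condition of $\xi_t$ (no third-class particles): holes on $[1,N]$; first-class particles on $[N+1,N+M]$; holes on $[N+M+1,N+2M]$; one second-class particle at $N+2M+1$; first-class particles on $[N+2M+2,2N+2M+1]$; holes at all sites $>2N+2M+1$. Initial condition of $\tilde\xi_t$ (same dynamics): second-class particles on $[N+1,N+M]$; third-class particles on $[N+2M+1,2N+2M+1]$; holes at all other sites $x\ge1$. $g(t)$ is the position of the unique second-class particle of $\xi_t$; $g(t)>0$ means that this particle is still in the system at time $t$, and $g(t)<0$ means that it has left the system by time $t$. $\mathsf{N}_i(x,t)$ is the number of particles of color $i$ in $\tilde\xi_t$ at time $t$ located at sites $\ge x$. Combinatorial notation. For $L\in\mathbb{N}$ and $\eta=(\eta_1,\dots,\eta_L)\in\{0,1\}^L$: $A(\eta)$ is the number of clusters (maximal runs) of 1's; $\sigma_j(\eta)$,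 $1\le j\le A(\eta)$, is the length of the $j$-th cluster of 1's; $\tau_j(\eta)$, $1\le j\le A(\eta)-1$, is the number of 0's between the $j$-th and $(j+1)$-th cluster of 1's; $\tau_0(\eta)$ is the number of 0's before the first cluster of 1's and $\tau_{A(\eta)}(\eta)$ the number of 0's after the last cluster of 1's (if $A(\eta)=0$, $\tau_0(\eta)=L$). Put $\Psi_i(\eta)=\sum_{j=i}^{A(\eta)}\sigma_j(\eta)$ for $1\le i\le A(\eta)+1$ and $\Phi_j(\eta)=\sum_{k=j}^{A(\eta)}\tau_k(\eta)$ for $0\le j\le A(\eta)+1$, so $\Psi_{A(\eta)+1}(\eta)=\Phi_{A(\eta)+1}(\eta)=0$. DEHP-tree of $\eta$ (with $c=\frac14$): a weighted directed graph on nodes $(x,y)\in\mathbb{Z}_{\ge0}^2$ (nodes with equal coordinates are identified), started from the root $(\Psi_1(\eta),\Phi_0(\eta))$. A node $(x,y)$ with $y\ge1$ has either one child or two children. It has exactly one child, $(x,y-1)$, joined by an edge $(x,y)\to(x,y-1)$ of weight $c/\alpha$, if $x=\Psi_i(\eta)$ and $\Phi_i(\eta)<y\le\Phi_{i-1}(\eta)$ for some $1\le i\le A(\eta)+1$. It has two children, $(x,y-1)$ and $(x-1,y)$, each joined by an edge from $(x,y)$ of weight $c$, if for some $1\le i\le A(\eta)$ either $x=\Psi_i(\eta)$ and $1\le y\le\Phi_i(\eta)$, or $\Psi_{i+1}(\eta)<x<\Psi_i(\eta)$ and $1\le y\le\Phi_i(\eta)$. The construction ends at the endpoints $(k,0)$,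 $0\le k\le\Psi_1(\eta)$. The weight of a directed path is the product of its edge weights (the empty path has weight $1$), and $Z_k(\eta)$ is the sum of the weights of all directed paths from the root to $(k,0)$ (zero if there is none). *)

theory Defs
  imports "HOL-Probability.Probability" "HOL-Library.Extended_Nat"
begin

section \<open>Continuous-time Markov chains\<close>

text \<open>
  \<open>p t i j\<close> is the probability of going from \<open>i\<close> to \<open>j\<close> in time \<open>t\<close>.  The chain has (off-diagonal)
  jump rates \<open>q\<close> in the sense that \<open>p h i j = q i j * h + o(h)\<close> for \<open>i \<noteq> j\<close> and
  \<open>p h i i = 1 - (\<Sum>j \<noteq> i. q i j) * h + o(h)\<close> as \<open>h\<close> decreases to \<open>0\<close>.
\<close>

definition transition_function :: "'s set \<Rightarrow> (real \<Rightarrow> 's \<Rightarrow> 's \<Rightarrow> real) \<Rightarrow> bool" where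
  "transition_function E p \<longleftrightarrow>
     (\<forall>t\<ge>0. \<forall>i\<in>E. \<forall>j\<in>E. 0 \<le> p t i j) \<and>
     (\<forall>t\<ge>0. \<forall>i\<in>E. (p t i has_sum 1) E) \<and>
     (\<forall>i\<in>E. \<forall>j\<in>E. p 0 i j = of_bool (i = j)) \<and>
     (\<forall>s\<ge>0. \<forall>t\<ge>0. \<forall>i\<in>E. \<forall>j\<in>E. ((\<lambda>k. p s i k * p t k j) has_sum p (s + t) i j) E)"

definition has_jump_rates :: "'s set \<Rightarrow> (real \<Rightarrow> 's \<Rightarrow> 's \<Rightarrow> real) \<Rightarrow> ('s \<Rightarrow> 's \<Rightarrow> real) \<Rightarrow> bool" where
  "has_jump_rates E p q \<longleftrightarrow>
     (\<forall>i\<in>E. \<forall>j\<in>E. i \<noteq> j \<longrightarrow> ((\<lambda>h. p h i j / h) \<longlongrightarrow> q i j) (at_right 0)) \<and>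
     (\<forall>i\<in>E. ((\<lambda>h. (1 - p h i i) / h) \<longlongrightarrow> infsum (q i) (E - {i})) (at_right 0))"

text \<open>
  The process may take values in a larger measurable space \<open>S\<close>, but the finite-dimensional
  distributions below sum to \<open>1\<close> over \<open>E\<close>, so it stays almost surely in the countable set \<open>E\<close>.
  Taking \<open>n = 0\<close> gives \<open>X 0 = x0\<close> almost surely.
\<close>

definition markov_jump_process ::
    "'s set \<Rightarrow> ('s \<Rightarrow> 's \<Rightarrow> real) \<Rightarrow> 's \<Rightarrow> 's measure \<Rightarrow> 'a measure \<Rightarrow> (real \<Rightarrow> 'a \<Rightarrow> 's) \<Rightarrow> bool" where
  "markov_jump_process E q x0 S P X \<longleftrightarrow>
     prob_space P \<and> x0 \<in> E \<and>
     (\<forall>t\<ge>0. X t \<in> P \<rightarrow>\<^sub>M S) \<and>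
     (\<exists>p. transition_function E p \<and> has_jump_rates E p q \<and>
        (\<forall>(n::nat) (t::nat \<Rightarrow> real) (i::nat \<Rightarrow> 's).
           t 0 = 0 \<and> (\<forall>k<n. t k \<le> t (Suc k)) \<and> i 0 = x0 \<and> (\<forall>k\<le>n. i k \<in> E) \<longrightarrow>
           measure P {\<omega> \<in> space P. \<forall>k\<le>n. X (t k) \<omega> = i k} =
             (\<Prod>k<n. p (t (Suc k) - t k) (i k) (i (Suc k)))))"


section \<open>The multi-color half-line open TASEP\<close>

text \<open>
  The sites are the \<open>x \<ge> 1\<close>; the dummy site \<open>0\<close> always carries a hole and takes no part in the
  dynamics.
\<close>

type_synonym config = "nat \<Rightarrow> enat"

definition finite_configs :: "config set" where
  "finite_configs = {\<eta>. range \<eta> \<subseteq> {1, 2, 3, \<infinity>} \<and> \<eta> 0 = \<infinity> \<and> finite {x. \<eta> x \<noteq> \<infinity>}}"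

definition config_space :: "config measure" where
  "config_space = (\<Pi>\<^sub>M x\<in>UNIV. count_space UNIV)"

definition exchange :: "nat \<Rightarrow> config \<Rightarrow> config" where
  "exchange x \<eta> = \<eta>(x := \<eta> (Suc x), Suc x := \<eta> x)"

definition inject :: "config \<Rightarrow> config" where
  "inject \<eta> = \<eta>(1 := 1)"

text \<open>For \<open>\<eta> \<in> finite_configs\<close> only finitely many bonds \<open>(x, x + 1)\<close> satisfy \<open>\<eta> x < \<eta> (x + 1)\<close>.\<close>

definition tasep_rate :: "real \<Rightarrow> config \<Rightarrow> config \<Rightarrow> real" where
  "tasep_rate \<alpha> \<eta> \<eta>' =
     real (card {x. 1 \<le> x \<and> \<eta> x < \<eta> (Suc x) \<and> exchange x \<eta> = \<eta>'}) +
     \<alpha> * of_bool (\<eta> 1 > 1 \<and> inject \<eta> = \<eta>')"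

text \<open>
  Started from finitely many particles, the process has finitely many particles at all times,
  since the boundary injects at rate at most \<open>\<alpha>\<close>; hence the state space \<open>finite_configs\<close>.
\<close>

definition half_line_open_tasep ::
    "real \<Rightarrow> config \<Rightarrow> 'a measure \<Rightarrow> (real \<Rightarrow> 'a \<Rightarrow> config) \<Rightarrow> bool" where
  "half_line_open_tasep \<alpha> \<eta>0 P \<xi> \<longleftrightarrow>
     markov_jump_process finite_configs (tasep_rate \<alpha>) \<eta>0 config_space P \<xi>"

definition xi_init :: "nat \<Rightarrow> nat \<Rightarrow> config" where
  "xi_init M N x =
     (if x \<in> {N+1..N+M} then 1
      else if x = N+2*M+1 then 2
      else if x \<in> {N+2*M+2..2*N+2*M+1} then 1
      else \<infinity>)"

definition xi_tilde_init :: "nat \<Rightarrow> nat \<Rightarrow> config" where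
  "xi_tilde_init M N x =
     (if x \<in> {N+1..N+M} then 2
      else if x \<in> {N+2*M+1..2*N+2*M+1} then 3
      else \<infinity>)"

text \<open>The value \<open>-1\<close> encodes that the second-class particle has left the system.\<close>

definition second_class_position :: "config \<Rightarrow> int" where
  "second_class_position \<eta> =
     (if \<exists>x\<ge>1. \<eta> x = 2 then int (LEAST x. 1 \<le> x \<and> \<eta> x = 2) else -1)"

definition num_color_ge :: "enat \<Rightarrow> nat \<Rightarrow> config \<Rightarrow> nat" where
  "num_color_ge i x \<eta> = card {y. 1 \<le> y \<and> x \<le> y \<and> \<eta> y = i}"


section \<open>Clusters and the DEHP-tree\<close>

text \<open>
  Elements of \<open>{0,1}\<^sup>L\<close> are lists of booleans of length \<open>L\<close>; \<open>True\<close> stands for \<open>1\<close>.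
  The lists below are \<open>[\<sigma>\<^sub>1, \<dots>, \<sigma>\<^sub>A]\<close> and \<open>[\<tau>\<^sub>0, \<dots>, \<tau>\<^sub>A]\<close>.
\<close>

lemma length_dropWhile_id_less:
  assumes "dropWhile Not \<eta> \<noteq> []"
  shows "length (dropWhile id (dropWhile Not \<eta>)) < length \<eta>"
proof -
  from assms obtain b r where r: "dropWhile Not \<eta> = b # r" by (cases "dropWhile Not \<eta>") auto
  with hd_dropWhile[OF assms] have "b" by simp
  then have "length (dropWhile id (dropWhile Not \<eta>)) < length (dropWhile Not \<eta>)"
    using r length_dropWhile_le[of id r] by simp
  also have "\<dots> \<le> length \<eta>" by (rule length_dropWhile_le)
  finally show ?thesis .
qed

function cluster_lengths :: "bool list \<Rightarrow> nat list" where
  "cluster_lengths \<eta> =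
     (let r = dropWhile Not \<eta>
      in if r = [] then [] else length (takeWhile id r) # cluster_lengths (dropWhile id r))"
  by auto
termination
  by (relation "Wellfounded.measure length") (auto simp del: dropWhile_eq_Nil_conv intro: length_dropWhile_id_less)

function gap_lengths :: "bool list \<Rightarrow> nat list" where
  "gap_lengths \<eta> =
     length (takeWhile Not \<eta>) #
     (let r = dropWhile Not \<eta>
      in if r = [] then [] else gap_lengths (dropWhile id r))"
  by auto
termination
  by (relation "Wellfounded.measure length") (auto simp del: dropWhile_eq_Nil_conv intro: length_dropWhile_id_less)

declare cluster_lengths.simps [simp del] gap_lengths.simps [simp del]

lemma length_gap_lengths: "length (gap_lengths \<eta>) = Suc (length (cluster_lengths \<eta>))"
proof (induction \<eta> rule: cluster_lengths.induct)
  case (1 \<eta>)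
  then show ?case
    by (subst gap_lengths.simps, subst cluster_lengths.simps)
      (simp add: Let_def del: dropWhile_eq_Nil_conv)
qed

definition num_clusters :: "bool list \<Rightarrow> nat" where
  "num_clusters \<eta> = length (cluster_lengths \<eta>)"

definition sigma :: "bool list \<Rightarrow> nat \<Rightarrow> nat" where
  "sigma \<eta> j = cluster_lengths \<eta> ! (j - 1)"

definition tau :: "bool list \<Rightarrow> nat \<Rightarrow> nat" where
  "tau \<eta> j = gap_lengths \<eta> ! j"

definition Psi :: "bool list \<Rightarrow> nat \<Rightarrow> nat" where
  "Psi \<eta> i = (\<Sum>j = i..num_clusters \<eta>. sigma \<eta> j)"

definition Phi :: "bool list \<Rightarrow> nat \<Rightarrow> nat" where
  "Phi \<eta> j = (\<Sum>k = j..num_clusters \<eta>. tau \<eta> k)"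

type_synonym node = "nat \<times> nat"

definition one_child :: "bool list \<Rightarrow> node \<Rightarrow> bool" where
  "one_child \<eta> = (\<lambda>(x, y).
     \<exists>i. 1 \<le> i \<and> i \<le> num_clusters \<eta> + 1 \<and> x = Psi \<eta> i \<and> Phi \<eta> i < y \<and> y \<le> Phi \<eta> (i - 1))"

definition two_children :: "bool list \<Rightarrow> node \<Rightarrow> bool" where
  "two_children \<eta> = (\<lambda>(x, y).
     \<exists>i. 1 \<le> i \<and> i \<le> num_clusters \<eta> \<and>
         ((x = Psi \<eta> i \<and> 1 \<le> y \<and> y \<le> Phi \<eta> i) \<or>
          (Psi \<eta> (i + 1) < x \<and> x < Psi \<eta> i \<and> 1 \<le> y \<and> y \<le> Phi \<eta> i)))"

inductive dehp_edge :: "bool list \<Rightarrow> node \<Rightarrow> node \<Rightarrow> bool" for \<eta> where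
  single: "one_child \<eta> (x, y) \<Longrightarrow> dehp_edge \<eta> (x, y) (x, y - 1)"
| down: "two_children \<eta> (x, y) \<Longrightarrow> dehp_edge \<eta> (x, y) (x, y - 1)"
| left: "two_children \<eta> (x, y) \<Longrightarrow> dehp_edge \<eta> (x, y) (x - 1, y)"

text \<open>The weight of an edge depends only on the node it leaves.\<close>

definition edge_weight :: "real \<Rightarrow> bool list \<Rightarrow> node \<Rightarrow> real" where
  "edge_weight \<alpha> \<eta> u = (if one_child \<eta> u then (1/4) / \<alpha> else 1/4)"

definition path_weight :: "real \<Rightarrow> bool list \<Rightarrow> node list \<Rightarrow> real" where
  "path_weight \<alpha> \<eta> us = (\<Prod>u\<leftarrow>butlast us. edge_weight \<alpha> \<eta> u)"

definition dehp_paths :: "bool list \<Rightarrow> nat \<Rightarrow> node list set" where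
  "dehp_paths \<eta> k =
     {us. us \<noteq> [] \<and> hd us = (Psi \<eta> 1, Phi \<eta> 0) \<and> last us = (k, 0) \<and> successively (dehp_edge \<eta>) us}"

definition Z :: "real \<Rightarrow> bool list \<Rightarrow> nat \<Rightarrow> real" where
  "Z \<alpha> \<eta> k = (\<Sum>us\<in>dehp_paths \<eta> k. path_weight \<alpha> \<eta> us)"

text \<open>The set of paths is finite, so that the sum above is a genuine one.\<close>

lemma Psi_antimono: "i \<le> j \<Longrightarrow> Psi \<eta> j \<le> Psi \<eta> i"
  unfolding Psi_def by (rule sum_mono2) auto

lemma two_children_pos: "two_children \<eta> (x, y) \<Longrightarrow> 0 < x \<and> 0 < y"
proof -
  assume "two_children \<eta> (x, y)"
  then obtain i where i: "1 \<le> i" "i \<le> num_clusters \<eta>" "1 \<le> y"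
    and x: "x = Psi \<eta> i \<or> Psi \<eta> (i + 1) < x"
    unfolding two_children_def by auto
  have pos: "\<forall>s\<in>set (cluster_lengths \<zeta>). 0 < s" for \<zeta>
  proof (induction \<zeta> rule: cluster_lengths.induct)
    case (1 \<zeta>)
    show ?case
    proof (cases "dropWhile Not \<zeta>")
      case Nil
      then show ?thesis by (subst cluster_lengths.simps) (simp add: Let_def del: dropWhile_eq_Nil_conv)
    next
      case (Cons b r)
      with hd_dropWhile[of Not \<zeta>] have "b" by simp
      with Cons 1[OF refl] show ?thesis
        by (subst cluster_lengths.simps) (simp add: Let_def del: dropWhile_eq_Nil_conv)
    qed
  qed
  have "0 < sigma \<eta> i"
    using i pos[of \<eta>] unfolding sigma_def num_clusters_def by auto
  moreover have "sigma \<eta> i \<le> Psi \<eta> i"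
    unfolding Psi_def using i by (intro member_le_sum) auto
  ultimately show ?thesis using x i by auto
qed

lemma dehp_edge_decreases:
  "dehp_edge \<eta> u v \<Longrightarrow> fst v \<le> fst u \<and> snd v \<le> snd u \<and> fst v + snd v < fst u + snd u"
  by (induction rule: dehp_edge.induct) (auto simp: one_child_def dest: two_children_pos)

lemma finite_dehp_paths: "finite (dehp_paths \<eta> k)"
proof -
  have *: "length us \<le> Suc (fst (hd us) + snd (hd us)) \<and>
           set us \<subseteq> {..fst (hd us)} \<times> {..snd (hd us)}"
    if "successively (dehp_edge \<eta>) us" "us \<noteq> []" for us
    using that
  proof (induction us rule: induct_list012)
    case (3 u v us)
    then show ?case using dehp_edge_decreases[of \<eta> u v] by fastforce
  qed auto
  have "dehp_paths \<eta> k \<subseteq>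
      {us. set us \<subseteq> {..Psi \<eta> 1} \<times> {..Phi \<eta> 0} \<and> length us \<le> Suc (Psi \<eta> 1 + Phi \<eta> 0)}"
    using * unfolding dehp_paths_def by fastforce
  then show ?thesis
    by (rule finite_subset) (intro finite_lists_length_le finite_cartesian_product finite_atMost)
qed

text \<open>List positions start at \<open>0\<close>: the coordinate \<open>\<eta>\<^sub>i\<close> is \<open>\<eta> ! (i - 1)\<close>.\<close>

definition B :: "nat \<Rightarrow> nat \<Rightarrow> nat \<Rightarrow> nat \<Rightarrow> bool list set" where
  "B M N m n =
     {\<eta>. length \<eta> = 2*M + 2*N + 1 \<and>
         (\<Sum>i = 1..M+N. of_bool (\<eta> ! (i - 1))) = m \<and>
         (\<Sum>j = M+N+1..2*M+2*N+1. of_bool (\<eta> ! (j - 1))) = n}"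

end

theory Submission
  imports Defs
begin

text \<open>
  Merging colors turns the statements into the survival of the discrepancy of a pair \<open>A \<subseteq> S\<close> of
  coupled one-species configurations.  The moves of a configuration \<open>A\<close> and of a word \<open>w\<close> are
  intertwined by \<open>flux A w = min\<^sub>k (#{y \<in> A. k < y} + k + #{ones of w beyond k})\<close>, so the average of
  \<open>flux S w - flux A w \<in> {0, 1}\<close> over stationary words is a harmonic function of \<open>(A, S)\<close>.  For the
  half line it is at most the indicator of \<open>A \<noteq> S\<close> and hence bounds the survival probability from
  below.  For a finite box with exit at rate \<open>1\<close> it is only superharmonic but equals \<open>1\<close> once the
  discrepancy is outside the box, where it eventually is if it survives; this gives an upper bound.
  Both kinds of weights come from the same operators \<open>D\<close>, \<open>E\<close> with different columns \<open>|V\<rangle>\<close>, and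
  the box weights converge to the half-line weights because the normalizations satisfy
  \<open>z\<^sub>n\<^sub>+\<^sub>1 / z\<^sub>n \<longlonglongrightarrow> 1\<close>.
\<close>


section \<open>Operators of the matrix ansatz\<close>

text \<open>The half-line function gives no upper bound because it depends on the whole
  configuration: a discrepancy that is far away does not by itself make the average close to 1. A
  box has this property by construction, so what remains is that a discrepancy cannot stay in a
  fixed box for long. A bounded Lyapunov function shows this for each box size, and the size tends
  to infinity only after the time. The assumption on \<alpha> enters through the column
  \<open>half_line_column\<close>. The factor 1/4 is the maximal current; with it the fixed columns
  of D + E obey a recursion with the double characteristic root 1/2, and the fixed column with first
  entry 1 is nonnegative as soon as 1/2 \<le> a. No sample paths are used. The process enters only
  through its laws at fixed times, and functions are compared with its semigroup by a maximum
  principle that works with right derivatives.\<close>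

text \<open>
  A column \<open>t\<close> lists the values \<open>t k = \<langle>W| D\<^sup>k |V\<rangle>\<close>, on which the letters act by
  \<open>D E = (D + E) / 4\<close> and \<open>\<langle>W| E = \<langle>W| / (4 a)\<close>.
\<close>

definition Dop :: "(nat \<Rightarrow> real) \<Rightarrow> nat \<Rightarrow> real" where
  "Dop t k = t (Suc k)"

primrec Eop :: "real \<Rightarrow> (nat \<Rightarrow> real) \<Rightarrow> nat \<Rightarrow> real" where
  "Eop a t 0 = t 0 / (4 * a)"
| "Eop a t (Suc k) = (t (Suc k) + Eop a t k) / 4"

primrec word_act :: "real \<Rightarrow> bool list \<Rightarrow> (nat \<Rightarrow> real) \<Rightarrow> nat \<Rightarrow> real" where
  "word_act a [] t = t"
| "word_act a (b # w) t = (if b then Dop else Eop a) (word_act a w t)"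

text \<open>This is \<open>\<langle>W| D\<^sup>k (\<Sum>w. f w \<cdot> w) |V\<rangle>\<close> over
  the words of length n. The recursion peels off the letter next to the row, as the inductions below
  do; \<open>mean_eq_sum\<close> recovers the explicit sum.\<close>

primrec mean :: "real \<Rightarrow> nat \<Rightarrow> (nat \<Rightarrow> real) \<Rightarrow> (bool list \<Rightarrow> real) \<Rightarrow> nat \<Rightarrow> real" where
  "mean a 0 t f = (\<lambda>k. f [] * t k)"
| "mean a (Suc n) t f =
     (\<lambda>k. Eop a (mean a n t (\<lambda>w. f (False # w))) k + Dop (mean a n t (\<lambda>w. f (True # w))) k)"

lemma Eop_add: "Eop a (\<lambda>k. s k + t k) k = Eop a s k + Eop a t k"
  by (induction k) (simp_all add: add_divide_distrib)

lemma Eop_cmult: "Eop a (\<lambda>k. c * t k) k = c * Eop a t k"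
  by (induction k) (simp_all add: field_simps)

lemma Eop_diff: "Eop a (\<lambda>k. s k - t k) k = Eop a s k - Eop a t k"
  using Eop_add[of a s "\<lambda>k. (-1) * t k" k] unfolding Eop_cmult by simp

lemma Eop_mono: "0 < a \<Longrightarrow> (\<And>k. s k \<le> t k) \<Longrightarrow> Eop a s k \<le> Eop a t k"
  by (induction k) (auto intro!: divide_right_mono add_mono)

lemma Eop_sum: "Eop a (\<lambda>k. \<Sum>i\<in>I. s i k) k = (\<Sum>i\<in>I. Eop a (s i) k)"
  by (induction k) (simp_all add: sum.distrib sum_divide_distrib[symmetric])

lemma Eop_tendsto: "(\<And>k. (\<lambda>m. s m k) \<longlonglongrightarrow> t k) \<Longrightarrow> (\<lambda>m. Eop a (s m) k) \<longlonglongrightarrow> Eop a t k"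
proof (induction k)
  case 0
  show ?case unfolding Eop.simps divide_inverse by (intro tendsto_mult_right 0)
next
  case (Suc k)
  show ?case unfolding Eop.simps
    by (intro tendsto_divide tendsto_add Suc tendsto_const) simp
qed

lemma mean_cong: "(\<And>w. length w = n \<Longrightarrow> f w = g w) \<Longrightarrow> mean a n t f = mean a n t g"
proof (induction n arbitrary: f g)
  case (Suc n)
  have "mean a n t (\<lambda>w. f (b # w)) = mean a n t (\<lambda>w. g (b # w))" for b
    by (rule Suc.IH) (simp add: Suc.prems)
  then show ?case by simp
qed simp

lemma mean_add: "mean a n t (\<lambda>w. f w + g w) k = mean a n t f k + mean a n t g k"
proof (induction n arbitrary: f g k)
  case (Suc n)
  have *: "mean a n t (\<lambda>w. f (b # w) + g (b # w)) = (\<lambda>k. mean a n t (\<lambda>w. f (b # w)) k + mean a n t (\<lambda>w. g (b # w)) k)" for b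
    by (rule ext) (rule Suc.IH)
  show ?case by (simp add: * Eop_add Dop_def)
qed (simp add: algebra_simps)

lemma mean_cmult: "mean a n t (\<lambda>w. c * f w) k = c * mean a n t f k"
proof (induction n arbitrary: f k)
  case (Suc n)
  have *: "mean a n t (\<lambda>w. c * f (b # w)) = (\<lambda>k. c * mean a n t (\<lambda>w. f (b # w)) k)" for b
    by (rule ext) (rule Suc.IH)
  show ?case by (simp add: * Eop_cmult Dop_def algebra_simps)
qed simp

lemma mean_diff: "mean a n t (\<lambda>w. f w - g w) k = mean a n t f k - mean a n t g k"
  using mean_add[of a n t f "\<lambda>w. (-1) * g w" k] unfolding mean_cmult by simp

lemma mean_zero [simp]: "mean a n t (\<lambda>w. 0) k = 0"
  using mean_cmult[of a n t 0 "\<lambda>w. 0" k] by simp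

lemma mean_sum: "mean a n t (\<lambda>w. \<Sum>x\<in>X. f x w) k = (\<Sum>x\<in>X. mean a n t (f x) k)"
  by (induction X rule: infinite_finite_induct) (simp_all add: mean_add)

lemma mean_mono:
  assumes "0 < a" "\<And>k. 0 \<le> t k" "\<And>w. length w = n \<Longrightarrow> f w \<le> g w"
  shows "mean a n t f k \<le> mean a n t g k"
  using assms(3)
proof (induction n arbitrary: f g k)
  case 0
  then show ?case using assms(2) by (simp add: mult_right_mono)
next
  case (Suc n)
  have "mean a n t (\<lambda>w. f (b # w)) k \<le> mean a n t (\<lambda>w. g (b # w)) k" for b k
    by (rule Suc.IH) (simp add: Suc.prems)
  then show ?case using assms(1) by (auto intro!: add_mono Eop_mono simp: Dop_def)
qed

lemma mean_tendsto:
  assumes "\<And>k. (\<lambda>m. s m k) \<longlonglongrightarrow> t k"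
  shows "(\<lambda>m. mean a n (s m) f k) \<longlonglongrightarrow> mean a n t f k"
proof (induction n arbitrary: f k)
  case 0
  then show ?case by (auto intro!: tendsto_mult_left assms)
next
  case (Suc n)
  show ?case unfolding mean.simps Dop_def
    by (intro tendsto_add Eop_tendsto Suc)
qed

lemma mean_column_cmult: "mean a n (\<lambda>k. c * t k) f k = c * mean a n t f k"
proof (induction n arbitrary: f k)
  case (Suc n)
  have *: "mean a n (\<lambda>k. c * t k) (\<lambda>w. f (b # w)) = (\<lambda>k. c * mean a n t (\<lambda>w. f (b # w)) k)" for b
    by (rule ext) (rule Suc.IH)
  show ?case by (simp add: * Eop_cmult Dop_def algebra_simps)
qed simp

lemma sum_lists_length_Suc:
  "(\<Sum>w | length w = Suc n. g w) = (\<Sum>w | length w = n. g (False # w)) + (\<Sum>w | length w = n. g (True # w :: bool list))"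
proof -
  have fin: "finite {w :: bool list. length w = n}" for n
    using finite_lists_length_eq[of "UNIV :: bool set" n] by simp
  have "{w. length w = Suc n} = Cons False ` {w. length w = n} \<union> Cons True ` {w. length w = n}"
    by (auto simp: length_Suc_conv image_iff) 
  then show ?thesis
    by (simp only:) (subst sum.union_disjoint, auto simp: fin sum.reindex)
qed

lemma mean_eq_sum: "mean a n t f k = (\<Sum>w | length w = n. f w * word_act a w t k)"
proof (induction n arbitrary: f k)
  case (Suc n)
  have *: "mean a n t f = (\<lambda>k. \<Sum>w | length w = n. f w * word_act a w t k)" for f
    by (rule ext) (rule Suc.IH)
  show ?case
    by (simp add: * sum_lists_length_Suc Eop_sum Dop_def Eop_cmult)
qed simp

section \<open>Moves of words and their averages\<close>

primrec hop_word :: "nat \<Rightarrow> bool list \<Rightarrow> bool list" where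
  "hop_word x [] = []"
| "hop_word x (b # w) =
     (case x of 0 \<Rightarrow> if b \<and> w \<noteq> [] \<and> \<not> hd w then False # True # tl w else b # w
      | Suc x \<Rightarrow> b # hop_word x w)"

lemma hop_word_Suc [simp]: "hop_word (Suc x) (b # w) = b # hop_word x w"
  by simp

lemma hop_word_0 [simp]:
  "hop_word 0 (a # b # w) = (if a \<and> \<not> b then False # True # w else a # b # w)"
  by simp

lemma hop_word_single [simp]: "hop_word x [b] = [b]"
  by (cases x) simp_all

declare hop_word.simps(2) [simp del]

lemma length_hop_word [simp]: "length (hop_word x w) = length w"
proof (induction w arbitrary: x)
  case (Cons b w)
  then show ?case
    by (cases x; cases w) (auto simp: hop_word.simps)
qed simp

text \<open>
  Each bond contributes a difference of two words with one site removed, by the relation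
  \<open>D E = (D + E) / 4\<close>; the contributions telescope.
\<close>

lemma mean_bulk:
  "mean a (Suc m) t (\<lambda>w. \<Sum>x<m. f (hop_word x w) - f w) k =
     (mean a m t (\<lambda>w. f (False # w) - f (True # w)) k
      - mean a m t (\<lambda>w. f (w @ [False]) - f (w @ [True])) k) / 4"
proof (induction m arbitrary: f k)
  case 0
  show ?case using Eop_cmult[of a 0 "\<lambda>_. 0" k] by (simp add: Dop_def)
next
  case (Suc m)
  \<comment> \<open>\<open>G\<close> fixes the first two letters; \<open>R\<close> fixes the first
    one and compares the two values of the last. The bond between the first two letters is split
    off, and the induction hypothesis handles the others.\<close>
  define G where "G b c = mean a m t (\<lambda>w. f (b # c # w))" for b c
  define R where "R b = mean a m t (\<lambda>w. f (b # w @ [False]) - f (b # w @ [True]))" for b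
  have split: "mean a (Suc m) t (\<lambda>w. \<Sum>x<Suc m. f (hop_word x (b # w)) - f (b # w)) k
      = mean a (Suc m) t (\<lambda>w. f (hop_word 0 (b # w)) - f (b # w)) k
        + (G b False k - G b True k - R b k) / 4" for b k
  proof -
    have "mean a (Suc m) t (\<lambda>w. \<Sum>x<Suc m. f (hop_word x (b # w)) - f (b # w)) k
      = mean a (Suc m) t (\<lambda>w. f (hop_word 0 (b # w)) - f (b # w)) k
       + mean a (Suc m) t (\<lambda>w. \<Sum>x<m. f (b # hop_word x w) - f (b # w)) k"
      unfolding mean_add[symmetric] sum.lessThan_Suc_shift hop_word_Suc ..
    then show ?thesis
      unfolding Suc.IH[of "\<lambda>w. f (b # w)" k] G_def R_def mean_diff[symmetric] by simp
  qed
  have bond_F: "mean a (Suc m) t (\<lambda>w. f (hop_word 0 (False # w)) - f (False # w)) k = 0" for k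
  proof -
    have "mean a (Suc m) t (\<lambda>w. f (hop_word 0 (False # w)) - f (False # w)) = mean a (Suc m) t (\<lambda>w. 0)"
      by (rule mean_cong) (auto simp: hop_word.simps)
    then show ?thesis by (simp del: mean.simps)
  qed
  have bond_T: "mean a (Suc m) t (\<lambda>w. f (hop_word 0 (True # w)) - f (True # w)) k
      = Eop a (\<lambda>k. G False True k - G True False k) k" for k
  proof -
    have "mean a m t (\<lambda>w. f (False # True # w) - f (True # False # w)) = (\<lambda>k. G False True k - G True False k)"
      unfolding G_def by (rule ext) (rule mean_diff)
    then show ?thesis by (simp add: Dop_def)
  qed
  have mean2: "mean a (Suc m) t (\<lambda>w. f (b # w)) k = Eop a (G b False) k + Dop (G b True) k" for b k
    by (simp add: G_def)
  have meanR: "mean a (Suc m) t (\<lambda>w. f (w @ [False]) - f (w @ [True])) k = Eop a (R False) k + Dop (R True) k"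
    by (simp add: R_def)
  have "mean a (Suc (Suc m)) t (\<lambda>w. \<Sum>x<Suc m. f (hop_word x w) - f w) k
    = Eop a (\<lambda>k. (1/4) * (G False False k - G False True k - R False k)) k
      + Dop (\<lambda>k. Eop a (\<lambda>k. G False True k - G True False k) k + (1/4) * (G True False k - G True True k - R True k)) k"
    unfolding mean.simps(2)[of a "Suc m"] split bond_F bond_T by simp
  \<comment> \<open>\<open>Eop\<close> under \<open>Dop\<close> is evaluated at
    \<open>Suc k\<close>, which is the relation for D E. It makes the terms \<open>Eop\<close> of
    \<open>G False True\<close> and \<open>Dop\<close> of \<open>G True False\<close>
    cancel.\<close>
  also have "\<dots> = (mean a (Suc m) t (\<lambda>w. f (False # w) - f (True # w)) k
      - mean a (Suc m) t (\<lambda>w. f (w @ [False]) - f (w @ [True])) k) / 4"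
    unfolding meanR mean_diff[of a "Suc m" t "\<lambda>w. f (False # w)"] mean2 Eop_cmult Eop_diff Dop_def Eop.simps
    by (simp add: field_simps)
  finally show ?case .
qed

definition inject_word :: "bool list \<Rightarrow> bool list" where
  "inject_word w = (if w = [] then [] else True # tl w)"

definition word_gen :: "real \<Rightarrow> (bool list \<Rightarrow> real) \<Rightarrow> bool list \<Rightarrow> real" where
  "word_gen a f w = (\<Sum>x<length w - 1. f (hop_word x w) - f w) + a * (f (inject_word w) - f w)"

text \<open>The rate a of the injection meets the factor 1 / (4 * a) of a leading 0, so the boundary
  cancels the left end of the telescoped bulk. Only the right end, where nothing leaves,
  remains.\<close>

lemma mean_word_gen:
  assumes "a \<noteq> 0"
  shows "mean a (Suc m) t (word_gen a f) 0 = mean a m t (\<lambda>w. f (w @ [True]) - f (w @ [False])) 0 / 4"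
proof -
  have "mean a (Suc m) t (word_gen a f) 0 =
      mean a (Suc m) t (\<lambda>w. (\<Sum>x<m. f (hop_word x w) - f w) + a * (f (inject_word w) - f w)) 0"
    by (rule arg_cong[where f = "\<lambda>g. g 0"], rule mean_cong) (simp add: word_gen_def)
  also have "\<dots> = mean a (Suc m) t (\<lambda>w. \<Sum>x<m. f (hop_word x w) - f w) 0
      + a * mean a (Suc m) t (\<lambda>w. f (inject_word w) - f w) 0"
    by (simp only: mean_add mean_cmult)
  also have "mean a (Suc m) t (\<lambda>w. f (inject_word w) - f w) 0 = mean a m t (\<lambda>w. f (True # w) - f (False # w)) 0 / (4 * a)"
    by (simp add: inject_word_def Dop_def)
  also have "mean a (Suc m) t (\<lambda>w. \<Sum>x<m. f (hop_word x w) - f w) 0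
      + a * (mean a m t (\<lambda>w. f (True # w) - f (False # w)) 0 / (4 * a))
      = mean a m t (\<lambda>w. f (w @ [True]) - f (w @ [False])) 0 / 4"
    using assms unfolding mean_bulk mean_diff by (simp add: field_simps)
  finally show ?thesis .
qed


section \<open>The half line as a limit of boxes\<close>

text \<open>A fixed column of D + E satisfies \<open>t (k + 2) = t (k + 1) - t k / 4\<close>. Its
  double root 1/2 explains the linear factor, whose slope is forced by \<open>t 0 = 1\<close> and
  \<open>t 1 = 1 - 1 / (4 * a)\<close>.\<close>

definition half_line_column :: "real \<Rightarrow> nat \<Rightarrow> real" where
  "half_line_column a k = 1 / 2 ^ k * (1 + (a - 1/2) / a * real k)"

lemma half_line_column_0 [simp]: "half_line_column a 0 = 1"
  by (simp add: half_line_column_def)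

lemma half_line_column_1: "a \<noteq> 0 \<Longrightarrow> half_line_column a (Suc 0) = 1 - 1 / (4 * a)"
  by (simp add: half_line_column_def field_simps)

lemma half_line_column_Suc_Suc:
  "half_line_column a (Suc (Suc k)) = half_line_column a (Suc k) - half_line_column a k / 4"
proof -
  define g where "g = (a - 1/2) / a"
  show ?thesis unfolding half_line_column_def g_def[symmetric] by (simp add: field_simps)
qed

lemma half_line_column_nonneg: "1/2 \<le> a \<Longrightarrow> 0 \<le> half_line_column a k"
  by (simp add: half_line_column_def)

lemma half_line_column_invariant:
  assumes "a \<noteq> 0"
  shows "Eop a (half_line_column a) k + half_line_column a (Suc k) = half_line_column a k"
proof (induction k)
  case 0
  then show ?case using assms by (simp add: half_line_column_1)
next
  case (Suc k)
  then show ?case by (simp add: half_line_column_Suc_Suc field_simps)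
qed

text \<open>A column fixed by D + E absorbs the last letter when that letter is summed out, so the
  weights of words of different lengths are consistent.\<close>

lemma mean_butlast:
  assumes "\<And>k. Eop a t k + t (Suc k) = t k"
  shows "mean a (Suc m) t (\<lambda>w. f (butlast w)) = mean a m t f"
proof (induction m arbitrary: f)
  case 0
  show ?case using assms by (auto simp: Dop_def Eop_cmult fun_eq_iff distrib_left[symmetric])
next
  case (Suc m)
  have "mean a (Suc m) t (\<lambda>w. f (butlast (b # w))) = mean a m t (\<lambda>w. f (b # w))" for b
  proof -
    have "mean a (Suc m) t (\<lambda>w. f (butlast (b # w))) = mean a (Suc m) t (\<lambda>w. f (b # butlast w))"
      by (rule mean_cong) auto
    then show ?thesis using Suc.IH[of "\<lambda>w. f (b # w)"] by simp
  qed
  then show ?case by (simp only: mean.simps(2)[of a "Suc m"] mean.simps(2)[of a m])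
qed

lemma mean_one:
  assumes "\<And>k. Eop a t k + t (Suc k) = t k"
  shows "mean a m t (\<lambda>w. 1) = t"
proof (induction m)
  case (Suc m)
  then show ?case using mean_butlast[OF assms, of m "\<lambda>_. 1"] by (simp del: mean.simps)
qed simp

text \<open>The letters behind the first m act on the column alone, as
  \<open>(D + E)\<^sup>n\<close>.\<close>

lemma mean_take: "mean a (m + n) t (\<lambda>w. f (take m w)) = mean a m (mean a n t (\<lambda>w. 1)) f"
proof (induction m arbitrary: f)
  case 0
  show ?case using mean_cmult[of a n t "f []" "\<lambda>_. 1"] by (simp add: fun_eq_iff)
next
  case (Suc m)
  show ?case using Suc.IH[of "\<lambda>w. f (b # w)" for b] by simp
qed

lemma mean_snoc: "mean a (Suc m) t (\<lambda>w. if last w then f (butlast w) else 0) k = mean a m (Dop t) f k"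
proof (induction m arbitrary: f k)
  case 0
  show ?case using Eop_cmult[of a 0 "\<lambda>_. 0" k] by (simp add: Dop_def)
next
  case (Suc m)
  have "mean a (Suc m) t (\<lambda>w. if last (b # w) then f (butlast (b # w)) else 0)
      = mean a m (Dop t) (\<lambda>w. f (b # w))" for b
  proof -
    have "mean a (Suc m) t (\<lambda>w. if last (b # w) then f (butlast (b # w)) else 0)
       = mean a (Suc m) t (\<lambda>w. if last w then f (b # butlast w) else 0)"
      by (rule mean_cong) auto
    then show ?thesis using Suc.IH[of "\<lambda>w. f (b # w)"] by (auto simp del: mean.simps)
  qed
  then show ?case by (simp only: mean.simps(2)[of a "Suc m"] mean.simps(2)[of a m])
qed

text \<open>Exit at rate \<open>1\<close> from the last site of a box means \<open>D |V\<rangle> = |V\<rangle> / 4\<close>.\<close>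

definition box_column :: "nat \<Rightarrow> real" where
  "box_column k = 1 / 4 ^ k"

text \<open>This is \<open>\<langle>W| D\<^sup>k (D + E)\<^sup>m |V\<rangle>\<close>, at k = 0 the
  normalization of a box with m sites. The other k are carried along because the recursion in m does
  not close at k = 0.\<close>

definition tau_column :: "real \<Rightarrow> nat \<Rightarrow> nat \<Rightarrow> real" where
  "tau_column a m = mean a m box_column (\<lambda>w. 1)"

lemma tau_column_0: "tau_column a 0 k = 1 / 4 ^ k"
  by (simp add: tau_column_def box_column_def)

lemma tau_column_Suc: "tau_column a (Suc m) k = Eop a (tau_column a m) k + tau_column a m (Suc k)"
  by (simp add: tau_column_def Dop_def)

lemma tau_column_Suc_0: "tau_column a (Suc m) 0 = tau_column a m 0 / (4 * a) + tau_column a m (Suc 0)"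
  by (simp add: tau_column_Suc)

lemma tau_column_Suc_Suc:
  "tau_column a (Suc m) (Suc k) = tau_column a m (Suc (Suc k)) + tau_column a (Suc m) k / 4"
  by (simp add: tau_column_Suc field_simps)

lemma tau_column_pos:
  assumes "0 < a" shows "0 < tau_column a m k"
proof (induction m arbitrary: k)
  case (Suc m)
  show ?case
  proof (induction k)
    case 0
    then show ?case using assms Suc by (simp add: tau_column_Suc_0 add_pos_pos)
  next
    case (Suc k)
    then show ?case using \<open>\<And>k. 0 < tau_column a m k\<close> by (simp add: tau_column_Suc_Suc add_pos_pos)
  qed
qed (simp add: tau_column_0)

text \<open>D + E is monotone and fixes \<open>half_line_column\<close>, so the comparison of the
  two columns at m = 0 persists.\<close>

lemma tau_column_le:
  assumes "1/2 \<le> a" shows "tau_column a m k \<le> half_line_column a k"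
proof (induction m arbitrary: k)
  case 0
  have "(1::real) / 4 ^ k \<le> 1 / 2 ^ k" by (simp add: frac_le power_mono)
  also have "\<dots> \<le> half_line_column a k"
    unfolding half_line_column_def
    using assms mult_left_mono[of 1 "1 + (a - 1/2) / a * real k" "1 / 2 ^ k"] by simp
  finally show ?case by (simp add: tau_column_0)
next
  case (Suc m)
  have "tau_column a (Suc m) k \<le> Eop a (half_line_column a) k + half_line_column a (Suc k)"
    unfolding tau_column_Suc using assms Suc by (intro add_mono Eop_mono) auto
  then show ?case using half_line_column_invariant[of a k] assms by simp
qed

section \<open>Growth ratios of the normalizations\<close>

definition growth :: "real \<Rightarrow> nat \<Rightarrow> nat \<Rightarrow> real" where
  "growth a m k = tau_column a (Suc m) k / tau_column a m k"

lemma tau_column_growth: "0 < a \<Longrightarrow> tau_column a (Suc m) k = growth a m k * tau_column a m k"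
  using tau_column_pos[of a m k] by (simp add: growth_def)

text \<open>\<open>tau_column a (Suc m) k\<close> is a positive combination of the values
  \<open>tau_column a m j\<close> with j \<le> k + 1. Its growth ratio is therefore a weighted mean
  of the ratios \<open>growth a m j\<close>, the largest of which belongs to j = k + 1.\<close>

lemma growth_Suc_le:
  assumes "0 < a" and mono: "\<And>k. growth a m k \<le> growth a m (Suc k)"
  shows "growth a (Suc m) k \<le> growth a m (Suc k)"
proof -
  note g = tau_column_growth[OF assms(1)] and pos = tau_column_pos[OF assms(1)]
  have "tau_column a (Suc (Suc m)) k \<le> growth a m (Suc k) * tau_column a (Suc m) k"
  proof (induction k)
    case 0
    have "growth a m 0 * tau_column a m 0 \<le> growth a m (Suc 0) * tau_column a m 0"
      using mono pos by (auto intro!: mult_right_mono less_imp_le)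
    then have "growth a m 0 * tau_column a m 0 / (4 * a) \<le> growth a m (Suc 0) * tau_column a m 0 / (4 * a)"
      using assms(1) by (intro divide_right_mono) auto
    then have "tau_column a (Suc m) 0 / (4 * a) + tau_column a (Suc m) (Suc 0)
        \<le> growth a m (Suc 0) * (tau_column a m 0 / (4 * a) + tau_column a m (Suc 0))"
      unfolding g[of m] by (simp add: distrib_left)
    then show ?case
      unfolding tau_column_Suc_0[of a "Suc m"] tau_column_Suc_0[of a m, symmetric] .
  next
    case (Suc k)
    have "growth a m (Suc k) * tau_column a m (Suc (Suc k)) \<le> growth a m (Suc (Suc k)) * tau_column a m (Suc (Suc k))"
      "growth a m (Suc k) * tau_column a (Suc m) k \<le> growth a m (Suc (Suc k)) * tau_column a (Suc m) k"
      using mono pos by (auto intro!: mult_right_mono less_imp_le)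
    moreover have "tau_column a (Suc (Suc m)) (Suc k)
        = growth a m (Suc (Suc k)) * tau_column a m (Suc (Suc k)) + tau_column a (Suc (Suc m)) k / 4"
      by (simp only: tau_column_Suc_Suc[of a "Suc m" k] g[of m "Suc (Suc k)"])
    ultimately show ?case unfolding tau_column_Suc_Suc[of a m] using Suc by (simp add: distrib_left)
  qed
  then show ?thesis using pos by (simp add: growth_def[of a "Suc m"] divide_le_eq)
qed

text \<open>By \<open>tau_column_Suc_Suc\<close>, \<open>growth a (Suc m) (Suc k)\<close> is a
  mediant of \<open>growth a m (Suc (Suc k))\<close> and \<open>growth a (Suc m) k\<close>. The
  first of these is at least the second by \<open>growth_Suc_le\<close>.\<close>

lemma growth_mono_column:
  assumes "0 < a"
  shows "growth a m k \<le> growth a m (Suc k)"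
proof (induction m arbitrary: k)
  case 0
  have "tau_column a (Suc 0) (Suc k) = 1 / 4 ^ (k + 2) + tau_column a (Suc 0) k / 4"
    unfolding tau_column_Suc_Suc tau_column_0 by simp
  then have "tau_column a (Suc 0) k \<le> 4 * tau_column a (Suc 0) (Suc k)"
    by simp
  then show ?case unfolding growth_def tau_column_0
    by (simp add: field_simps)
next
  case (Suc m)
  note g = tau_column_growth[OF assms(1)] and pos = tau_column_pos[OF assms(1)]
  have "growth a (Suc m) k \<le> growth a m (Suc (Suc k))"
    using growth_Suc_le[OF assms Suc, of k] Suc[of "Suc k"] by linarith
  then have "growth a (Suc m) k * tau_column a m (Suc (Suc k)) \<le> tau_column a (Suc m) (Suc (Suc k))"
    using pos[of m "Suc (Suc k)"] unfolding g[of m "Suc (Suc k)"] by (intro mult_right_mono) auto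
  then have "growth a (Suc m) k * tau_column a (Suc m) (Suc k) \<le> tau_column a (Suc (Suc m)) (Suc k)"
    unfolding tau_column_Suc_Suc[of a m] tau_column_Suc_Suc[of a "Suc m"] g[of "Suc m" k] by (simp add: distrib_left)
  then show ?case using pos by (simp add: growth_def[of a "Suc m" "Suc k"] le_divide_eq)
qed

text \<open>Again a mediant: \<open>growth a (Suc m) 0\<close> lies between
  \<open>growth a m 0\<close> and \<open>growth a m (Suc 0)\<close>.\<close>

lemma growth_incseq:
  assumes "0 < a"
  shows "incseq (\<lambda>m. growth a m 0)"
proof (rule incseq_SucI)
  fix m
  note g = tau_column_growth[OF assms(1)] and pos = tau_column_pos[OF assms(1)]
  have "growth a m 0 * tau_column a m (Suc 0) \<le> growth a m (Suc 0) * tau_column a m (Suc 0)"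
    using growth_mono_column[OF assms] pos by (auto intro!: mult_right_mono less_imp_le)
  then have "growth a m 0 * (tau_column a m 0 / (4 * a) + tau_column a m (Suc 0))
      \<le> tau_column a (Suc m) 0 / (4 * a) + tau_column a (Suc m) (Suc 0)"
    unfolding g[of m] by (simp add: distrib_left)
  then have "growth a m 0 * tau_column a (Suc m) 0 \<le> tau_column a (Suc (Suc m)) 0"
    unfolding tau_column_Suc_0[of a "Suc m"] tau_column_Suc_0[of a m, symmetric] .
  then show "growth a m 0 \<le> growth a (Suc m) 0"
    using pos by (simp add: growth_def[of a "Suc m"] le_divide_eq)
qed

text \<open>As the ratios increase, one ratio above 1 would force geometric growth, against the
  bound of \<open>tau_column a m 0\<close> by 1.\<close>

lemma growth_le_1:
  assumes "1/2 \<le> a"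
  shows "growth a m 0 \<le> 1"
proof (rule ccontr)
  have a: "0 < a" using assms by simp
  assume "\<not> growth a m 0 \<le> 1"
  then have r: "1 < growth a m 0" by simp
  have "tau_column a m 0 * growth a m 0 ^ j \<le> tau_column a (m + j) 0" for j
  proof (induction j)
    case (Suc j)
    have "tau_column a m 0 * growth a m 0 ^ Suc j \<le> growth a m 0 * tau_column a (m + j) 0"
      using Suc r by (simp add: mult.left_commute mult.commute)
    also have "\<dots> \<le> growth a (m + j) 0 * tau_column a (m + j) 0"
      using growth_incseq[OF a] tau_column_pos[OF a] by (intro mult_right_mono) (auto simp: incseq_def less_imp_le)
    finally show ?case by (simp add: tau_column_growth[OF a])
  qed simp
  moreover obtain j where "1 / tau_column a m 0 < growth a m 0 ^ j"
    using real_arch_pow[OF r] by blast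
  ultimately have "1 < tau_column a (m + j) 0"
    using tau_column_pos[OF a, of m 0] by (smt (verit) divide_less_eq mult.commute)
  then show False using tau_column_le[OF assms, of "m + j" 0] by simp
qed

text \<open>For a ratio \<open>l < 1\<close> the recursion has complex characteristic roots, so its solutions oscillate.\<close>

lemma oscillating_recursion:
  fixes u :: "nat \<Rightarrow> real"
  assumes rec: "\<And>k. u (Suc (Suc k)) = l * (u (Suc k) - u k / 4)"
    and nonneg: "\<And>k. 0 \<le> u k" and u0: "u 0 = 1" and l: "0 < l" "l \<le> 1"
  shows "l = 1"
proof (rule ccontr)
  assume "l \<noteq> 1"
  then have l1: "l < 1" using l by simp
  have pos: "0 < u k" for k
  proof (induction k)
    case (Suc k)
    show ?case
    proof (rule ccontr)
      assume "\<not> 0 < u (Suc k)"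
      then have "u (Suc k) = 0" using nonneg[of "Suc k"] by simp
      then have "u (Suc (Suc k)) < 0" using rec[of k] Suc l by (simp add: mult_pos_neg)
      then show False using nonneg[of "Suc (Suc k)"] by simp
    qed
  qed (simp add: u0)
  define r where "r k = u (Suc k) / u k" for k
  have rpos: "0 < r k" for k using pos by (simp add: r_def)
  have rrec: "r (Suc k) = l - l / (4 * r k)" for k
    using pos[of k] pos[of "Suc k"] unfolding r_def rec by (simp add: field_simps)
  \<comment> \<open>Completing the square turns the decrease of the ratio, r + l / (4 r) - l, into
    (r - l/2)^2 / r + d / r. Positivity of d is the negative discriminant, and each step lowers the
    ratio by at least \<open>d / r 0\<close>.\<close>
  define d where "d = l * (1 - l) / 4"
  have d: "0 < d" using l l1 by (simp add: d_def)
  have step: "r (Suc k) \<le> r k - d / r k" for k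
  proof -
    have "r k - d / r k - r (Suc k) = (r k - l / 2)^2 / r k"
      using rpos[of k] unfolding rrec d_def by (simp add: field_simps power2_eq_square)
    then show ?thesis using rpos[of k] by (smt (verit) divide_nonneg_pos zero_le_power2)
  qed
  have dec: "r k \<le> r 0" for k
  proof (induction k)
    case (Suc k)
    then show ?case using step[of k] rpos[of k] d by (smt (verit) divide_pos_pos)
  qed simp
  have "r k \<le> r 0 - real k * (d / r 0)" for k
  proof (induction k)
    case (Suc k)
    have "d / r 0 \<le> d / r k" using dec[of k] rpos d by (intro divide_left_mono) auto
    then show ?case using Suc step[of k] by (simp add: algebra_simps add_divide_distrib)
  qed simp
  moreover obtain k where "r 0 / (d / r 0) < real k" using reals_Archimedean2 by blast
  then have "r 0 < real k * (d / r 0)" using d rpos[of 0] by (simp add: pos_divide_less_eq pos_less_divide_eq)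
  ultimately have "r k < 0" by (smt (verit))
  then show False using rpos[of k] by simp
qed

text \<open>The recursion expresses level m at \<open>Suc (Suc k)\<close> by level
  \<open>Suc m\<close> at smaller indices. After division by the entry at 0 both levels have the
  same limits, so the limiting recursion closes in k, with the limit of the growth ratio as a
  factor.\<close>

lemma growth_tendsto_aux:
  assumes "0 < a" "(\<lambda>m. growth a m 0) \<longlonglongrightarrow> l"
    and u: "u 0 = 1" "u (Suc 0) = l - 1 / (4 * a)" "\<And>k. u (Suc (Suc k)) = l * (u (Suc k) - u k / 4)"
  shows "(\<lambda>m. tau_column a m k / tau_column a m 0) \<longlonglongrightarrow> u k"
proof (induction k rule: induct_nat_012)
  case 0
  then show ?case using tau_column_pos[OF assms(1)] by (simp add: u less_imp_neq[symmetric])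
next
  case 1
  have "tau_column a m (Suc 0) / tau_column a m 0 = growth a m 0 - 1 / (4 * a)" for m
    using tau_column_pos[OF assms(1), of m 0] unfolding growth_def tau_column_Suc_0 by (simp add: field_simps)
  then show ?case using assms(2) by (auto simp: u intro!: tendsto_diff)
next
  case (ge2 k)
  have "tau_column a m (Suc (Suc k)) / tau_column a m 0 =
      growth a m 0 * (tau_column a (Suc m) (Suc k) / tau_column a (Suc m) 0
        - tau_column a (Suc m) k / tau_column a (Suc m) 0 / 4)" for m
    using tau_column_pos[OF assms(1), of m 0] tau_column_pos[OF assms(1), of "Suc m" 0]
    unfolding growth_def tau_column_Suc_Suc by (simp add: field_simps)
  then show ?case unfolding u
    using ge2[THEN LIMSEQ_Suc] assms(2) by (simp only:) (intro tendsto_intros; simp)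
qed

fun ratio_limit :: "real \<Rightarrow> real \<Rightarrow> nat \<Rightarrow> real" where
  "ratio_limit a l 0 = 1"
| "ratio_limit a l (Suc 0) = l - 1 / (4 * a)"
| "ratio_limit a l (Suc (Suc k)) = l * (ratio_limit a l (Suc k) - ratio_limit a l k / 4)"

lemma growth_tendsto:
  assumes "1/2 \<le> a"
  shows "(\<lambda>m. growth a m 0) \<longlonglongrightarrow> 1"
proof -
  have a: "0 < a" using assms by simp
  obtain l where l: "(\<lambda>m. growth a m 0) \<longlonglongrightarrow> l" and up: "\<And>m. growth a m 0 \<le> l"
    using incseq_convergent[OF growth_incseq[OF a]] growth_le_1[OF assms] by blast
  have "0 < growth a 0 0" using tau_column_pos[OF a] by (simp add: growth_def)
  then have l0: "0 < l" using up[of 0] by simp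
  have l1: "l \<le> 1" using l growth_le_1[OF assms] by (intro LIMSEQ_le_const2) auto
  have lim: "(\<lambda>m. tau_column a m k / tau_column a m 0) \<longlonglongrightarrow> ratio_limit a l k" for k
    by (rule growth_tendsto_aux[OF a l]) simp_all
  have "0 \<le> ratio_limit a l k" for k
    using tau_column_pos[OF a] by (intro LIMSEQ_le_const[OF lim]) (auto simp: less_imp_le)
  then have "l = 1" using oscillating_recursion[of "ratio_limit a l" l] l0 l1 by simp
  with l show ?thesis by simp
qed

lemma tau_column_ratio_tendsto:
  assumes "1/2 \<le> a"
  shows "(\<lambda>m. tau_column a m k / tau_column a m 0) \<longlonglongrightarrow> half_line_column a k"
  using assms half_line_column_1[of a]
  by (intro growth_tendsto_aux[OF _ growth_tendsto]) (auto simp: half_line_column_Suc_Suc)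

lemma tau_column_shift_tendsto:
  assumes "1/2 \<le> a"
  shows "(\<lambda>m. tau_column a (n + m) 0 / tau_column a m 0) \<longlonglongrightarrow> 1"
proof (induction n)
  case 0
  have "0 < tau_column a m 0" for m using assms by (intro tau_column_pos) simp
  then show ?case by (simp add: less_imp_neq[symmetric])
next
  case (Suc n)
  have pos: "0 < tau_column a m 0" for m using assms by (intro tau_column_pos) simp
  have "tau_column a (Suc n + m) 0 / tau_column a m 0 = growth a (m + n) 0 * (tau_column a (n + m) 0 / tau_column a m 0)" for m
    using pos[of "n + m"] by (simp add: growth_def add.commute)
  note eq = this
  show ?case unfolding eq
    using tendsto_mult[OF LIMSEQ_ignore_initial_segment[OF growth_tendsto[OF assms], of n] Suc] by simp
qed

text \<open>Summing out the last m letters replaces the column by \<open>tau_column a m\<close>,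
  which becomes \<open>half_line_column\<close> after division by its first entry. The remaining
  quotient of normalizations tends to 1.\<close>

lemma box_mean_tendsto:
  assumes "1/2 \<le> a"
  shows "(\<lambda>m. mean a (n + m) box_column (\<lambda>w. f (take n w)) 0 / tau_column a (n + m) 0)
     \<longlonglongrightarrow> mean a n (half_line_column a) f 0"
proof -
  have pos: "0 < tau_column a m k" for m k using assms by (intro tau_column_pos) simp
  have "mean a (n + m) box_column (\<lambda>w. f (take n w)) 0 / tau_column a (n + m) 0 =
     mean a n (\<lambda>k. tau_column a m k / tau_column a m 0) f 0 / (tau_column a (n + m) 0 / tau_column a m 0)" for m
  proof -
    have "mean a n (\<lambda>k. tau_column a m k / tau_column a m 0) f 0 = mean a n (tau_column a m) f 0 / tau_column a m 0"
      using mean_column_cmult[of a n "1 / tau_column a m 0" "tau_column a m" f 0] by simp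
    then show ?thesis unfolding mean_take tau_column_def[symmetric] using pos[of m 0] by simp
  qed
  note eq = this
  have "(\<lambda>m. mean a n (\<lambda>k. tau_column a m k / tau_column a m 0) f 0) \<longlonglongrightarrow> mean a n (half_line_column a) f 0"
    by (rule mean_tendsto) (rule tau_column_ratio_tendsto[OF assms])
  from tendsto_divide[OF this tau_column_shift_tendsto[OF assms, of n]]
  show ?thesis unfolding eq by simp
qed


section \<open>Maximum principle for jump chains\<close>

text \<open>\<open>J i\<close> lists the possible targets of a jump from i. The function
  \<open>V\<close>, with finite level sets and at most exponential growth along the chain, is the
  substitute for compactness in the maximum principle.\<close>

locale jump_chain =
  fixes E :: "'s set" and p :: "real \<Rightarrow> 's \<Rightarrow> 's \<Rightarrow> real" and q :: "'s \<Rightarrow> 's \<Rightarrow> real"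
    and J :: "'s \<Rightarrow> 's set" and V :: "'s \<Rightarrow> real"
  assumes transition: "transition_function E p" and rates: "has_jump_rates E p q"
    and finite_J: "i \<in> E \<Longrightarrow> finite (J i)" and J_subset: "i \<in> E \<Longrightarrow> J i \<subseteq> E - {i}"
    and q_zero: "i \<in> E \<Longrightarrow> j \<in> E \<Longrightarrow> j \<noteq> i \<Longrightarrow> j \<notin> J i \<Longrightarrow> q i j = 0"
    and q_nonneg: "i \<in> E \<Longrightarrow> j \<in> E \<Longrightarrow> 0 \<le> q i j"
    and V_nonneg: "i \<in> E \<Longrightarrow> 0 \<le> V i"
    and finite_level: "finite {i \<in> E. V i \<le> v}"
    and V_drift: "i \<in> E \<Longrightarrow> (\<Sum>j\<in>J i. q i j * (V j - V i)) \<le> V i + 1"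
begin

definition gen :: "('s \<Rightarrow> real) \<Rightarrow> 's \<Rightarrow> real" where
  "gen u i = (\<Sum>j\<in>J i. q i j * (u j - u i))"

definition sg :: "real \<Rightarrow> ('s \<Rightarrow> real) \<Rightarrow> 's \<Rightarrow> real" where
  "sg t f i = (\<Sum>\<^sub>\<infinity>j\<in>E. p t i j * f j)"

lemma p_nonneg: "0 \<le> t \<Longrightarrow> i \<in> E \<Longrightarrow> j \<in> E \<Longrightarrow> 0 \<le> p t i j"
  and p_sum: "0 \<le> t \<Longrightarrow> i \<in> E \<Longrightarrow> (p t i has_sum 1) E"
  and p_0: "i \<in> E \<Longrightarrow> j \<in> E \<Longrightarrow> p 0 i j = of_bool (i = j)"
  and p_add: "0 \<le> s \<Longrightarrow> 0 \<le> t \<Longrightarrow> i \<in> E \<Longrightarrow> j \<in> E \<Longrightarrow> ((\<lambda>k. p s i k * p t k j) has_sum p (s + t) i j) E"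
  using transition unfolding transition_function_def by auto

lemma p_abs_summable:
  assumes "0 \<le> t" "i \<in> E" "\<And>j. j \<in> E \<Longrightarrow> \<bar>f j\<bar> \<le> C"
  shows "(\<lambda>j. norm (p t i j * f j)) summable_on E"
proof (rule Infinite_Sum.abs_summable_on_comparison_test)
  have "p t i summable_on E" using p_sum[OF assms(1,2)] by (rule has_sum_imp_summable)
  then have "(\<lambda>j. p t i j * C) summable_on E" by (rule summable_on_cmult_left)
  then show "(\<lambda>j. norm (p t i j * C)) summable_on E"
    by (rule summable_on_iff_abs_summable_on_real[THEN iffD1])
  show "norm (p t i j * f j) \<le> norm (p t i j * C)" if "j \<in> E" for j
    using p_nonneg[OF assms(1,2) that] assms(3)[OF that] by (auto simp: abs_mult intro!: mult_left_mono)
qed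

lemmas p_summable = p_abs_summable[THEN Infinite_Sum.abs_summable_summable]

lemma sg_bounded:
  assumes "0 \<le> t" "i \<in> E" "\<And>j. j \<in> E \<Longrightarrow> \<bar>f j\<bar> \<le> C"
  shows "\<bar>sg t f i\<bar> \<le> C"
proof -
  have s: "((\<lambda>j. p t i j * C) has_sum C) E"
    using has_sum_cmult_left[OF p_sum[OF assms(1,2)], of C] by simp
  have s': "((\<lambda>j. - (p t i j * C)) has_sum - C) E"
    using s by (rule has_sum_uminusI)
  have f: "((\<lambda>j. p t i j * f j) has_sum sg t f i) E"
    unfolding sg_def using p_summable[OF assms] by simp
  have le: "p t i j * f j \<le> p t i j * C" "- (p t i j * C) \<le> p t i j * f j" if "j \<in> E" for j
    using p_nonneg[OF assms(1,2) that] assms(3)[OF that]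
      mult_left_mono[of "f j" C "p t i j"] mult_left_mono[of "- C" "f j" "p t i j"]
    by (auto simp: abs_le_iff)
  have "sg t f i \<le> C" by (rule has_sum_mono[OF f s]) (rule le)
  moreover have "- C \<le> sg t f i"
    by (rule has_sum_mono[OF s' f]) (rule le)
  ultimately show ?thesis by (simp add: abs_le_iff)
qed

lemma sg_0: "i \<in> E \<Longrightarrow> sg 0 f i = f i"
proof -
  assume i: "i \<in> E"
  have "sg 0 f i = (\<Sum>\<^sub>\<infinity>j\<in>{i}. f j)"
    unfolding sg_def by (rule infsum_cong_neutral) (auto simp: p_0 i)
  then show ?thesis by simp
qed

lemma sg_add:
  assumes "0 \<le> s" "0 \<le> t" "i \<in> E" and f: "\<And>j. j \<in> E \<Longrightarrow> \<bar>f j\<bar> \<le> C"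
  shows "sg (s + t) f i = sg s (sg t f) i"
proof -
  have "(\<lambda>x. norm (case x of (k, j) \<Rightarrow> p s i k * (p t k j * f j))) summable_on (E \<times> E)"
    unfolding Infinite_Sum.abs_summable_on_Sigma_iff
  proof (intro conjI ballI)
    fix k assume k: "k \<in> E"
    show "(\<lambda>j. norm (case (k, j) of (k, j) \<Rightarrow> p s i k * (p t k j * f j))) summable_on E"
      using summable_on_cmult_right[where c = "\<bar>p s i k\<bar>", OF p_abs_summable[OF assms(2) k f]]
      by (simp add: abs_mult)
  next
    have "(\<lambda>k. norm (p s i k * sg t (\<lambda>j. \<bar>f j\<bar>) k)) summable_on E"
      using sg_bounded[OF assms(2), of _ "\<lambda>j. \<bar>f j\<bar>" C] f by (intro p_abs_summable assms) auto
    moreover have "(\<Sum>\<^sub>\<infinity>j\<in>E. norm (case (k, j) of (k, j) \<Rightarrow> p s i k * (p t k j * f j)))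
        = p s i k * sg t (\<lambda>j. \<bar>f j\<bar>) k" if "k \<in> E" for k
    proof -
      have "(\<Sum>\<^sub>\<infinity>j\<in>E. norm (case (k, j) of (k, j) \<Rightarrow> p s i k * (p t k j * f j)))
         = (\<Sum>\<^sub>\<infinity>j\<in>E. p s i k * (p t k j * \<bar>f j\<bar>))"
        by (rule infsum_cong) (simp add: abs_mult p_nonneg assms that)
      then show ?thesis by (simp add: sg_def infsum_cmult_right')
    qed
    ultimately show "(\<lambda>k. norm (\<Sum>\<^sub>\<infinity>j\<in>E. norm (case (k, j) of (k, j) \<Rightarrow> p s i k * (p t k j * f j)))) summable_on E"
      by (simp cong: summable_on_cong)
  qed
  then have "(\<lambda>(k, j). p s i k * (p t k j * f j)) summable_on (E \<times> E)"
    by (rule Infinite_Sum.abs_summable_summable)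
  then have "(\<Sum>\<^sub>\<infinity>k\<in>E. \<Sum>\<^sub>\<infinity>j\<in>E. p s i k * (p t k j * f j)) = (\<Sum>\<^sub>\<infinity>j\<in>E. \<Sum>\<^sub>\<infinity>k\<in>E. p s i k * (p t k j * f j))"
    by (rule infsum_swap_banach)
  also have "\<dots> = (\<Sum>\<^sub>\<infinity>j\<in>E. p (s + t) i j * f j)"
  proof (rule infsum_cong)
    fix j assume j: "j \<in> E"
    have "(\<Sum>\<^sub>\<infinity>k\<in>E. p s i k * (p t k j * f j)) = (\<Sum>\<^sub>\<infinity>k\<in>E. (p s i k * p t k j) * f j)"
      by (simp add: mult.assoc)
    also have "\<dots> = p (s + t) i j * f j"
      using has_sum_cmult_left[OF p_add[OF assms(1,2,3) j]] by (rule infsumI)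
    finally show "(\<Sum>\<^sub>\<infinity>k\<in>E. p s i k * (p t k j * f j)) = p (s + t) i j * f j" .
  qed
  finally show ?thesis by (simp add: sg_def infsum_cmult_right')
qed

text \<open>Chapman-Kolmogorov for a first step of length h: staying at i contributes nothing, jumps
  into K are kept, and all other mass multiplies differences of size at most 2 * C. K = J i will
  give the derivative and K = {} the continuity.\<close>

lemma sg_increment:
  assumes "0 \<le> t" "0 \<le> h" "i \<in> E" and f: "\<And>j. j \<in> E \<Longrightarrow> \<bar>f j\<bar> \<le> C" and K: "finite K" "K \<subseteq> E - {i}"
  shows "\<bar>sg (h + t) f i - sg t f i - (\<Sum>k\<in>K. p h i k * (sg t f k - sg t f i))\<bar>
    \<le> 2 * C * (1 - p h i i - (\<Sum>k\<in>K. p h i k))"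
proof -
  define u where "u = sg t f"
  have u: "\<bar>u j\<bar> \<le> C" if "j \<in> E" for j unfolding u_def using assms(1) that f by (rule sg_bounded)
  have "((\<lambda>k. p h i k * u k) has_sum sg (h + t) f i) E"
    using p_summable[OF assms(2,3) u] sg_add[where f = f, OF assms(2,1,3) f] by (simp add: sg_def[of h] u_def)
  from has_sum_add[OF this has_sum_cmult_left[OF p_sum[OF assms(2,3)], of "- u i"]]
  have 1: "((\<lambda>k. p h i k * (u k - u i)) has_sum (sg (h + t) f i - u i)) E"
    by (simp add: right_diff_distrib)
  have K': "finite (insert i K)" "insert i K \<subseteq> E" "i \<notin> K" using K assms(3) by auto
  have 2: "((\<lambda>k. p h i k * (u k - u i)) has_sum (\<Sum>k\<in>insert i K. p h i k * (u k - u i))) (insert i K)"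
    using K' by (intro has_sum_finite)
  have 3: "((\<lambda>k. p h i k * (u k - u i)) has_sum (sg (h + t) f i - u i - (\<Sum>k\<in>K. p h i k * (u k - u i)))) (E - insert i K)"
    using has_sum_Diff[OF 1 2] K' by simp
  have "((\<lambda>k. p h i k) has_sum (\<Sum>k\<in>insert i K. p h i k)) (insert i K)"
    using K' by (intro has_sum_finite)
  from has_sum_Diff[OF p_sum[OF assms(2,3)] this K'(2)]
  have "((\<lambda>k. p h i k) has_sum (1 - p h i i - (\<Sum>k\<in>K. p h i k))) (E - insert i K)"
    using K' by (simp add: algebra_simps)
  from has_sum_cmult_right[OF this, of "2 * C"]
  have 4: "((\<lambda>k. 2 * C * p h i k) has_sum (2 * C * (1 - p h i i - (\<Sum>k\<in>K. p h i k)))) (E - insert i K)" .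
  have 5: "((\<lambda>k. - (2 * C * p h i k)) has_sum - (2 * C * (1 - p h i i - (\<Sum>k\<in>K. p h i k)))) (E - insert i K)"
    using 4 by (rule has_sum_uminusI)
  have le: "\<bar>p h i k * (u k - u i)\<bar> \<le> 2 * C * p h i k" if "k \<in> E - insert i K" for k
  proof -
    have "\<bar>u k - u i\<bar> \<le> 2 * C" using u[of k] u[of i] that assms(3) by auto
    then show ?thesis using p_nonneg[of h i k] assms that
      by (simp add: abs_mult mult.commute mult_left_mono)
  qed
  have "sg (h + t) f i - u i - (\<Sum>k\<in>K. p h i k * (u k - u i)) \<le> 2 * C * (1 - p h i i - (\<Sum>k\<in>K. p h i k))"
    by (rule has_sum_mono[OF 3 4]) (drule le, linarith)
  moreover have "- (2 * C * (1 - p h i i - (\<Sum>k\<in>K. p h i k))) \<le> sg (h + t) f i - u i - (\<Sum>k\<in>K. p h i k * (u k - u i))"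
    by (rule has_sum_mono[OF 5 3]) (drule le, linarith)
  ultimately show ?thesis unfolding u_def by (simp add: abs_le_iff)
qed

lemma total_rate:
  assumes "i \<in> E" shows "((\<lambda>h. (1 - p h i i) / h) \<longlongrightarrow> (\<Sum>j\<in>J i. q i j)) (at_right 0)"
proof -
  have "infsum (q i) (E - {i}) = (\<Sum>\<^sub>\<infinity>j\<in>J i. q i j)"
    using J_subset[OF assms] q_zero[OF assms] by (intro infsum_cong_neutral) auto
  also have "\<dots> = (\<Sum>j\<in>J i. q i j)" using finite_J[OF assms] by simp
  finally have eq: "infsum (q i) (E - {i}) = (\<Sum>j\<in>J i. q i j)" .
  have "((\<lambda>h. (1 - p h i i) / h) \<longlongrightarrow> infsum (q i) (E - {i})) (at_right 0)"
    using rates assms unfolding has_jump_rates_def by (elim conjE) (erule bspec)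
  then show ?thesis unfolding eq .
qed

text \<open>The mass outside i and \<open>J i\<close> is o(h), because the total rate equals the sum
  of the rates into \<open>J i\<close>. The increment estimate looks forward in time and so yields a
  right derivative.\<close>

lemma backward_equation:
  assumes "0 \<le> t" "i \<in> E" and f: "\<And>j. j \<in> E \<Longrightarrow> \<bar>f j\<bar> \<le> C"
  shows "((\<lambda>s. sg s f i) has_real_derivative gen (sg t f) i) (at_right t)"
proof -
  define u where "u = sg t f"
  define r where "r h = 1 - p h i i - (\<Sum>k\<in>J i. p h i k)" for h
  define main where "main h = (\<Sum>k\<in>J i. p h i k * (u k - u i))" for h
  have rate: "((\<lambda>h. p h i k / h) \<longlongrightarrow> q i k) (at_right 0)" if "k \<in> J i" for k
  proof -
    have k: "k \<in> E" "i \<noteq> k" using J_subset[OF assms(2)] that by auto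
    from rates have "\<forall>i\<in>E. \<forall>j\<in>E. i \<noteq> j \<longrightarrow> ((\<lambda>h. p h i j / h) \<longlongrightarrow> q i j) (at_right 0)"
      unfolding has_jump_rates_def by (rule conjunct1)
    from this[rule_format, OF assms(2) k] show ?thesis .
  qed
  have "((\<lambda>h. (1 - p h i i) / h - (\<Sum>k\<in>J i. p h i k / h)) \<longlongrightarrow> (\<Sum>j\<in>J i. q i j) - (\<Sum>j\<in>J i. q i j)) (at_right 0)"
    by (intro tendsto_diff total_rate assms tendsto_sum rate)
  then have "((\<lambda>h. r h / h) \<longlongrightarrow> 0) (at_right 0)"
    unfolding r_def diff_divide_distrib[of _ "sum _ _"] sum_divide_distrib by simp
  then have r0: "((\<lambda>h. 2 * C * (r h / h)) \<longlongrightarrow> 0) (at_right 0)"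
    by (rule tendsto_mult_right_zero)
  have "((\<lambda>h. \<Sum>k\<in>J i. (p h i k / h) * (u k - u i)) \<longlongrightarrow> gen u i) (at_right 0)"
    unfolding gen_def by (intro tendsto_sum tendsto_mult tendsto_const rate)
  then have main0: "((\<lambda>h. main h / h) \<longlongrightarrow> gen u i) (at_right 0)"
    unfolding main_def sum_divide_distrib by (simp only: times_divide_eq_left)
  have "((\<lambda>h. (sg (h + t) f i - u i) / h - main h / h) \<longlongrightarrow> 0) (at_right 0)"
  proof (rule Lim_null_comparison[OF _ r0])
    show "\<forall>\<^sub>F h in at_right 0. norm ((sg (h + t) f i - u i) / h - main h / h) \<le> 2 * C * (r h / h)"
    proof (rule eventually_at_right_less[THEN eventually_mono])
      fix h :: real assume h: "0 < h"
      have "\<bar>sg (h + t) f i - u i - main h\<bar> \<le> 2 * C * r h"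
        unfolding u_def main_def r_def
        using sg_increment[where f = f, OF assms(1) less_imp_le[OF h] assms(2) f finite_J[OF assms(2)] J_subset[OF assms(2)]] by simp
      from divide_right_mono[OF this less_imp_le[OF h]]
      have "\<bar>sg (h + t) f i - u i - main h\<bar> / h \<le> 2 * C * r h / h" .
      moreover have "(sg (h + t) f i - u i) / h - main h / h = (sg (h + t) f i - u i - main h) / h"
        by (rule diff_divide_distrib[symmetric])
      ultimately show "norm ((sg (h + t) f i - u i) / h - main h / h) \<le> 2 * C * (r h / h)"
        using h by (simp only: real_norm_def abs_divide abs_of_pos times_divide_eq_right)
    qed
  qed
  from tendsto_add[OF this main0]
  have "((\<lambda>h. (sg (h + t) f i - u i) / h) \<longlongrightarrow> gen u i) (at_right 0)" by simp
  then show ?thesis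
    unfolding has_field_derivative_iff filterlim_at_right_to_0[of _ _ t] by (simp only: u_def add_diff_cancel_right')
qed

lemma p_diag_tendsto: "i \<in> E \<Longrightarrow> ((\<lambda>h. 1 - p h i i) \<longlongrightarrow> 0) (at_right 0)"
proof -
  assume "i \<in> E"
  have "((\<lambda>h. (1 - p h i i) / h * h) \<longlongrightarrow> (\<Sum>j\<in>J i. q i j) * 0) (at_right 0)"
    by (intro tendsto_mult total_rate \<open>i \<in> E\<close> tendsto_ident_at)
  moreover have "\<forall>\<^sub>F h in at_right 0. (1 - p h i i) / h * h = 1 - p h i i"
    by (rule eventually_at_right_less[THEN eventually_mono]) simp
  ultimately show ?thesis by (simp only: mult_zero_right) (rule Lim_transform_eventually)
qed

text \<open>The increment estimate is uniform in the starting time, so running it from an earlier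
  time up to t gives continuity from the left as well.\<close>

lemma sg_continuous:
  assumes "i \<in> E" and f: "\<And>j. j \<in> E \<Longrightarrow> \<bar>f j\<bar> \<le> C"
  shows "continuous_on {0..} (\<lambda>t. sg t f i)"
  unfolding continuous_on_iff
proof (intro ballI allI impI)
  fix t e :: real assume t: "t \<in> {0..}" and e: "0 < e"
  have C: "0 \<le> C" using f[OF assms(1)] by linarith
  have lim: "((\<lambda>h. 2 * C * (1 - p h i i)) \<longlongrightarrow> 0) (at_right 0)"
    by (rule tendsto_mult_right_zero) (rule p_diag_tendsto[OF assms(1)])
  from order_tendstoD(2)[OF lim e] obtain d where d: "0 < d" "\<And>h. 0 < h \<Longrightarrow> h < d \<Longrightarrow> 2 * C * (1 - p h i i) < e"
    unfolding eventually_at_right_field by auto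
  have inc: "\<bar>sg (h + s) f i - sg s f i\<bar> < e" if "0 \<le> s" "0 \<le> h" "h < d" for s h
  proof (cases "h = 0")
    case False
    then show ?thesis
      using sg_increment[where f = f and K = "{}", OF that(1,2) assms(1) f] d(2)[of h] that by auto
  qed (use e in simp)
  show "\<exists>d>0. \<forall>s\<in>{0..}. dist s t < d \<longrightarrow> dist (sg s f i) (sg t f i) < e"
  proof (intro exI[of _ d] conjI ballI impI d)
    fix s :: real assume s: "s \<in> {0..}" "dist s t < d"
    show "dist (sg s f i) (sg t f i) < e"
    proof (cases "s \<le> t")
      case True
      then show ?thesis using inc[of s "t - s"] s by (auto simp: dist_real_def abs_minus_commute)
    next
      case False
      then show ?thesis using inc[of t "s - t"] s t by (auto simp: dist_real_def)
    qed
  qed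
qed

text \<open>
  The multiple of \<open>exp (2 t) (1 + V)\<close> subtracted from \<open>w\<close> confines positive values to a finite set of
  states, on which the first zero would contradict the sign of the derivative.
\<close>

lemma maximum_principle:
  fixes w :: "real \<Rightarrow> 's \<Rightarrow> real"
  assumes cont: "\<And>i. i \<in> E \<Longrightarrow> continuous_on {0..} (\<lambda>t. w t i)"
    and bdd: "\<And>t i. 0 \<le> t \<Longrightarrow> t \<le> T \<Longrightarrow> i \<in> E \<Longrightarrow> w t i \<le> C"
    and deriv: "\<And>t i. 0 \<le> t \<Longrightarrow> i \<in> E \<Longrightarrow>
      \<exists>D. ((\<lambda>s. w s i) has_real_derivative D) (at_right t) \<and> D \<le> gen (w t) i"
    and init: "\<And>i. i \<in> E \<Longrightarrow> w 0 i \<le> 0"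
    and T: "0 \<le> T" and i0: "i0 \<in> E"
  shows "w T i0 \<le> 0"
proof -
  have main: "w T i0 \<le> e * (exp (2 * T) * (1 + V i0))" if e: "0 < e" for e
  proof (rule ccontr)
    define y where "y t i = w t i - e * (exp (2 * t) * (1 + V i))" for t i
    define Bd where "Bd = {t \<in> {0..T}. \<exists>i\<in>E. 0 < y t i}"
    assume "\<not> w T i0 \<le> e * (exp (2 * T) * (1 + V i0))"
    then have T_Bd: "T \<in> Bd" using T i0 unfolding Bd_def y_def by (auto intro!: bexI[of _ i0])
    \<comment> \<open>A positive value of y forces e * V i \<le> C, so up to time T only the states
      of this finite set can have one.\<close>
    define Fs where "Fs = {i \<in> E. V i \<le> C / e}"
    have Fs: "i \<in> Fs" if "i \<in> E" "0 < y t i" "0 \<le> t" "t \<le> T" for t i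
    proof -
      have "e * (1 * (1 + V i)) \<le> e * (exp (2 * t) * (1 + V i))"
        using e V_nonneg[OF that(1)] that(3) by (intro mult_left_mono mult_right_mono) auto
      also have "\<dots> \<le> C" using that bdd[of t i] unfolding y_def by linarith
      finally have "e * V i \<le> C" using e by (simp add: distrib_left)
      then show ?thesis using that e unfolding Fs_def by (simp add: field_simps)
    qed
    have ycont: "continuous_on {0..} (\<lambda>t. y t i)" if "i \<in> E" for i
      unfolding y_def by (intro continuous_intros cont that)
    define t0 where "t0 = Inf Bd"
    have bb: "bdd_below Bd" unfolding Bd_def by (rule bdd_belowI[of _ 0]) auto
    have t0: "0 \<le> t0" "t0 \<le> T"
      unfolding t0_def using T_Bd bb by (auto intro!: cInf_greatest cInf_lower simp: Bd_def)
    have y_t0: "y t0 i \<le> 0" if i: "i \<in> E" for i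
    proof (rule ccontr)
      assume pos: "\<not> y t0 i \<le> 0"
      then obtain d where d: "0 < d" "\<And>s. 0 \<le> s \<Longrightarrow> \<bar>s - t0\<bar> < d \<Longrightarrow> \<bar>y s i - y t0 i\<bar> < y t0 i"
        using ycont[OF i] t0(1) unfolding continuous_on_iff dist_real_def by (force simp: not_le)
      \<comment> \<open>A time just before t0, or 0, at which y is still positive. It contradicts
        the infimum unless t0 = 0, where the initial bound makes y negative.\<close>
      define s where "s = max 0 (t0 - d / 2)"
      have "\<bar>y s i - y t0 i\<bar> < y t0 i" using d t0 by (intro d(2)) (auto simp: s_def max_def)
      then have "0 < y s i" by linarith
      moreover have "s \<le> t0" using d t0 by (simp add: s_def)
      ultimately have "s \<in> Bd" using t0 i by (auto simp: Bd_def s_def)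
      then have "t0 \<le> s" unfolding t0_def using bb by (rule cInf_lower)
      then have "t0 = 0" using d(1) \<open>s \<le> t0\<close> t0 by (auto simp: s_def max_def split: if_splits)
      moreover have "0 < e * (1 + V i)" using V_nonneg[OF i] e by (simp add: add_pos_nonneg)
      ultimately have "y t0 i < 0" using init[OF i] unfolding y_def by simp
      then show False using pos by simp
    qed
    have ev: "\<forall>\<^sub>F s in at_right t0. y s i \<le> 0" if i: "i \<in> E" for i
    proof (cases "y t0 i < 0")
      case True
      have "((\<lambda>s. y s i) \<longlongrightarrow> y t0 i) (at t0 within {0..})"
        using ycont[OF i] t0 by (auto simp: continuous_on_def)
      then have "((\<lambda>s. y s i) \<longlongrightarrow> y t0 i) (at_right t0)"
        by (rule tendsto_within_subset) (use t0 in auto)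
      from order_tendstoD(2)[OF this True] show ?thesis by (rule eventually_mono) simp
    next
      case False
      then have y0: "y t0 i = 0" using y_t0[OF i] by simp
      obtain D where D: "((\<lambda>s. w s i) has_real_derivative D) (at_right t0)" "D \<le> gen (w t0) i"
        using deriv[OF t0(1) i] by blast
      define c where "c = e * exp (2 * t0)"
      have c: "0 < c" using e by (simp add: c_def)
      have yd: "((\<lambda>s. y s i) has_real_derivative D - 2 * c * (1 + V i)) (at_right t0)"
        unfolding y_def c_def by (auto intro!: derivative_eq_intros D)
      have "gen (w t0) i = gen (y t0) i + c * (\<Sum>j\<in>J i. q i j * (V j - V i))"
        unfolding gen_def y_def c_def sum_distrib_left sum.distrib[symmetric]
        by (rule sum.cong) (simp_all add: algebra_simps)
      also have "\<dots> \<le> 0 + c * (V i + 1)"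
      proof (rule add_mono)
        show "gen (y t0) i \<le> 0" unfolding gen_def y0
          using y_t0 q_nonneg[OF i] J_subset[OF i] by (intro sum_nonpos) (auto intro!: mult_nonneg_nonpos)
        show "c * (\<Sum>j\<in>J i. q i j * (V j - V i)) \<le> c * (V i + 1)"
          using c V_drift[OF i] by simp
      qed
      \<comment> \<open>The drift of V uses up c * (1 + V i); the factor 2 in the exponent leaves a
        second copy, which makes the derivative strictly negative.\<close>
      finally have "D - 2 * c * (1 + V i) \<le> - c * (1 + V i)" using D(2) by (simp add: algebra_simps)
      also have "\<dots> < 0" using c V_nonneg[OF i] by (simp add: mult_neg_pos)
      finally have neg: "D - 2 * c * (1 + V i) < 0" .
      have "\<forall>\<^sub>F s in at_right t0. (y s i - y t0 i) / (s - t0) < 0"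
        using order_tendstoD(2)[OF _ neg] yd unfolding has_field_derivative_iff by blast
      moreover have "\<forall>\<^sub>F s in at_right t0. t0 < s" by (rule eventually_at_right_less)
      ultimately show ?thesis
        by eventually_elim (simp add: y0 divide_less_0_iff)
    qed
    have "finite Fs" unfolding Fs_def by (rule finite_level)
    then have "\<forall>\<^sub>F s in at_right t0. \<forall>i\<in>Fs. y s i \<le> 0"
      by (rule eventually_ball_finite) (use ev in \<open>auto simp: Fs_def\<close>)
    then obtain b where b: "t0 < b" "\<And>s i. t0 < s \<Longrightarrow> s < b \<Longrightarrow> i \<in> Fs \<Longrightarrow> y s i \<le> 0"
      unfolding eventually_at_right_field by auto
    obtain s where s: "s \<in> Bd" "s < b"
      using cInf_lessD[of Bd b] T_Bd b(1) unfolding t0_def by blast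
    then obtain i where i: "i \<in> E" "0 < y s i" "0 \<le> s" "s \<le> T" by (auto simp: Bd_def)
    have "t0 \<le> s" unfolding t0_def using s(1) bb by (rule cInf_lower)
    moreover have "t0 \<noteq> s" using y_t0[OF i(1)] i(2) by auto
    ultimately show False using b(2)[of s i] s(2) Fs[OF i(1,2,3,4)] i(2) by auto
  qed
  show ?thesis
  proof (rule ccontr)
    assume "\<not> w T i0 \<le> 0"
    then have pos: "0 < w T i0" by simp
    \<comment> \<open>Taking e = w T i0 / (2 * m) in \<open>main\<close> replaces the limit of e to
      0.\<close>
    define m where "m = exp (2 * T) * (1 + V i0)"
    have m: "0 < m" using V_nonneg[OF i0] by (simp add: m_def add_pos_nonneg)
    have "w T i0 \<le> (w T i0 / (2 * m)) * m"
      unfolding m_def by (rule main) (use pos m in \<open>simp add: m_def\<close>)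
    then show False using pos m by simp
  qed
qed

lemma sg_le_superharmonic_majorant:
  assumes f: "\<And>j. j \<in> E \<Longrightarrow> \<bar>f j\<bar> \<le> C" and K: "\<And>j. j \<in> E \<Longrightarrow> \<bar>K j\<bar> \<le> C'"
    and le: "\<And>j. j \<in> E \<Longrightarrow> f j \<le> K j" and super: "\<And>i. i \<in> E \<Longrightarrow> gen K i \<le> 0"
    and t: "0 \<le> t" and i: "i \<in> E"
  shows "sg t f i \<le> K i"
proof -
  have "sg t f i - K i \<le> 0"
  proof (rule maximum_principle[where T = t and C = "C + C'" and w = "\<lambda>t i. sg t f i - K i"])
    show "continuous_on {0..} (\<lambda>t. sg t f i - K i)" if "i \<in> E" for i
      by (intro continuous_intros sg_continuous[where f = f, OF that f])
    show "sg s f j - K j \<le> C + C'" if "0 \<le> s" "j \<in> E" for s j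
      using sg_bounded[where f = f, OF that f] K[OF that(2)] by linarith
    show "\<exists>D. ((\<lambda>t. sg t f j - K j) has_real_derivative D) (at_right s) \<and> D \<le> gen (\<lambda>i. sg s f i - K i) j"
      if "0 \<le> s" "j \<in> E" for s j
    proof (intro exI conjI)
      show "((\<lambda>t. sg t f j - K j) has_real_derivative gen (sg s f) j - 0) (at_right s)"
        by (intro DERIV_diff DERIV_const backward_equation[where f = f, OF that f])
      have "gen (sg s f) j = gen (\<lambda>i. sg s f i - K i) j + gen K j"
        unfolding gen_def sum.distrib[symmetric] by (rule sum.cong) (simp_all add: algebra_simps)
      then show "gen (sg s f) j - 0 \<le> gen (\<lambda>i. sg s f i - K i) j"
        using super[OF that(2)] by simp
    qed
    show "sg 0 f j - K j \<le> 0" if "j \<in> E" for j using sg_0[OF that] le[OF that] by simp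
  qed (rule t i)+
  then show ?thesis by simp
qed

lemma harmonic_le_sg:
  assumes f: "\<And>j. j \<in> E \<Longrightarrow> \<bar>f j\<bar> \<le> C" and H: "\<And>j. j \<in> E \<Longrightarrow> \<bar>H j\<bar> \<le> C'"
    and le: "\<And>j. j \<in> E \<Longrightarrow> H j \<le> f j" and harm: "\<And>i. i \<in> E \<Longrightarrow> gen H i = 0"
    and t: "0 \<le> t" and i: "i \<in> E"
  shows "H i \<le> sg t f i"
proof -
  have "gen (\<lambda>j. - H j) i = - gen H i" for i
    unfolding gen_def sum_negf[symmetric] by (rule sum.cong) (simp_all add: algebra_simps)
  then have "sg t (\<lambda>j. - f j) i \<le> - H i"
    using f H le harm by (intro sg_le_superharmonic_majorant[where C = C and C' = C'] t i) simp_all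
  moreover have "sg t (\<lambda>j. - f j) i = - sg t f i"
    by (simp add: sg_def infsum_uminus)
  ultimately show ?thesis by simp
qed

text \<open>As f is superharmonic, \<open>sg t f i\<close> decreases in t, so t times it is at most
  its time integral. The integral of f - K along the chain is controlled by L through
  \<open>L_drift\<close>, and K does not increase on average. The proof compares t * (sg t f - K)
  with L by the maximum principle instead of integrating.\<close>

lemma sg_le_superharmonic:
  assumes f: "\<And>j. j \<in> E \<Longrightarrow> \<bar>f j\<bar> \<le> C" and K: "\<And>j. j \<in> E \<Longrightarrow> \<bar>K j\<bar> \<le> C"
    and L: "\<And>j. j \<in> E \<Longrightarrow> 0 \<le> L j" "\<And>j. j \<in> E \<Longrightarrow> L j \<le> C'"
    and f_super: "\<And>i. i \<in> E \<Longrightarrow> gen f i \<le> 0" and K_super: "\<And>i. i \<in> E \<Longrightarrow> gen K i \<le> 0"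
    and L_drift: "\<And>i. i \<in> E \<Longrightarrow> f i - K i + gen L i \<le> 0"
    and t: "0 < t" and i: "i \<in> E"
  shows "sg t f i \<le> K i + C' / t"
proof -
  define w where "w t i = t * sg t f i - t * K i - L i" for t i
  have "w t i \<le> 0"
  proof (rule maximum_principle[where T = t and C = "t * (2 * C)" and w = w])
    show "continuous_on {0..} (\<lambda>t. w t i)" if "i \<in> E" for i
      unfolding w_def by (intro continuous_intros sg_continuous[where f = f, OF that f])
    show "w s j \<le> t * (2 * C)" if "0 \<le> s" "s \<le> t" "j \<in> E" for s j
    proof -
      have "sg s f j - K j \<le> 2 * C" using sg_bounded[where f = f, OF that(1,3) f] K[OF that(3)] by linarith
      moreover have "0 \<le> 2 * C" using K[OF that(3)] by linarith
      ultimately have "s * (sg s f j - K j) \<le> t * (2 * C)"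
        by (meson mult_left_mono mult_right_mono order_trans that(1,2))
      then show ?thesis using L(1)[OF that(3)] by (simp add: w_def algebra_simps)
    qed
    show "\<exists>D. ((\<lambda>t. w t j) has_real_derivative D) (at_right s) \<and> D \<le> gen (w s) j"
      if s: "0 \<le> s" "j \<in> E" for s j
    proof (intro exI conjI)
      show "((\<lambda>t. w t j) has_real_derivative sg s f j + s * gen (sg s f) j - K j) (at_right s)"
        unfolding w_def by (auto intro!: derivative_eq_intros backward_equation[where f = f, OF s f])
      have "gen (w s) j = s * gen (sg s f) j - s * gen K j - gen L j"
        unfolding gen_def w_def sum_distrib_left sum_subtractf[symmetric]
        by (rule sum.cong) (simp_all add: algebra_simps)
      moreover have "s * gen K j \<le> 0" using K_super[OF s(2)] s(1) by (simp add: mult_nonneg_nonpos)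
      moreover have "sg s f j \<le> f j" by (rule sg_le_superharmonic_majorant[where f = f, OF f f order_refl f_super s])
      ultimately show "sg s f j + s * gen (sg s f) j - K j \<le> gen (w s) j"
        using L_drift[OF s(2)] by linarith
    qed
    show "w 0 j \<le> 0" if "j \<in> E" for j using L(1)[OF that] by (simp add: w_def)
  qed (use t i in simp_all)
  then have "t * sg t f i \<le> t * K i + C'" using L(2)[OF i] by (simp add: w_def)
  then show ?thesis using t by (simp add: field_simps)
qed

end


section \<open>Duality between particles and words\<close>

definition hop :: "nat \<Rightarrow> nat set \<Rightarrow> nat set" where
  "hop x A = (if x \<in> A \<and> Suc x \<notin> A then insert (Suc x) (A - {x}) else A)"

definition tail_count :: "nat set \<Rightarrow> nat \<Rightarrow> nat" where
  "tail_count A k = card {y \<in> A. k < y}"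

text \<open>Word positions count from 0 and sites from 1: \<open>w ! k\<close> belongs to site k +
  1, so \<open>ones_from w k\<close> and \<open>tail_count A k\<close> both look at the sites beyond
  k.\<close>

definition ones_from :: "bool list \<Rightarrow> nat \<Rightarrow> nat" where
  "ones_from w k = length (filter id (drop k w))"

definition flux :: "nat set \<Rightarrow> bool list \<Rightarrow> nat" where
  "flux A w = Min ((\<lambda>k. tail_count A k + k + ones_from w k) ` {..length w})"

lemma tail_count_Suc: "finite A \<Longrightarrow> tail_count A k = tail_count A (Suc k) + of_bool (Suc k \<in> A)"
proof -
  assume A: "finite A"
  have "{y \<in> A. k < y} = (if Suc k \<in> A then insert (Suc k) {y \<in> A. Suc k < y} else {y \<in> A. Suc k < y})"
  proof -
    have "k < y \<longleftrightarrow> y = Suc k \<or> Suc k < y" for y by linarith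
    then show ?thesis by auto
  qed
  then show ?thesis using A by (simp add: tail_count_def)
qed

lemma tail_count_hop:
  assumes "finite A"
  shows "tail_count (hop x A) k = tail_count A k + of_bool (k = x \<and> x \<in> A \<and> Suc x \<notin> A)"
proof (cases "x \<in> A \<and> Suc x \<notin> A")
  case True
  then have hop: "hop x A = insert (Suc x) (A - {x})" by (simp add: hop_def)
  have fin: "finite {y \<in> A. P y}" for P using assms by simp
  consider "k < x" | "k = x" | "x < k" by linarith
  then show ?thesis
  proof cases
    case 1
    then have "{y \<in> hop x A. k < y} = insert (Suc x) ({y \<in> A. k < y} - {x})" unfolding hop by auto
    moreover have "Suc (card ({y \<in> A. k < y} - {x})) = card {y \<in> A. k < y}"
      using True 1 by (intro card_Suc_Diff1 fin) auto
    ultimately show ?thesis using True 1 fin by (simp add: tail_count_def)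
  next
    case 2
    then have "{y \<in> hop x A. k < y} = insert (Suc x) {y \<in> A. k < y}" unfolding hop by auto
    then show ?thesis using True 2 fin by (simp add: tail_count_def)
  next
    case 3
    then have "{y \<in> hop x A. k < y} = {y \<in> A. k < y}" using True unfolding hop by auto
    then show ?thesis using 3 by (simp add: tail_count_def)
  qed
qed (auto simp: hop_def)

lemma tail_count_insert_1:
  assumes "finite A"
  shows "tail_count (insert 1 A) k = tail_count A k + of_bool (k = 0 \<and> 1 \<notin> A)"
proof -
  have "{y \<in> insert 1 A. k < y} = (if k = 0 then insert 1 {y \<in> A. k < y} else {y \<in> A. k < y})"
    by auto
  then show ?thesis using assms by (simp add: tail_count_def card_insert_if)
qed

lemma ones_from_Suc: "k < length w \<Longrightarrow> ones_from w k = ones_from w (Suc k) + of_bool (w ! k)"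
  by (simp add: ones_from_def Cons_nth_drop_Suc[symmetric])

lemma ones_from_hop_word:
  "ones_from (hop_word x w) k = ones_from w k + of_bool (k = Suc x \<and> Suc x < length w \<and> w ! x \<and> \<not> w ! Suc x)"
proof (induction w arbitrary: x k)
  case (Cons b w)
  show ?case
  proof (cases x)
    case 0
    then show ?thesis
      by (cases w; cases k; cases "k - 1") (auto simp: ones_from_def)
  next
    case (Suc y)
    then show ?thesis using Cons[of y "k - 1"] Cons[of y 0]
      by (cases k) (auto simp: ones_from_def)
  qed
qed (simp add: ones_from_def)

lemma ones_from_inject_word:
  "ones_from (inject_word w) k = ones_from w k + of_bool (k = 0 \<and> w \<noteq> [] \<and> \<not> w ! 0)"
  by (cases w; cases k) (auto simp: ones_from_def inject_word_def)

lemma length_inject_word [simp]: "length (inject_word w) = length w"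
  by (simp add: inject_word_def)

lemma Min_image_le:
  fixes f g :: "nat \<Rightarrow> nat"
  assumes "\<And>k. k \<le> n \<Longrightarrow> \<exists>j\<le>n. f j \<le> g k + c"
  shows "Min (f ` {..n}) \<le> Min (g ` {..n}) + c"
proof -
  have "Min (g ` {..n}) \<in> g ` {..n}" by (intro Min_in) auto
  then obtain k where k: "Min (g ` {..n}) = g k" "k \<in> {..n}" by (rule imageE)
  then obtain j where j: "j \<le> n" "f j \<le> g k + c" using assms by blast
  have "Min (f ` {..n}) \<le> f j" using j by (intro Min_le) auto
  also note j(2)
  finally show ?thesis unfolding k(1) .
qed

text \<open>Either move can change only the term k = Suc x of the minimum, and raises it by 1. If
  both moves are possible the terms agree. If just one is, the term at x or at
  \<open>Suc (Suc x)\<close> equals the unraised term at \<open>Suc x\<close>, so the minimum does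
  not notice the move.\<close>

lemma flux_hop:
  assumes A: "finite A" and x: "Suc x < length w"
  shows "flux (hop (Suc x) A) w = flux A (hop_word x w)"
proof -
  note defs = tail_count_hop[OF A] ones_from_hop_word
  have t: "tail_count A x = tail_count A (Suc x) + of_bool (Suc x \<in> A)"
    "tail_count A (Suc x) = tail_count A (Suc (Suc x)) + of_bool (Suc (Suc x) \<in> A)"
    using tail_count_Suc[OF A] by blast+
  have o: "ones_from w x = ones_from w (Suc x) + of_bool (w ! x)"
    "ones_from w (Suc x) = ones_from w (Suc (Suc x)) + of_bool (w ! Suc x)"
    using ones_from_Suc x by auto
  have "flux (hop (Suc x) A) w \<le> flux A (hop_word x w) + 0"
    unfolding flux_def length_hop_word
  proof (rule Min_image_le)
    fix k assume "k \<le> length w"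
    then show "\<exists>j\<le>length w. tail_count (hop (Suc x) A) j + j + ones_from w j
        \<le> tail_count A k + k + ones_from (hop_word x w) k + 0"
    proof (cases "k = Suc x \<and> Suc x \<in> A \<and> Suc (Suc x) \<notin> A \<and> \<not> (w ! x \<and> \<not> w ! Suc x)")
      case True
      show ?thesis
        by (rule exI[of _ "if w ! x then Suc (Suc x) else x"]) (use True x t o in \<open>auto simp: defs\<close>)
    next
      case False
      with \<open>k \<le> length w\<close> show ?thesis
        by (intro exI[of _ k]) (use x in \<open>auto simp: defs\<close>)
    qed
  qed
  moreover have "flux A (hop_word x w) \<le> flux (hop (Suc x) A) w + 0"
    unfolding flux_def length_hop_word
  proof (rule Min_image_le)
    fix k assume "k \<le> length w"
    then show "\<exists>j\<le>length w. tail_count A j + j + ones_from (hop_word x w) j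
        \<le> tail_count (hop (Suc x) A) k + k + ones_from w k + 0"
    proof (cases "k = Suc x \<and> w ! x \<and> \<not> w ! Suc x \<and> \<not> (Suc x \<in> A \<and> Suc (Suc x) \<notin> A)")
      case True
      show ?thesis
        by (rule exI[of _ "if Suc x \<in> A then Suc (Suc x) else x"]) (use True x t o in \<open>auto simp: defs\<close>)
    next
      case False
      with \<open>k \<le> length w\<close> show ?thesis
        by (intro exI[of _ k]) (use x in \<open>auto simp: defs\<close>)
    qed
  qed
  ultimately show ?thesis by simp
qed

text \<open>The same argument at the boundary: both moves raise only the term k = 0, and if just one
  of them is possible the term k = 1 equals the unraised one.\<close>

lemma flux_insert_1:
  assumes A: "finite A" and w: "w \<noteq> []"
  shows "flux (insert 1 A) w = flux A (inject_word w)"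
proof -
  note defs = tail_count_insert_1[OF A, simplified] ones_from_inject_word
  have t: "tail_count A 0 = tail_count A (Suc 0) + of_bool (Suc 0 \<in> A)"
    using tail_count_Suc[OF A] by blast
  have o: "ones_from w 0 = ones_from w (Suc 0) + of_bool (w ! 0)"
    using ones_from_Suc w by auto
  have l: "Suc 0 \<le> length w" using w by (cases w) auto
  have "flux (insert 1 A) w \<le> flux A (inject_word w) + 0"
    unfolding flux_def length_inject_word
  proof (rule Min_image_le)
    fix k assume k: "k \<le> length w"
    show "\<exists>j\<le>length w. tail_count (insert 1 A) j + j + ones_from w j
        \<le> tail_count A k + k + ones_from (inject_word w) k + 0"
      by (rule exI[of _ "if k = 0 \<and> 1 \<notin> A \<and> w ! 0 then 1 else k"])
        (use k l t o w in \<open>auto simp: defs\<close>)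
  qed
  moreover have "flux A (inject_word w) \<le> flux (insert 1 A) w + 0"
    unfolding flux_def length_inject_word
  proof (rule Min_image_le)
    fix k assume k: "k \<le> length w"
    show "\<exists>j\<le>length w. tail_count A j + j + ones_from (inject_word w) j
        \<le> tail_count (insert 1 A) k + k + ones_from w k + 0"
      by (rule exI[of _ "if k = 0 \<and> 1 \<in> A \<and> \<not> w ! 0 then 1 else k"])
        (use k l t o w in \<open>auto simp: defs\<close>)
  qed
  ultimately show ?thesis by simp
qed

lemma flux_hop_outside: "finite A \<Longrightarrow> length w < x \<Longrightarrow> flux (hop x A) w = flux A w"
  unfolding flux_def by (rule arg_cong[where f = Min], rule image_cong) (auto simp: tail_count_hop)

lemma flux_snoc:
  "flux A (v @ [b]) = min (flux A v + of_bool b) (tail_count A (Suc (length v)) + Suc (length v))"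
proof -
  have "{..length (v @ [b])} = insert (Suc (length v)) {..length v}" by auto
  then have "flux A (v @ [b]) = min (tail_count A (Suc (length v)) + Suc (length v))
      (Min ((\<lambda>k. tail_count A k + k + ones_from (v @ [b]) k) ` {..length v}))"
    unfolding flux_def by (simp add: ones_from_def)
  also have "(\<lambda>k. tail_count A k + k + ones_from (v @ [b]) k) ` {..length v}
      = (\<lambda>k. k + of_bool b) ` (\<lambda>k. tail_count A k + k + ones_from v k) ` {..length v}"
    unfolding image_image by (rule image_cong) (auto simp: ones_from_def)
  also have "Min \<dots> = flux A v + of_bool b"
    unfolding flux_def by (rule mono_Min_commute[symmetric]) (auto simp: mono_def)
  finally show ?thesis by (simp add: min.commute)
qed

lemma flux_le_tail:
  assumes "finite A"
  shows "flux A v < tail_count A (Suc (length v)) + Suc (length v) + of_bool (Suc (length v) \<in> A)"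
proof -
  have "flux A v \<le> tail_count A (length v) + length v + ones_from v (length v)"
    unfolding flux_def by (intro Min_le) auto
  then show ?thesis using tail_count_Suc[OF assms, of "length v"] by (simp add: ones_from_def)
qed

text \<open>If the new site is empty, the new term of the minimum exceeds the previous last term by
  1, hence is at least \<open>flux A v + 1\<close> and cannot cut off the contribution of the letter
  b.\<close>

lemma flux_snoc_notin:
  assumes "finite A" "Suc (length v) \<notin> A"
  shows "flux A (v @ [b]) = flux A v + of_bool b"
  using flux_le_tail[OF assms(1), of v] assms(2) by (auto simp: flux_snoc)

lemma tail_count_superset:
  assumes "A \<subseteq> S" "finite S"
  shows "tail_count S k = tail_count A k + tail_count (S - A) k"
proof -
  have "{y \<in> S. k < y} = {y \<in> A. k < y} \<union> {y \<in> S - A. k < y}" using assms(1) by auto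
  then show ?thesis
    unfolding tail_count_def using assms finite_subset[OF assms]
    by (simp add: card_Un_disjoint disjoint_iff)
qed

text \<open>An extra particle beyond the end of the word is counted in every term of the
  minimum.\<close>

lemma flux_superset_ge:
  assumes "A \<subseteq> S" "finite S"
  shows "flux A w + tail_count (S - A) (length w) \<le> flux S w"
proof -
  have "Min ((\<lambda>k. tail_count A k + k + ones_from w k + tail_count (S - A) (length w)) ` {..length w})
     \<le> flux S w + 0"
    unfolding flux_def
  proof (rule Min_image_le)
    fix k assume k: "k \<le> length w"
    have "tail_count (S - A) (length w) \<le> tail_count (S - A) k"
      unfolding tail_count_def using assms k by (intro card_mono) auto
    then show "\<exists>j\<le>length w. tail_count A j + j + ones_from w j + tail_count (S - A) (length w)
        \<le> tail_count S k + k + ones_from w k + 0"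
      using k tail_count_superset[OF assms, of k] by (intro exI[of _ k]) simp
  qed
  moreover have "Min ((\<lambda>k. tail_count A k + k + ones_from w k + tail_count (S - A) (length w)) ` {..length w})
     = flux A w + tail_count (S - A) (length w)"
    unfolding flux_def by (subst mono_Min_commute[where f = "\<lambda>x. x + tail_count (S - A) (length w)"])
      (auto simp: mono_def image_image)
  ultimately show ?thesis by simp
qed

lemma flux_superset_le:
  assumes "A \<subseteq> S" "finite S"
  shows "flux S w \<le> flux A w + card (S - A)"
  unfolding flux_def
proof (rule Min_image_le)
  fix k assume k: "k \<le> length w"
  have "tail_count (S - A) k \<le> card (S - A)"
    unfolding tail_count_def using assms by (intro card_mono) auto
  then show "\<exists>j\<le>length w. tail_count S j + j + ones_from w j \<le> tail_count A k + k + ones_from w k + card (S - A)"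
    using k tail_count_superset[OF assms, of k] by (intro exI[of _ k]) simp
qed

section \<open>Flux difference of a nested pair\<close>

definition flux_gap :: "nat set \<Rightarrow> nat set \<Rightarrow> bool list \<Rightarrow> real" where
  "flux_gap A S w = real (flux S w) - real (flux A w)"

lemma flux_gap_bounds:
  assumes "A \<subseteq> S" "finite S" "card (S - A) \<le> 1"
  shows "0 \<le> flux_gap A S w" "flux_gap A S w \<le> of_bool (A \<noteq> S)"
proof -
  show "0 \<le> flux_gap A S w" using flux_superset_ge[OF assms(1,2), of w] by (simp add: flux_gap_def)
  show "flux_gap A S w \<le> of_bool (A \<noteq> S)"
    using flux_superset_le[OF assms(1,2), of w] assms(3) by (auto simp: flux_gap_def)
qed

lemma flux_gap_outside:
  assumes "A \<subseteq> S" "finite S" "card (S - A) \<le> 1" "d \<in> S - A" "length w < d"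
  shows "flux_gap A S w = 1"
proof -
  have "{d} \<subseteq> {y \<in> S - A. length w < y}" using assms by auto
  then have "card {d} \<le> tail_count (S - A) (length w)"
    unfolding tail_count_def using assms(2) by (intro card_mono) auto
  then show ?thesis
    using flux_superset_ge[OF assms(1,2), of w] flux_superset_le[OF assms(1,2), of w] assms(3)
    by (simp add: flux_gap_def)
qed

text \<open>A hop out of the last site of the box corresponds to turning the last letter into a 0.
  The two sides agree if the site behind the box is empty in S. In general the hop may be blocked
  there, which the words do not see, and an inequality remains.\<close>

lemma flux_gap_exit:
  assumes AB: "A \<subseteq> S" "finite S"
  shows "flux_gap (hop (Suc (length v)) A) (hop (Suc (length v)) S) (v @ [b]) \<le> flux_gap A S (v @ [False])"
proof -
  let ?n = "Suc (length v)"
  have fA: "finite A" using AB finite_subset by blast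
  have hop: "flux (hop ?n C) (v @ [b]) =
      min (flux C v + of_bool b) (tail_count C ?n + of_bool (?n \<in> C \<and> Suc ?n \<notin> C) + ?n)" if "finite C" for C
    unfolding flux_snoc using flux_hop_outside[OF that, of v ?n] by (simp add: tail_count_hop[OF that])
  note lA = flux_le_tail[OF fA, of v] and lB = flux_le_tail[OF AB(2), of v]
  note ge = flux_superset_ge[OF AB, of v] and tail = tail_count_superset[OF AB, of ?n]
  have "tail_count (S - A) ?n \<le> tail_count (S - A) (length v)"
    unfolding tail_count_def using AB by (intro card_mono) auto
  then show ?thesis
    unfolding flux_gap_def hop[OF fA] hop[OF AB(2)] unfolding flux_snoc
    using lA lB ge tail AB(1) by (auto simp: min_def split: if_splits)
qed

definition gap_mean :: "real \<Rightarrow> nat \<Rightarrow> (nat \<Rightarrow> real) \<Rightarrow> nat set \<Rightarrow> nat set \<Rightarrow> real" where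
  "gap_mean a n t A S = mean a n t (flux_gap A S) 0"

text \<open>Only bonds up to m occur. For a given configuration m is later taken beyond every bond
  that can move, so that this is the full generator.\<close>

definition pair_gen :: "real \<Rightarrow> nat \<Rightarrow> (nat set \<Rightarrow> nat set \<Rightarrow> real) \<Rightarrow> nat set \<Rightarrow> nat set \<Rightarrow> real" where
  "pair_gen a m f A S =
     (\<Sum>x = 1..m. f (hop x A) (hop x S) - f A S) + a * (f (insert 1 A) (insert 1 S) - f A S)"

text \<open>The symmetry \<open>flux (s A) w = flux A (s w)\<close> turns the particle dynamics into the dynamics of words.\<close>

lemma pair_gen_gap_mean:
  assumes "finite A" "finite S" "a \<noteq> 0"
  shows "pair_gen a m (gap_mean a (Suc m) t) A S =
    mean a m t (\<lambda>v. flux_gap A S (v @ [True]) - flux_gap A S (v @ [False])) 0 / 4"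
proof -
  have "pair_gen a m (gap_mean a (Suc m) t) A S = mean a (Suc m) t
     (\<lambda>w. (\<Sum>x<m. flux_gap (hop (Suc x) A) (hop (Suc x) S) w - flux_gap A S w) +
       a * (flux_gap (insert 1 A) (insert 1 S) w - flux_gap A S w)) 0"
    unfolding pair_gen_def gap_mean_def mean_add mean_cmult mean_sum mean_diff
    by (rule arg_cong2[where f = "(+)"]) (auto intro!: sum.reindex_bij_witness[of _ Suc "\<lambda>x. x - 1"])
  also have "\<dots> = mean a (Suc m) t (word_gen a (flux_gap A S)) 0"
  proof (rule arg_cong[where f = "\<lambda>g. g 0"], rule mean_cong)
    fix w :: "bool list" assume w: "length w = Suc m"
    have "flux_gap (hop (Suc x) A) (hop (Suc x) S) w = flux_gap A S (hop_word x w)" if "x < m" for x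
      using that w assms by (simp add: flux_gap_def flux_hop)
    moreover have "flux_gap (insert 1 A) (insert 1 S) w = flux_gap A S (inject_word w)"
    proof -
      have ne: "w \<noteq> []" using w by auto
      show ?thesis
        unfolding flux_gap_def flux_insert_1[OF assms(1) ne] flux_insert_1[OF assms(2) ne] ..
    qed
    ultimately show "(\<Sum>x<m. flux_gap (hop (Suc x) A) (hop (Suc x) S) w - flux_gap A S w) +
       a * (flux_gap (insert 1 A) (insert 1 S) w - flux_gap A S w) = word_gen a (flux_gap A S) w"
      by (simp add: word_gen_def w)
  qed
  finally show ?thesis using mean_word_gen[OF assms(3)] by simp
qed

text \<open>With site \<open>Suc m\<close> empty the last letter adds the same amount to both
  fluxes, so the right-end term left by \<open>mean_word_gen\<close> vanishes.\<close>

lemma gap_mean_harmonic: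
  assumes "finite S" "A \<subseteq> S" "a \<noteq> 0" "Suc m \<notin> S"
  shows "pair_gen a m (gap_mean a (Suc m) t) A S = 0"
proof -
  have fA: "finite A" using assms finite_subset by blast
  have nA: "Suc m \<notin> A" using assms by auto
  have "mean a m t (\<lambda>v. flux_gap A S (v @ [True]) - flux_gap A S (v @ [False])) = mean a m t (\<lambda>v. 0)"
    using assms fA nA by (intro mean_cong) (simp add: flux_gap_def flux_snoc_notin)
  then show ?thesis using pair_gen_gap_mean[OF fA assms(1,3), of m t] by simp
qed

text \<open>The hop out of the last site contributes at most minus a mean over the words that end in
  1. Since D |V\<rangle> = |V\<rangle> / 4, this mean equals the right-end term that the closed box
  leaves over.\<close>

lemma gap_mean_box_superharmonic:
  assumes "finite S" "A \<subseteq> S" "0 < a" "n \<le> m" "0 < n"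
  shows "pair_gen a m (gap_mean a n box_column) A S \<le> 0"
proof -
  have fA: "finite A" using assms finite_subset by blast
  obtain l where n: "n = Suc l" using assms(5) by (cases n) auto
  let ?g = "\<lambda>v. flux_gap A S (v @ [True]) - flux_gap A S (v @ [False])"
  let ?f = "\<lambda>x. gap_mean a n box_column (hop x A) (hop x S) - gap_mean a n box_column A S"
  have outside: "?f x = 0" if "n < x" for x
  proof -
    have "mean a n box_column (flux_gap (hop x A) (hop x S)) = mean a n box_column (flux_gap A S)"
      using that assms(1) fA by (intro mean_cong) (simp add: flux_gap_def flux_hop_outside)
    then show ?thesis by (simp add: gap_mean_def)
  qed
  have "(\<Sum>x = 1..m. ?f x) = (\<Sum>x = 1..n. ?f x)"
    using assms(4) outside by (intro sum.mono_neutral_right) auto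
  then have eq: "pair_gen a m (gap_mean a n box_column) A S
      = pair_gen a l (gap_mean a n box_column) A S + ?f n"
    unfolding pair_gen_def by (simp add: n)
  have "?f n = mean a n box_column (\<lambda>w. flux_gap (hop n A) (hop n S) w - flux_gap A S w) 0"
    by (simp add: gap_mean_def mean_diff)
  also have "\<dots> \<le> mean a n box_column (\<lambda>w. - (if last w then ?g (butlast w) else 0)) 0"
  proof (rule mean_mono)
    fix w :: "bool list" assume w: "length w = n"
    then have w_eq: "w = butlast w @ [last w]" "length (butlast w) = l"
      by (auto simp: n intro!: append_butlast_last_id[symmetric])
    have "flux_gap (hop n A) (hop n S) w \<le> flux_gap A S (butlast w @ [False])"
      using flux_gap_exit[OF assms(2,1), of "butlast w" "last w"] w_eq n by simp
    then show "flux_gap (hop n A) (hop n S) w - flux_gap A S w \<le> - (if last w then ?g (butlast w) else 0)"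
      using w_eq(1) by (cases "last w") auto
  qed (use assms in \<open>auto simp: box_column_def\<close>)
  also have "\<dots> = - mean a n box_column (\<lambda>w. if last w then ?g (butlast w) else 0) 0"
    using mean_cmult[of a n box_column "-1" "\<lambda>w. if last w then ?g (butlast w) else 0" 0] by simp
  also have "mean a n box_column (\<lambda>w. if last w then ?g (butlast w) else 0) 0 = mean a l (Dop box_column) ?g 0"
    unfolding n by (rule mean_snoc)
  also have "Dop box_column = (\<lambda>k. (1/4) * box_column k)"
    by (simp add: Dop_def box_column_def fun_eq_iff)
  also have "mean a l (\<lambda>k. (1/4) * box_column k) ?g 0 = (1/4) * mean a l box_column ?g 0"
    by (rule mean_column_cmult)
  finally show ?thesis
    unfolding eq using pair_gen_gap_mean[OF fA assms(1), of a l box_column] assms(3) by (simp add: n)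
qed


section \<open>Survival of a single discrepancy\<close>

text \<open>A hop preserves cardinality, so a discrepancy cannot disappear in the bulk; it can only
  be overwritten at site 1.\<close>

lemma hop_eq_iff: "A \<subseteq> S \<Longrightarrow> card (S - A) \<le> 1 \<Longrightarrow> finite S \<Longrightarrow> hop x A = hop x S \<longleftrightarrow> A = S"
proof
  assume AB: "A \<subseteq> S" "card (S - A) \<le> 1" "finite S" and eq: "hop x A = hop x S"
  have fA: "finite A" using AB finite_subset by blast
  have "card (hop x C) = card C" if "finite C" for C
    using that card_Suc_Diff1[of C x]
    by (cases "x \<in> C \<and> Suc x \<notin> C") (simp_all add: hop_def del: card_Diff_singleton)
  then have "card A = card S" using eq fA AB(3) by metis
  then show "A = S" using AB by (metis card_subset_eq)
qed simp

definition valid_pair :: "nat set \<Rightarrow> nat set \<Rightarrow> bool" where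
  "valid_pair A S \<longleftrightarrow> finite S \<and> 0 \<notin> S \<and> A \<subseteq> S \<and> card (S - A) \<le> 1"

lemma valid_pairD:
  assumes "valid_pair A S"
  shows "finite S" "0 \<notin> S" "A \<subseteq> S" "card (S - A) \<le> 1" "finite A" "0 \<notin> A"
  using assms finite_subset unfolding valid_pair_def by auto

lemma valid_pair_cases:
  assumes "valid_pair A S"
  obtains "A = S" | d where "d \<notin> A" "S = insert d A" "0 < d"
proof (cases "A = S")
  case False
  then obtain d where d: "d \<in> S" "d \<notin> A" using valid_pairD(3)[OF assms] by auto
  have "S - A = {d}"
    using valid_pairD(1,4)[OF assms] d card_le_Suc0_iff_eq[of "S - A"] by auto
  then have "S = insert d A" using valid_pairD(3)[OF assms] by auto
  with d valid_pairD(2)[OF assms] show ?thesis using that by (metis gr0I)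
qed (use that in blast)

section \<open>A Lyapunov function for leaving a box\<close>

definition in_box :: "nat \<Rightarrow> nat set \<Rightarrow> nat set \<Rightarrow> bool" where
  "in_box n A S \<longleftrightarrow> (\<exists>d\<in>S - A. d \<le> n)"

definition moment :: "nat \<Rightarrow> nat set \<Rightarrow> nat" where
  "moment n A = \<Sum>{y \<in> A. y \<le> n}"

lemma moment_le: "moment n A \<le> n * n"
proof -
  have "moment n A \<le> (\<Sum>y\<in>{1..n}. n)"
  proof -
    have "moment n A = \<Sum>({y \<in> A. y \<le> n} - {0})"
      unfolding moment_def by (rule sum.mono_neutral_right) auto
    also have "\<dots> \<le> \<Sum>{1..n}" by (rule sum_mono2) auto
    also have "\<dots> \<le> (\<Sum>y\<in>{1..n}. n)" by (rule sum_mono) auto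
    finally show ?thesis .
  qed
  then show ?thesis by simp
qed

lemma moment_hop:
  assumes "x \<in> A" "Suc x \<notin> A" "Suc x \<le> n"
  shows "moment n (hop x A) = Suc (moment n A)"
proof -
  have "{y \<in> hop x A. y \<le> n} = insert (Suc x) ({y \<in> A. y \<le> n} - {x})"
    using assms by (auto simp: hop_def)
  moreover have "x + \<Sum>({y \<in> A. y \<le> n} - {x}) = moment n A"
    unfolding moment_def using assms by (intro sum.remove[symmetric]) auto
  ultimately show ?thesis using assms by (simp add: moment_def)
qed

lemma moment_hop_outside: "n < x \<Longrightarrow> moment n (hop x A) = moment n A"
  unfolding moment_def hop_def by (rule arg_cong[where f = "\<Sum>"]) auto

lemma moment_insert_1:
  assumes "1 \<notin> A" "1 \<le> n"
  shows "moment n (insert 1 A) = Suc (moment n A)"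
proof -
  have "{y \<in> insert 1 A. y \<le> n} = insert 1 {y \<in> A. y \<le> n}" using assms by auto
  then show ?thesis using assms by (simp add: moment_def)
qed

lemma pair_gen_affine: "pair_gen a m (\<lambda>A S. c * f A S + c' * g A S + e) A S = c * pair_gen a m f A S + c' * pair_gen a m g A S"
  unfolding pair_gen_def by (simp add: sum_distrib_left distrib_left sum.distrib[symmetric] algebra_simps)

lemma pair_gen_alive:
  assumes "valid_pair A S" "0 < a"
  shows "pair_gen a m (\<lambda>A S. of_bool (A \<noteq> S)) A S = - a * of_bool (1 \<in> S - A)"
proof -
  have "(\<Sum>x = 1..m. of_bool (hop x A \<noteq> hop x S) - of_bool (A \<noteq> S) :: real) = 0"
    using hop_eq_iff valid_pairD[OF assms(1)] by (intro sum.neutral) auto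
  moreover have "of_bool (insert 1 A \<noteq> insert 1 S) - of_bool (A \<noteq> S) = - (of_bool (1 \<in> S - A) :: real)"
  proof (cases rule: valid_pair_cases[OF assms(1)])
    case (2 d)
    then have "insert 1 A = insert 1 S \<longleftrightarrow> d = 1" "A \<noteq> S" "1 \<in> S - A \<longleftrightarrow> d = 1" by blast+
    then show ?thesis by simp
  qed simp
  ultimately show ?thesis unfolding pair_gen_def by simp
qed

definition box_weight :: "nat \<Rightarrow> real \<Rightarrow> nat set \<Rightarrow> nat set \<Rightarrow> real" where
  "box_weight n M A S = of_bool (in_box n A S) * M ^ moment n A"

lemma box_weight_bounds:
  assumes "1 \<le> M" shows "0 \<le> box_weight n M A S" "box_weight n M A S \<le> M ^ (n * n)"
  using assms power_increasing[OF moment_le, of M n A] by (auto simp: box_weight_def)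

lemma pair_gen_box_weight_nonneg:
  "1 \<le> M \<Longrightarrow> 0 < a \<Longrightarrow> \<not> in_box n A S \<Longrightarrow> 0 \<le> pair_gen a m (box_weight n M) A S"
  unfolding pair_gen_def using box_weight_bounds(1)[of M n]
  by (auto intro!: add_nonneg_nonneg sum_nonneg mult_nonneg_nonneg simp: box_weight_def[of n M A S])

text \<open>Bonds beyond n change neither the moment nor whether the discrepancy is in the box. Each
  bond up to n outside Y can at worst reduce the nonnegative weight to 0, which costs one copy of
  it.\<close>

lemma sum_hops_ge:
  assumes AB: "valid_pair A S" and M: "1 \<le> M" and m: "n \<le> m" and box: "in_box n A S" and Y: "Y \<subseteq> {1..n}"
  shows "(\<Sum>x\<in>Y. box_weight n M (hop x A) (hop x S) - box_weight n M A S) - (real n - real (card Y)) * box_weight n M A S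
     \<le> (\<Sum>x = 1..m. box_weight n M (hop x A) (hop x S) - box_weight n M A S)"
proof -
  let ?f = "\<lambda>x. box_weight n M (hop x A) (hop x S) - box_weight n M A S"
  have outside: "?f x = 0" if x: "n < x" for x
  proof -
    obtain d where d: "d \<in> S - A" "d \<le> n" using box by (auto simp: in_box_def)
    then have "d \<in> hop x S - hop x A" using x by (auto simp: hop_def)
    then have "in_box n (hop x A) (hop x S)" using d by (auto simp: in_box_def)
    then show ?thesis using box moment_hop_outside[OF x] by (simp add: box_weight_def)
  qed
  have "(\<Sum>x = 1..m. ?f x) = (\<Sum>x = 1..n. ?f x)"
    using m outside by (intro sum.mono_neutral_right) auto
  also have "\<dots> = (\<Sum>x\<in>Y. ?f x) + (\<Sum>x\<in>{1..n} - Y. ?f x)"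
    using Y by (simp add: sum.subset_diff add.commute)
  also have "(\<Sum>x\<in>{1..n} - Y. ?f x) \<ge> (\<Sum>x\<in>{1..n} - Y. - box_weight n M A S)"
    using box_weight_bounds(1)[OF M, of n] by (intro sum_mono) auto
  moreover have "(\<Sum>x\<in>{1..n} - Y. - box_weight n M A S) = - (real n - real (card Y)) * box_weight n M A S"
    using Y card_mono[OF _ Y] finite_subset[OF Y] by (simp add: card_Diff_subset of_nat_diff algebra_simps)
  ultimately show ?thesis by (simp only:)
qed

lemma sum_hops_ge_0:
  assumes "valid_pair A S" "1 \<le> M" "n \<le> m" "in_box n A S"
  shows "- real n * box_weight n M A S
     \<le> (\<Sum>x = 1..m. box_weight n M (hop x A) (hop x S) - box_weight n M A S)"
  using sum_hops_ge[OF assms empty_subsetI] by simp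

text \<open>The witness is the end of the run of A that starts at site 1.\<close>

lemma exists_hop:
  assumes "1 \<in> A" "d \<notin> A" "1 \<le> d"
  shows "\<exists>y. 1 \<le> y \<and> y < d \<and> y \<in> A \<and> Suc y \<notin> A"
proof (rule ccontr)
  assume *: "\<not> ?thesis"
  have "k < d \<Longrightarrow> Suc k \<in> A" for k
  proof (induction k)
    case (Suc k)
    then have "Suc k \<in> A" by simp
    with * Suc.prems show ?case by (metis Suc_leI zero_less_Suc One_nat_def)
  qed (use assms in simp)
  from this[of "d - 1"] show False using assms by auto
qed

lemma pair_gen_box_weight_ge:
  assumes AB: "valid_pair A S" and a: "0 < a" "a \<le> 1" and m: "n \<le> m" and box: "in_box n A S" and "1 \<notin> S - A"
    and M: "M = (real n + 1) / a + 1"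
  shows "1 \<le> pair_gen a m (box_weight n M) A S"
proof -
  define g where "g = box_weight n M A S"
  have M1: "1 \<le> M" using a by (simp add: M)
  have g: "g = M ^ moment n A" "1 \<le> g" using box M1 by (auto simp: g_def box_weight_def)
  \<comment> \<open>M is chosen so that multiplying the weight by M at rate a gains n + 1 copies of
    it, one more than the n bonds of the box can lose.\<close>
  have aM: "a * (M - 1) = real n + 1" using a by (simp add: M)
  obtain d where d: "d \<notin> A" "S = insert d A" "0 < d"
    using valid_pair_cases[OF AB] box by (auto simp: in_box_def)
  have dn: "d \<le> n" "1 < d" using box d assms(6) by (auto simp: in_box_def intro!: Suc_lessI)
  show ?thesis
  proof (cases "1 \<in> A")
    case False
    have "in_box n (insert 1 A) (insert 1 S)" using d dn by (auto simp: in_box_def)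
    moreover have "moment n (insert 1 A) = Suc (moment n A)" using False dn by (intro moment_insert_1) auto
    ultimately have "box_weight n M (insert 1 A) (insert 1 S) = M * g" using g by (simp add: box_weight_def)
    then have "pair_gen a m (box_weight n M) A S \<ge> - real n * g + a * (M * g - g)"
      using sum_hops_ge_0[OF AB M1 m box] unfolding pair_gen_def g_def[symmetric] by simp
    also have "- real n * g + a * (M * g - g) = (a * (M - 1) - real n) * g" by (simp add: algebra_simps)
    finally show ?thesis using g(2) unfolding aM by simp
  next
    case True
    then obtain y where y: "1 \<le> y" "y < d" "y \<in> A" "Suc y \<notin> A" using exists_hop[of A d] d dn by auto
    \<comment> \<open>If the particle hops onto the discrepancy, the two change places and the
      discrepancy steps back to y; otherwise it stays at d.\<close>
    have "in_box n (hop y A) (hop y S)"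
    proof (cases "Suc y = d")
      case True
      then have "y \<in> hop y S - hop y A" using y d by (auto simp: hop_def)
      then show ?thesis using y dn unfolding in_box_def by (intro bexI[of _ y]) simp_all
    next
      case False
      then have "d \<in> hop y S - hop y A" using y d by (auto simp: hop_def)
      then show ?thesis using dn by (auto simp: in_box_def)
    qed
    moreover have "moment n (hop y A) = Suc (moment n A)" using y dn by (intro moment_hop) auto
    ultimately have "box_weight n M (hop y A) (hop y S) = M * g" using g by (simp add: box_weight_def)
    moreover have "{y} \<subseteq> {1..n}" using y dn by simp
    ultimately have "(M * g - g) - (real n - 1) * g
        \<le> (\<Sum>x = 1..m. box_weight n M (hop x A) (hop x S) - box_weight n M A S)"
      using sum_hops_ge[OF AB M1 m box, of "{y}"] unfolding g_def[symmetric] by simp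
    moreover have "insert 1 A = A" "insert 1 S = S" using True d by auto
    ultimately have "(M * g - g) - (real n - 1) * g \<le> pair_gen a m (box_weight n M) A S"
      unfolding pair_gen_def by simp
    moreover have "a * (M * g - g) \<le> 1 * (M * g - g)" using a M1 g(2) by (intro mult_right_mono) auto
    moreover have "a * (M * g - g) = (real n + 1) * g" unfolding aM[symmetric] by (simp add: algebra_simps)
    ultimately have "pair_gen a m (box_weight n M) A S \<ge> 2 * g" by (simp add: algebra_simps)
    then show ?thesis using g(2) by simp
  qed
qed

text \<open>
  While the discrepancy is in the box, either a particle can enter or one to its left can move, which
  increases \<open>moment\<close>; the geometric weight makes this gain dominate all other transitions.
\<close>

lemma lyapunov_exists:
  assumes a: "0 < a" "a \<le> 1"
  obtains L C where "\<And>A S. 0 \<le> L A S" "\<And>A S. L A S \<le> C"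
    "\<And>A S m. valid_pair A S \<Longrightarrow> n \<le> m \<Longrightarrow> pair_gen a m L A S \<le> - of_bool (in_box n A S)"
proof -
  define M where "M = (real n + 1) / a + 1"
  define R where "R = M ^ (n * n)"
  \<comment> \<open>With this value, a discrepancy at site 1 loses a / \<kappa> = 2 * (n + 2) * R
    through the survival indicator. That outweighs the drift n * R + R that the box weight can
    contribute there, plus 1.\<close>
  define \<kappa> where "\<kappa> = a / (2 * (real n + 2) * R)"
  \<comment> \<open>R bounds the box weight, so adding it keeps L nonnegative.\<close>
  define L where "L A S = 1 / \<kappa> * of_bool (A \<noteq> S) + (- 1) * box_weight n M A S + R" for A S
  have M1: "1 \<le> M" using a by (simp add: M_def)
  then have R1: "1 \<le> R" by (simp add: R_def one_le_power)
  have \<kappa>: "0 < \<kappa>" using a R1 by (simp add: \<kappa>_def)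
  have \<kappa>R: "1 / \<kappa> * a = 2 * (real n + 2) * R" using a R1 by (simp add: \<kappa>_def)
  show ?thesis
  proof (rule that[of L "1 / \<kappa> + R"])
    fix A S :: "nat set"
    have "0 \<le> 1 / \<kappa> * of_bool (A \<noteq> S)" "1 / \<kappa> * of_bool (A \<noteq> S) \<le> 1 / \<kappa>"
      using \<kappa> by (cases "A = S"; simp)+
    then show "0 \<le> L A S" "L A S \<le> 1 / \<kappa> + R"
      using box_weight_bounds[OF M1, of n A S] unfolding L_def R_def by linarith+
  next
    fix A S m assume AB: "valid_pair A S" and m: "n \<le> m"
    have gen: "pair_gen a m L A S = 1 / \<kappa> * (- a * of_bool (1 \<in> S - A)) - pair_gen a m (box_weight n M) A S"
    proof -
      have "L = (\<lambda>A S. 1 / \<kappa> * of_bool (A \<noteq> S) + (- 1) * box_weight n M A S + R)"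
        by (intro ext) (rule L_def)
      then have "pair_gen a m L A S = 1 / \<kappa> * pair_gen a m (\<lambda>A S. of_bool (A \<noteq> S)) A S
          + (- 1) * pair_gen a m (box_weight n M) A S"
        using pair_gen_affine[of a m "1 / \<kappa>" "\<lambda>A S. of_bool (A \<noteq> S)" "- 1" "box_weight n M" R A S] by (simp only:)
      then show ?thesis unfolding pair_gen_alive[OF AB a(1)] by linarith
    qed
    show "pair_gen a m L A S \<le> - of_bool (in_box n A S)"
    proof (cases "in_box n A S")
      case False
      have "0 \<le> 1 / \<kappa> * (a * of_bool (1 \<in> S - A))" using \<kappa> a by simp
      then show ?thesis using False pair_gen_box_weight_nonneg[OF M1 a(1) False, of m] unfolding gen by simp
    next
      case box: True
      show ?thesis
      proof (cases "1 \<in> S - A")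
        case False
        then have e: "of_bool (1 \<in> S - A) = (0 :: real)" by simp
        show ?thesis using pair_gen_box_weight_ge[OF AB a m box False M_def] box unfolding gen e by simp
      next
        case True
        define g where "g = box_weight n M A S"
        have g: "0 \<le> g" "g \<le> R" using box_weight_bounds[OF M1] by (auto simp: g_def R_def)
        have "- real n * g + a * (0 - g) \<le> pair_gen a m (box_weight n M) A S"
        proof -
          have "a * (0 - g) \<le> a * (box_weight n M (insert 1 A) (insert 1 S) - g)"
            using box_weight_bounds(1)[OF M1, of n "insert 1 A" "insert 1 S"] a
            by (intro mult_left_mono) simp_all
          with sum_hops_ge_0[OF AB M1 m box] show ?thesis
            unfolding pair_gen_def g_def by linarith
        qed
        moreover have "real n * g \<le> real n * R" "a * g \<le> 1 * R"
          using g a by (intro mult_left_mono mult_mono; simp)+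
        ultimately have "- pair_gen a m (box_weight n M) A S \<le> real n * R + R" by simp
        moreover have "1 / \<kappa> * (- a * of_bool (1 \<in> S - A)) = - (2 * (real n + 2) * R)" using True \<kappa>R by simp
        moreover have "1 + (real n * R + R) \<le> 2 * (real n + 2) * R"
        proof -
          have "0 \<le> real n * R" "2 * (real n + 2) * R = 2 * (real n * R) + 4 * R"
            using R1 by (simp_all add: algebra_simps)
          then show ?thesis using R1 by linarith
        qed
        ultimately show ?thesis unfolding gen using box by simp
      qed
    qed
  qed
qed

text \<open>The length is that of the smallest box containing S; the inserted 0 covers the empty
  set. By \<open>gap_mean_stable\<close> every larger box gives the same value.\<close>

definition survival :: "real \<Rightarrow> nat set \<Rightarrow> nat set \<Rightarrow> real" where
  "survival a A S = gap_mean a (Max (insert 0 S)) (half_line_column a) A S"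

text \<open>Letters at sites beyond S are counted equally in both fluxes.\<close>

lemma flux_gap_take:
  assumes "finite S" "A \<subseteq> S" "S \<subseteq> {..n}" "n \<le> length w"
  shows "flux_gap A S w = flux_gap A S (take n w)"
  using assms(4)
proof (induction w rule: rev_induct)
  case (snoc b w)
  show ?case
  proof (cases "n \<le> length w")
    case True
    have "Suc (length w) \<notin> S" "Suc (length w) \<notin> A" "finite A"
      using True assms finite_subset by auto
    then have "flux_gap A S (w @ [b]) = flux_gap A S w"
      using assms(1) by (simp add: flux_gap_def flux_snoc_notin)
    then show ?thesis using snoc True by simp
  next
    case False
    then have "n = length (w @ [b])" using snoc.prems by simp
    then show ?thesis by simp
  qed
qed simp

lemma gap_mean_stable:
  assumes "finite S" "A \<subseteq> S" "S \<subseteq> {..n}" "0 < a"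
  shows "gap_mean a n (half_line_column a) A S = survival a A S"
proof -
  let ?k = "Max (insert 0 S)"
  have S: "S \<subseteq> {..?k}" using assms(1) by auto
  have k: "?k \<le> n" using assms(1,3) by auto
  have inv: "Eop a (half_line_column a) k + half_line_column a (Suc k) = half_line_column a k" for k
    using half_line_column_invariant[of a k] assms(4) by simp
  have "mean a n (half_line_column a) (flux_gap A S) = mean a n (half_line_column a) (\<lambda>w. flux_gap A S (take ?k w))"
    by (rule mean_cong, rule flux_gap_take[OF assms(1,2) S]) (use k in simp)
  also have "\<dots> = mean a (?k + (n - ?k)) (half_line_column a) (\<lambda>w. flux_gap A S (take ?k w))"
    by (simp only: le_add_diff_inverse[OF k])
  also have "\<dots> = mean a ?k (half_line_column a) (flux_gap A S)"
    unfolding mean_take mean_one[where t = "half_line_column a", OF inv] ..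
  finally show ?thesis by (simp add: survival_def gap_mean_def)
qed

lemma survival_bounds:
  assumes "valid_pair A S" "1/2 \<le> a"
  shows "0 \<le> survival a A S" "survival a A S \<le> of_bool (A \<noteq> S)"
proof -
  note v = valid_pairD[OF assms(1)]
  have a: "0 < a" using assms(2) by simp
  have inv: "Eop a (half_line_column a) k + half_line_column a (Suc k) = half_line_column a k" for k
    using half_line_column_invariant[of a k] a by simp
  have "mean a (Max (insert 0 S)) (half_line_column a) (\<lambda>w. 0) 0 \<le> survival a A S"
    unfolding survival_def gap_mean_def using half_line_column_nonneg[OF assms(2)] a flux_gap_bounds(1)[OF v(3,1,4)]
    by (intro mean_mono) auto
  then show "0 \<le> survival a A S" by simp
  have "survival a A S \<le> mean a (Max (insert 0 S)) (half_line_column a) (\<lambda>w. of_bool (A \<noteq> S) * 1) 0"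
    unfolding survival_def gap_mean_def using half_line_column_nonneg[OF assms(2)] a flux_gap_bounds(2)[OF v(3,1,4)]
    by (intro mean_mono) auto
  then show "survival a A S \<le> of_bool (A \<noteq> S)"
    unfolding mean_cmult mean_one[where t = "half_line_column a", OF inv] by simp
qed

text \<open>The word length in \<open>survival\<close> changes when S moves. Rewriting every value
  with the common length \<open>Suc m\<close> makes \<open>gap_mean_harmonic\<close> applicable;
  hops from sites up to m stay within this length.\<close>

lemma survival_harmonic:
  assumes "valid_pair A S" "0 < a" "S \<subseteq> {..m}"
  shows "pair_gen a m (survival a) A S = 0"
proof -
  note v = valid_pairD[OF assms(1)]
  have stable: "survival a A' S' = gap_mean a (Suc m) (half_line_column a) A' S'"
    if "finite S'" "A' \<subseteq> S'" "S' \<subseteq> {..Suc m}" for A' S'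
    using gap_mean_stable[OF that assms(2)] by simp
  have hop: "hop x A \<subseteq> hop x S" "finite (hop x S)" for x
  proof -
    show "hop x A \<subseteq> hop x S"
      by (cases rule: valid_pair_cases[OF assms(1)]) (auto simp: hop_def)
    show "finite (hop x S)" using v by (simp add: hop_def)
  qed
  have "pair_gen a m (survival a) A S = pair_gen a m (gap_mean a (Suc m) (half_line_column a)) A S"
    unfolding pair_gen_def
  proof (intro arg_cong2[where f = "(+)"] sum.cong arg_cong2[where f = "(-)"] arg_cong2[where f = "(*)"] refl stable)
    fix x assume "x \<in> {1..m}"
    then show "hop x S \<subseteq> {..Suc m}" using assms(3) by (auto simp: hop_def)
  qed (use v assms(3) hop in auto)
  also have "\<dots> = 0" using v assms by (intro gap_mean_harmonic) auto
  finally show ?thesis .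
qed

definition box_survival :: "real \<Rightarrow> nat \<Rightarrow> nat set \<Rightarrow> nat set \<Rightarrow> real" where
  "box_survival a n A S = gap_mean a n box_column A S / tau_column a n 0"

lemma box_survival_bounds:
  assumes "valid_pair A S" "0 < a"
  shows "0 \<le> box_survival a n A S" "box_survival a n A S \<le> 1"
    "of_bool (A \<noteq> S) \<le> box_survival a n A S + of_bool (in_box n A S)"
proof -
  note v = valid_pairD[OF assms(1)]
  have tau: "0 < tau_column a n 0" by (rule tau_column_pos[OF assms(2)])
  have box: "0 \<le> box_column k" for k by (simp add: box_column_def)
  have one: "mean a n box_column (\<lambda>w. 1) 0 = tau_column a n 0" by (simp add: tau_column_def)
  have "mean a n box_column (\<lambda>w. 0) 0 \<le> gap_mean a n box_column A S"
    unfolding gap_mean_def using assms(2) box flux_gap_bounds(1)[OF v(3,1,4)] by (intro mean_mono) auto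
  then show nonneg: "0 \<le> box_survival a n A S" using tau by (simp add: box_survival_def)
  have "flux_gap A S w \<le> 1" for w
    using flux_gap_bounds(2)[OF v(3,1,4), of w] by (auto simp: of_bool_def split: if_splits)
  then have "gap_mean a n box_column A S \<le> mean a n box_column (\<lambda>w. 1) 0"
    unfolding gap_mean_def using assms(2) box by (intro mean_mono) auto
  then show "box_survival a n A S \<le> 1" using tau one by (simp add: box_survival_def)
  show "of_bool (A \<noteq> S) \<le> box_survival a n A S + of_bool (in_box n A S)"
  proof (cases "A \<noteq> S \<and> \<not> in_box n A S")
    case True
    then obtain d where d: "d \<in> S - A" "n < d" using v(3) by (auto simp: in_box_def not_le)
    have "gap_mean a n box_column A S = mean a n box_column (\<lambda>w. 1) 0"
      unfolding gap_mean_def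
      by (rule arg_cong[where f = "\<lambda>g. g 0"], rule mean_cong) (use flux_gap_outside[OF v(3,1,4) d(1)] d(2) in auto)
    then show ?thesis using one tau by (simp add: box_survival_def)
  qed (use nonneg in auto)
qed

lemma box_survival_superharmonic:
  assumes "valid_pair A S" "0 < a" "0 < n" "n \<le> m"
  shows "pair_gen a m (box_survival a n) A S \<le> 0"
proof -
  have tau: "0 < tau_column a n 0" by (rule tau_column_pos[OF assms(2)])
  have "pair_gen a m (box_survival a n) A S
      = pair_gen a m (\<lambda>A S. 1 / tau_column a n 0 * gap_mean a n box_column A S + 0 * 0 + 0) A S"
    by (simp add: box_survival_def[abs_def])
  also have "\<dots> = 1 / tau_column a n 0 * pair_gen a m (gap_mean a n box_column) A S"
    unfolding pair_gen_affine by simp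
  also have "\<dots> \<le> 0"
    using gap_mean_box_superharmonic[of S A a n m] valid_pairD[OF assms(1)] assms tau
    by (intro mult_nonneg_nonpos) auto
  finally show ?thesis .
qed

lemma box_survival_tendsto:
  assumes "valid_pair A S" "1/2 \<le> a"
  shows "(\<lambda>n. box_survival a n A S) \<longlonglongrightarrow> survival a A S"
proof -
  note v = valid_pairD[OF assms(1)]
  define k where "k = Max (insert 0 S)"
  have S: "S \<subseteq> {..k}" using v by (auto simp: k_def)
  have "box_survival a (m + k) A S = mean a (k + m) box_column (\<lambda>w. flux_gap A S (take k w)) 0 / tau_column a (k + m) 0" for m
  proof -
    have "mean a (k + m) box_column (flux_gap A S) = mean a (k + m) box_column (\<lambda>w. flux_gap A S (take k w))"
      by (rule mean_cong, rule flux_gap_take[OF v(1,3) S]) simp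
    then show ?thesis by (simp only: box_survival_def gap_mean_def add.commute[of m])
  qed
  note eq = this
  have "survival a A S = mean a k (half_line_column a) (flux_gap A S) 0"
    unfolding survival_def gap_mean_def k_def ..
  then have "(\<lambda>m. box_survival a (m + k) A S) \<longlonglongrightarrow> survival a A S"
    unfolding eq using box_mean_tendsto[OF assms(2), of k "flux_gap A S"] by simp
  then show ?thesis by (rule LIMSEQ_offset)
qed


section \<open>Layers of the multi-color TASEP\<close>

definition rank_right :: "enat \<Rightarrow> config \<Rightarrow> nat \<Rightarrow> nat" where
  "rank_right c \<eta> y = card {z. y < z \<and> \<eta> z = c}"

text \<open>
  The \<open>r\<close>-th particle of color \<open>c\<close>, counted from the right, is what \<open>layer c r\<close> has in addition to
  \<open>layer c (r - 1)\<close>: particles of color \<open>c\<close> to its right block it like stronger ones, and those to its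
  left are to it like holes.
\<close>

definition layer :: "enat \<Rightarrow> nat \<Rightarrow> config \<Rightarrow> nat set" where
  "layer c r \<eta> = {y. \<eta> y < c \<or> \<eta> y = c \<and> rank_right c \<eta> y < r}"

definition active :: "config \<Rightarrow> nat set" where
  "active \<eta> = {x. 1 \<le> x \<and> \<eta> x < \<eta> (Suc x)}"

definition occupied :: "config \<Rightarrow> nat set" where
  "occupied \<eta> = {x. \<eta> x \<noteq> \<infinity>}"

lemma finite_configsD:
  assumes "\<eta> \<in> finite_configs"
  shows "range \<eta> \<subseteq> {1, 2, 3, \<infinity>}" "\<eta> 0 = \<infinity>" "finite (occupied \<eta>)"
  using assms by (auto simp: finite_configs_def occupied_def)

lemma less_imp_not_infinity: "(m :: enat) < n \<Longrightarrow> m \<noteq> \<infinity>"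
  by (cases m) simp_all

lemma active_subset: "active \<eta> \<subseteq> occupied \<eta>"
  unfolding active_def occupied_def using less_imp_not_infinity by blast

lemma finite_active: "\<eta> \<in> finite_configs \<Longrightarrow> finite (active \<eta>)"
  using active_subset finite_configsD(3) finite_subset by blast

lemma finite_color: "\<eta> \<in> finite_configs \<Longrightarrow> c \<noteq> \<infinity> \<Longrightarrow> finite {z. P z \<and> \<eta> z = c}"
  by (rule finite_subset[OF _ finite_configsD(3)]) (auto simp: occupied_def)

lemma exchange_transpose: "exchange x \<eta> = \<eta> \<circ> Transposition.transpose x (Suc x)"
  by (auto simp: exchange_def Transposition.transpose_def fun_eq_iff)

lemma rank_right_Suc:
  assumes "\<eta> \<in> finite_configs" "c \<noteq> \<infinity>"
  shows "rank_right c \<eta> y = rank_right c \<eta> (Suc y) + of_bool (\<eta> (Suc y) = c)"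
proof -
  have "{z. y < z \<and> \<eta> z = c} = (if \<eta> (Suc y) = c then insert (Suc y) {z. Suc y < z \<and> \<eta> z = c} else {z. Suc y < z \<and> \<eta> z = c})"
  proof -
    have "y < z \<longleftrightarrow> z = Suc y \<or> Suc y < z" for z by linarith
    then show ?thesis by auto
  qed
  then show ?thesis using finite_color[OF assms] by (simp add: rank_right_def)
qed

lemma rank_right_exchange_left:
  assumes "y < x"
  shows "rank_right c (exchange x \<eta>) y = rank_right c \<eta> y"
proof -
  let ?t = "Transposition.transpose x (Suc x)"
  have "{z. y < z \<and> exchange x \<eta> z = c} = ?t ` {z. y < z \<and> \<eta> z = c}"
  proof (intro equalityI subsetI)
    fix z assume "z \<in> {z. y < z \<and> exchange x \<eta> z = c}"
    then have "?t z \<in> {z. y < z \<and> \<eta> z = c}"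
      using assms by (auto simp: exchange_transpose Transposition.transpose_def)
    then show "z \<in> ?t ` {z. y < z \<and> \<eta> z = c}" by (rule rev_image_eqI) simp
  next
    fix z assume "z \<in> ?t ` {z. y < z \<and> \<eta> z = c}"
    then show "z \<in> {z. y < z \<and> exchange x \<eta> z = c}"
      using assms by (auto simp: exchange_transpose) (auto simp: Transposition.transpose_def)
  qed
  then show ?thesis by (simp add: rank_right_def card_image)
qed

lemma rank_right_exchange_right: "Suc x \<le> y \<Longrightarrow> rank_right c (exchange x \<eta>) y = rank_right c \<eta> y"
  unfolding rank_right_def by (rule arg_cong[where f = card]) (auto simp: exchange_def)

lemma exchange_finite_configs:
  assumes "\<eta> \<in> finite_configs" "1 \<le> x"
  shows "exchange x \<eta> \<in> finite_configs" "occupied (exchange x \<eta>) = Transposition.transpose x (Suc x) ` occupied \<eta>"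
proof -
  let ?t = "Transposition.transpose x (Suc x)"
  show occ: "occupied (exchange x \<eta>) = ?t ` occupied \<eta>"
  proof (intro equalityI subsetI)
    fix z assume "z \<in> occupied (exchange x \<eta>)"
    then have "?t z \<in> occupied \<eta>" by (simp add: exchange_transpose occupied_def)
    then show "z \<in> ?t ` occupied \<eta>" by (rule rev_image_eqI) simp
  qed (auto simp: occupied_def exchange_transpose)
  have "finite (occupied (exchange x \<eta>))" unfolding occ using finite_configsD(3)[OF assms(1)] by simp
  moreover have "range (exchange x \<eta>) \<subseteq> {1, 2, 3, \<infinity>}"
    using finite_configsD(1)[OF assms(1)] unfolding exchange_transpose by (auto simp: image_subset_iff)
  moreover have "exchange x \<eta> 0 = \<infinity>"
    using finite_configsD(2)[OF assms(1)] assms(2) by (simp add: exchange_def)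
  ultimately show "exchange x \<eta> \<in> finite_configs" by (simp add: finite_configs_def occupied_def)
qed

lemma inject_finite_configs:
  assumes "\<eta> \<in> finite_configs"
  shows "inject \<eta> \<in> finite_configs" "occupied (inject \<eta>) = insert 1 (occupied \<eta>)"
proof -
  show occ: "occupied (inject \<eta>) = insert 1 (occupied \<eta>)"
    by (auto simp: occupied_def inject_def one_enat_def)
  have "finite (occupied (inject \<eta>))" unfolding occ using finite_configsD(3)[OF assms] by simp
  moreover have "range (inject \<eta>) \<subseteq> {1, 2, 3, \<infinity>}"
    using finite_configsD(1)[OF assms] by (auto simp: inject_def image_subset_iff)
  ultimately show "inject \<eta> \<in> finite_configs"
    using finite_configsD(2)[OF assms] by (simp add: finite_configs_def occupied_def inject_def)
qed

text \<open>The exchanged contents differ, so the order among the particles of color c and hence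
  their ranks are preserved. The memberships of x and \<open>Suc x\<close> are swapped, and as the
  stronger content sits at x, the layer contains x whenever it contains \<open>Suc x\<close>: the
  swap is a hop.\<close>

lemma layer_exchange:
  assumes \<eta>: "\<eta> \<in> finite_configs" and c: "c \<noteq> \<infinity>" and x: "x \<in> active \<eta>"
  shows "layer c r (exchange x \<eta>) = hop x (layer c r \<eta>)"
proof -
  have x1: "1 \<le> x" and less: "\<eta> x < \<eta> (Suc x)" using x by (auto simp: active_def)
  note ex = exchange_finite_configs(1)[OF \<eta> x1]
  have ex_x: "exchange x \<eta> x = \<eta> (Suc x)" "exchange x \<eta> (Suc x) = \<eta> x"
    by (auto simp: exchange_def)
  have other: "y \<in> layer c r (exchange x \<eta>) \<longleftrightarrow> y \<in> layer c r \<eta>" if "y \<noteq> x" "y \<noteq> Suc x" for y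
  proof -
    have "rank_right c (exchange x \<eta>) y = rank_right c \<eta> y"
      using that rank_right_exchange_left[of y x] rank_right_exchange_right[of x y] by (cases "y < x") auto
    then show ?thesis using that by (simp add: layer_def exchange_def)
  qed
  have r1: "rank_right c (exchange x \<eta>) (Suc x) = rank_right c \<eta> (Suc x)"
    by (rule rank_right_exchange_right) simp
  have 1: "Suc x \<in> layer c r (exchange x \<eta>) \<longleftrightarrow> x \<in> layer c r \<eta>"
    using rank_right_Suc[OF \<eta> c, of x] less by (auto simp: layer_def ex_x r1)
  have 2: "x \<in> layer c r (exchange x \<eta>) \<longleftrightarrow> Suc x \<in> layer c r \<eta>"
    using rank_right_Suc[OF ex c, of x] less by (auto simp: layer_def ex_x r1)
  have 3: "Suc x \<in> layer c r \<eta> \<Longrightarrow> x \<in> layer c r \<eta>"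
    using less by (auto simp: layer_def)
  show ?thesis
  proof (rule set_eqI)
    fix y show "y \<in> layer c r (exchange x \<eta>) \<longleftrightarrow> y \<in> hop x (layer c r \<eta>)"
      using other[of y] 1 2 3 by (cases "y = x"; cases "y = Suc x") (auto simp: hop_def)
  qed
qed

text \<open>The only delicate case is color c at both sites: the right particle has the smaller
  rank, so it belongs to the layer whenever the left one does and blocks it.\<close>

lemma layer_hop_inactive:
  assumes \<eta>: "\<eta> \<in> finite_configs" and c: "c \<noteq> \<infinity>" and x: "x \<notin> active \<eta>" "1 \<le> x"
  shows "hop x (layer c r \<eta>) = layer c r \<eta>"
proof -
  have "\<eta> (Suc x) \<le> \<eta> x" using x by (auto simp: active_def)
  then have "x \<in> layer c r \<eta> \<Longrightarrow> Suc x \<in> layer c r \<eta>"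
    using rank_right_Suc[OF \<eta> c, of x] by (auto simp: layer_def)
  then show ?thesis by (auto simp: hop_def)
qed

lemma layer_inject:
  assumes \<eta>: "\<eta> \<in> finite_configs" and c: "1 < c" "c \<noteq> \<infinity>"
  shows "layer c r (inject \<eta>) = insert 1 (layer c r \<eta>)"
proof (rule set_eqI)
  fix y
  have "rank_right c (inject \<eta>) y = rank_right c \<eta> y" if "1 \<le> y"
    unfolding rank_right_def using that by (intro arg_cong[where f = card]) (auto simp: inject_def)
  moreover have "0 \<notin> layer c r (inject \<eta>)" "0 \<notin> layer c r \<eta>"
    using finite_configsD(2)[OF \<eta>] c by (auto simp: layer_def inject_def)
  ultimately show "y \<in> layer c r (inject \<eta>) \<longleftrightarrow> y \<in> insert 1 (layer c r \<eta>)"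
    using c by (cases "y = 0"; cases "y = 1") (auto simp: layer_def inject_def)
qed

lemma one_in_layer:
  assumes \<eta>: "\<eta> \<in> finite_configs" and c: "1 < c" and "\<not> 1 < \<eta> 1"
  shows "insert 1 (layer c r \<eta>) = layer c r \<eta>"
proof -
  have "\<eta> 1 = 1 \<or> \<eta> 1 = 2 \<or> \<eta> 1 = 3 \<or> \<eta> 1 = \<infinity>" using finite_configsD(1)[OF \<eta>] by (auto simp: image_subset_iff)
  moreover have "(1::enat) < 2" "(1::enat) < 3" by (simp_all add: one_enat_def numeral_eq_enat)
  ultimately have "\<eta> 1 = 1" using assms(3) by auto
  then show ?thesis using c by (auto simp: layer_def)
qed

text \<open>The difference consists of the particle of color c with rank s, which is unique because
  ranks strictly decrease to the right.\<close>

lemma layer_valid_pair: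
  assumes \<eta>: "\<eta> \<in> finite_configs" and c: "c \<noteq> \<infinity>"
  shows "valid_pair (layer c s \<eta>) (layer c (Suc s) \<eta>)"
proof -
  have "layer c (Suc s) \<eta> \<subseteq> occupied \<eta>" unfolding layer_def occupied_def using c less_imp_not_infinity by blast
  then have "finite (layer c (Suc s) \<eta>)" using finite_configsD(3)[OF \<eta>] finite_subset by blast
  moreover have "0 \<notin> layer c (Suc s) \<eta>" using finite_configsD(2)[OF \<eta>] c by (auto simp: layer_def)
  moreover have "layer c s \<eta> \<subseteq> layer c (Suc s) \<eta>" by (auto simp: layer_def)
  moreover have "card (layer c (Suc s) \<eta> - layer c s \<eta>) \<le> 1"
  proof -
    have less: "rank_right c \<eta> y' < rank_right c \<eta> y" if "y < y'" "\<eta> y' = c" for y y'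
      unfolding rank_right_def
      by (rule psubset_card_mono[OF finite_color[OF \<eta> c]]) (use that in auto)
    have "layer c (Suc s) \<eta> - layer c s \<eta> = {y. \<eta> y = c \<and> rank_right c \<eta> y = s}"
      by (auto simp: layer_def)
    moreover have "y = y'" if "\<eta> y = c" "rank_right c \<eta> y = s" "\<eta> y' = c" "rank_right c \<eta> y' = s" for y y'
      using less[of y y'] less[of y' y] that by (metis less_irrefl linorder_neqE_nat)
    moreover have "finite {y. \<eta> y = c \<and> rank_right c \<eta> y = s}"
      using finite_color[OF \<eta> c, of "\<lambda>y. rank_right c \<eta> y = s"] by (simp add: conj_commute)
    ultimately show ?thesis by (simp add: card_le_Suc0_iff_eq)
  qed
  ultimately show ?thesis by (simp add: valid_pair_def)
qed

section \<open>Generator of the multi-color TASEP\<close>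

definition successors :: "config \<Rightarrow> config set" where
  "successors \<eta> = (\<lambda>x. exchange x \<eta>) ` active \<eta> \<union> (if 1 < \<eta> 1 then {inject \<eta>} else {})"

definition total_position :: "config \<Rightarrow> real" where
  "total_position \<eta> = (\<Sum>x\<in>occupied \<eta>. real x)"

text \<open>The rate is itself a sum over moves. Interchanging it with the sum over target
  configurations gives each move its own term, whether or not two moves share a target.\<close>

lemma sum_successors:
  assumes "\<eta> \<in> finite_configs"
  shows "(\<Sum>\<zeta>\<in>successors \<eta>. tasep_rate a \<eta> \<zeta> * (u \<zeta> - u \<eta>)) =
     (\<Sum>x\<in>active \<eta>. u (exchange x \<eta>) - u \<eta>) + a * of_bool (1 < \<eta> 1) * (u (inject \<eta>) - u \<eta>)"
proof -
  have fin: "finite (active \<eta>)" by (rule finite_active[OF assms])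
  then have finS: "finite (successors \<eta>)" by (simp add: successors_def)
  have rate: "tasep_rate a \<eta> \<zeta> = (\<Sum>x\<in>active \<eta>. of_bool (exchange x \<eta> = \<zeta>)) + a * of_bool (1 < \<eta> 1 \<and> inject \<eta> = \<zeta>)" for \<zeta>
  proof -
    have "{x. 1 \<le> x \<and> \<eta> x < \<eta> (Suc x) \<and> exchange x \<eta> = \<zeta>} = {x \<in> active \<eta>. exchange x \<eta> = \<zeta>}"
      by (auto simp: active_def)
    then have "tasep_rate a \<eta> \<zeta> = real (card {x \<in> active \<eta>. exchange x \<eta> = \<zeta>}) + a * of_bool (1 < \<eta> 1 \<and> inject \<eta> = \<zeta>)"
      by (simp add: tasep_rate_def)
    also have "real (card {x \<in> active \<eta>. exchange x \<eta> = \<zeta>}) = (\<Sum>x\<in>active \<eta>. of_bool (exchange x \<eta> = \<zeta>))"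
      using fin by (simp add: of_bool_def sum.If_cases Int_def)
    finally show ?thesis .
  qed
  have "(\<Sum>\<zeta>\<in>successors \<eta>. tasep_rate a \<eta> \<zeta> * (u \<zeta> - u \<eta>)) =
      (\<Sum>\<zeta>\<in>successors \<eta>. \<Sum>x\<in>active \<eta>. of_bool (exchange x \<eta> = \<zeta>) * (u \<zeta> - u \<eta>))
      + (\<Sum>\<zeta>\<in>successors \<eta>. a * of_bool (1 < \<eta> 1 \<and> inject \<eta> = \<zeta>) * (u \<zeta> - u \<eta>))"
    unfolding rate distrib_right sum.distrib sum_distrib_right ..
  also have "(\<Sum>\<zeta>\<in>successors \<eta>. \<Sum>x\<in>active \<eta>. of_bool (exchange x \<eta> = \<zeta>) * (u \<zeta> - u \<eta>))
      = (\<Sum>x\<in>active \<eta>. \<Sum>\<zeta>\<in>successors \<eta>. of_bool (exchange x \<eta> = \<zeta>) * (u \<zeta> - u \<eta>))"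
    by (rule sum.swap)
  also have "\<dots> = (\<Sum>x\<in>active \<eta>. u (exchange x \<eta>) - u \<eta>)"
  proof (rule sum.cong[OF refl])
    fix x assume "x \<in> active \<eta>"
    then have mem: "exchange x \<eta> \<in> successors \<eta>" by (auto simp: successors_def)
    have "(\<Sum>\<zeta>\<in>successors \<eta>. of_bool (exchange x \<eta> = \<zeta>) * (u \<zeta> - u \<eta>))
        = (\<Sum>\<zeta>\<in>{exchange x \<eta>}. of_bool (exchange x \<eta> = \<zeta>) * (u \<zeta> - u \<eta>))"
      using mem finS by (intro sum.mono_neutral_right) auto
    then show "(\<Sum>\<zeta>\<in>successors \<eta>. of_bool (exchange x \<eta> = \<zeta>) * (u \<zeta> - u \<eta>)) = u (exchange x \<eta>) - u \<eta>" by simp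
  qed
  also have "(\<Sum>\<zeta>\<in>successors \<eta>. a * of_bool (1 < \<eta> 1 \<and> inject \<eta> = \<zeta>) * (u \<zeta> - u \<eta>)) = a * of_bool (1 < \<eta> 1) * (u (inject \<eta>) - u \<eta>)"
  proof (cases "1 < \<eta> 1")
    case True
    then have mem: "inject \<eta> \<in> successors \<eta>" by (simp add: successors_def)
    have "(\<Sum>\<zeta>\<in>successors \<eta>. a * of_bool (1 < \<eta> 1 \<and> inject \<eta> = \<zeta>) * (u \<zeta> - u \<eta>))
        = (\<Sum>\<zeta>\<in>{inject \<eta>}. a * of_bool (1 < \<eta> 1 \<and> inject \<eta> = \<zeta>) * (u \<zeta> - u \<eta>))"
      using mem finS by (intro sum.mono_neutral_right) auto
    then show ?thesis using True by simp
  qed simp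
  finally show ?thesis .
qed

lemma successors_finite_configs:
  assumes "\<eta> \<in> finite_configs"
  shows "successors \<eta> \<subseteq> finite_configs - {\<eta>}"
proof
  fix \<zeta> assume "\<zeta> \<in> successors \<eta>"
  then consider x where "x \<in> active \<eta>" "\<zeta> = exchange x \<eta>" | "1 < \<eta> 1" "\<zeta> = inject \<eta>"
    by (auto simp: successors_def split: if_splits)
  then show "\<zeta> \<in> finite_configs - {\<eta>}"
  proof cases
    case 1
    then have "\<zeta> x = \<eta> (Suc x)" "\<eta> x < \<eta> (Suc x)" "1 \<le> x" by (auto simp: exchange_def active_def)
    then show ?thesis using exchange_finite_configs(1)[OF assms] 1 by auto
  next
    case 2
    then have "\<zeta> 1 = 1" by (simp add: inject_def)
    then show ?thesis using inject_finite_configs(1)[OF assms] 2 by auto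
  qed
qed

lemma total_position_drift:
  assumes "\<eta> \<in> finite_configs" "0 \<le> a" "a \<le> 1"
  shows "(\<Sum>\<zeta>\<in>successors \<eta>. tasep_rate a \<eta> \<zeta> * (total_position \<zeta> - total_position \<eta>)) \<le> total_position \<eta> + 1"
proof -
  note fin = finite_configsD(3)[OF assms(1)]
  have ex: "total_position (exchange x \<eta>) - total_position \<eta> \<le> 1" if x: "x \<in> active \<eta>" for x
  proof -
    have "1 \<le> x" using x by (simp add: active_def)
    then have "total_position (exchange x \<eta>) = (\<Sum>y\<in>occupied \<eta>. real (Transposition.transpose x (Suc x) y))"
      unfolding total_position_def exchange_finite_configs(2)[OF assms(1) \<open>1 \<le> x\<close>]
      by (subst sum.reindex) (auto simp: o_def)
    also have "\<dots> \<le> (\<Sum>y\<in>occupied \<eta>. real y + of_bool (y = x))"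
      by (rule sum_mono) (auto simp: Transposition.transpose_def)
    also have "\<dots> \<le> total_position \<eta> + 1"
      using fin by (simp add: sum.distrib total_position_def of_bool_def)
    finally show ?thesis by simp
  qed
  \<comment> \<open>Each exchange gains at most 1, and active sites are occupied and at least 1, so
    their number is bounded by the sum of the occupied positions.\<close>
  have "(\<Sum>x\<in>active \<eta>. total_position (exchange x \<eta>) - total_position \<eta>) \<le> (\<Sum>x\<in>active \<eta>. real x)"
  proof (rule sum_mono)
    fix x assume "x \<in> active \<eta>"
    then show "total_position (exchange x \<eta>) - total_position \<eta> \<le> real x"
      using ex[of x] by (simp add: active_def)
  qed
  also have "\<dots> \<le> total_position \<eta>"
    unfolding total_position_def using fin active_subset by (intro sum_mono2) auto
  finally have 1: "(\<Sum>x\<in>active \<eta>. total_position (exchange x \<eta>) - total_position \<eta>) \<le> total_position \<eta>" .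
  have "total_position (inject \<eta>) - total_position \<eta> \<le> 1" "0 \<le> total_position (inject \<eta>) - total_position \<eta>"
    unfolding total_position_def inject_finite_configs(2)[OF assms(1)] using fin by (auto simp: sum.insert_if)
  then have "a * (total_position (inject \<eta>) - total_position \<eta>) \<le> 1 * 1"
    using assms by (intro mult_mono) auto
  moreover have "0 \<le> a * (total_position (inject \<eta>) - total_position \<eta>)"
    using assms \<open>0 \<le> total_position (inject \<eta>) - total_position \<eta>\<close> by simp
  ultimately have "a * of_bool (1 < \<eta> 1) * (total_position (inject \<eta>) - total_position \<eta>) \<le> 1"
    by (cases "1 < \<eta> 1") auto
  with 1 show ?thesis unfolding sum_successors[OF assms(1)] by simp
qed

lemma finite_total_position: "finite {\<eta> \<in> finite_configs. total_position \<eta> \<le> v}"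
proof -
  define n where "n = nat \<lfloor>v\<rfloor>"
  have "{\<eta> \<in> finite_configs. total_position \<eta> \<le> v} \<subseteq>
    {\<eta>. \<forall>x. (x \<in> {..n} \<longrightarrow> \<eta> x \<in> {1, 2, 3, \<infinity>}) \<and> (x \<notin> {..n} \<longrightarrow> \<eta> x = \<infinity>)}"
  proof (intro subsetI CollectI allI conjI impI)
    fix \<eta> x assume \<eta>: "\<eta> \<in> {\<eta> \<in> finite_configs. total_position \<eta> \<le> v}"
    then show "\<eta> x \<in> {1, 2, 3, \<infinity>}" using finite_configsD(1)[of \<eta>] by blast
    assume x: "x \<notin> {..n}"
    show "\<eta> x = \<infinity>"
    proof (rule ccontr)
      assume "\<eta> x \<noteq> \<infinity>"
      then have "x \<in> occupied \<eta>" by (simp add: occupied_def)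
      then have "real x \<le> total_position \<eta>"
        unfolding total_position_def using \<eta> finite_configsD(3)[of \<eta>] by (intro member_le_sum) auto
      then have "real x \<le> v" using \<eta> by simp
      then show False using x by (auto simp: n_def le_nat_floor)
    qed
  qed
  moreover have "finite {\<eta>. \<forall>x. (x \<in> {..n} \<longrightarrow> \<eta> x \<in> {1, 2, 3, \<infinity> :: enat}) \<and> (x \<notin> {..n} \<longrightarrow> \<eta> x = \<infinity>)}"
    by (rule finite_set_of_finite_funs) auto
  ultimately show ?thesis by (rule finite_subset)
qed

lemma tasep_jump_chain:
  assumes "transition_function finite_configs p" "has_jump_rates finite_configs p (tasep_rate a)" "0 \<le> a" "a \<le> 1"
  shows "jump_chain finite_configs p (tasep_rate a) successors total_position"
proof
  show "finite (successors \<eta>)" if "\<eta> \<in> finite_configs" for \<eta>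
    using finite_active[OF that] by (simp add: successors_def)
  show "tasep_rate a \<eta> \<zeta> = 0" if "\<zeta> \<notin> successors \<eta>" for \<eta> \<zeta>
  proof -
    have none: "{x. 1 \<le> x \<and> \<eta> x < \<eta> (Suc x) \<and> exchange x \<eta> = \<zeta>} = {}" "\<not> (\<eta> 1 > 1 \<and> inject \<eta> = \<zeta>)"
      using that by (auto simp: successors_def active_def split: if_splits)
    show ?thesis unfolding tasep_rate_def none(1) using none(2) by (simp only: card.empty) simp
  qed
  show "0 \<le> tasep_rate a \<eta> \<zeta>" for \<eta> \<zeta> using assms(3) by (simp add: tasep_rate_def)
  show "0 \<le> total_position \<eta>" for \<eta> by (simp add: total_position_def sum_nonneg)
qed (use assms successors_finite_configs finite_total_position total_position_drift in auto)

text \<open>Bonds inactive in \<eta> are blocked in both layers, and when injection is impossible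
  site 1 already belongs to both; hence the two generators have the same nonzero terms.\<close>

lemma layer_gen:
  assumes p: "jump_chain finite_configs p (tasep_rate a) successors total_position"
    and \<eta>: "\<eta> \<in> finite_configs" and c: "1 < c" "c \<noteq> \<infinity>" and m: "active \<eta> \<subseteq> {1..m}"
  shows "jump_chain.gen (tasep_rate a) successors (\<lambda>\<eta>. f (layer c r \<eta>) (layer c s \<eta>)) \<eta> = pair_gen a m f (layer c r \<eta>) (layer c s \<eta>)"
proof -
  have "(\<Sum>x\<in>active \<eta>. f (layer c r (exchange x \<eta>)) (layer c s (exchange x \<eta>)) - f (layer c r \<eta>) (layer c s \<eta>))
     = (\<Sum>x\<in>active \<eta>. f (hop x (layer c r \<eta>)) (hop x (layer c s \<eta>)) - f (layer c r \<eta>) (layer c s \<eta>))"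
    by (rule sum.cong) (simp_all add: layer_exchange[OF \<eta> c(2)])
  also have "\<dots> = (\<Sum>x = 1..m. f (hop x (layer c r \<eta>)) (hop x (layer c s \<eta>)) - f (layer c r \<eta>) (layer c s \<eta>))"
    using m by (intro sum.mono_neutral_left) (auto simp: layer_hop_inactive[OF \<eta> c(2)])
  finally have 1: "(\<Sum>x\<in>active \<eta>. f (layer c r (exchange x \<eta>)) (layer c s (exchange x \<eta>)) - f (layer c r \<eta>) (layer c s \<eta>)) = \<dots>" .
  have 2: "a * of_bool (1 < \<eta> 1) * (f (layer c r (inject \<eta>)) (layer c s (inject \<eta>)) - f (layer c r \<eta>) (layer c s \<eta>))
     = a * (f (insert 1 (layer c r \<eta>)) (insert 1 (layer c s \<eta>)) - f (layer c r \<eta>) (layer c s \<eta>))"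
    unfolding layer_inject[OF \<eta> c] using one_in_layer[OF \<eta> c(1)] by (cases "1 < \<eta> 1") simp_all
  show ?thesis
    unfolding jump_chain.gen_def[OF p]
      sum_successors[OF \<eta>, of a "\<lambda>\<eta>. f (layer c r \<eta>) (layer c s \<eta>)"] 1 2 pair_gen_def ..
qed

text \<open>For fixed n the survival probability lies between h and k n + C / t, where C depends on
  n. Therefore t tends to infinity first, and then k n tends to h.\<close>

lemma survival_limit:
  assumes p: "transition_function finite_configs p" "has_jump_rates finite_configs p (tasep_rate a)"
    and a: "1/2 < a" "a \<le> 1" and \<eta>0: "\<eta>0 \<in> finite_configs" and c: "1 < c" "c \<noteq> \<infinity>"
  shows "((\<lambda>t. \<Sum>\<^sub>\<infinity>\<eta>\<in>finite_configs. p t \<eta>0 \<eta> * of_bool (layer c s \<eta> \<noteq> layer c (Suc s) \<eta>)) \<longlongrightarrow>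
    survival a (layer c s \<eta>0) (layer c (Suc s) \<eta>0)) at_top"
proof -
  let ?A = "layer c s" and ?B = "layer c (Suc s)"
  have a0: "0 < a" "1/2 \<le> a" "0 \<le> a" using a by auto
  note chain = tasep_jump_chain[OF p a0(3) a(2)]
  interpret jump_chain finite_configs p "tasep_rate a" successors total_position by (rule chain)
  define f where "f \<eta> = (of_bool (?A \<eta> \<noteq> ?B \<eta>) :: real)" for \<eta>
  define h where "h = survival a (?A \<eta>0) (?B \<eta>0)"
  define k where "k n = box_survival a n (?A \<eta>0) (?B \<eta>0)" for n
  note valid = layer_valid_pair[OF _ c(2), of _ s]
  have gen_eq: "\<exists>m\<ge>n. ?B \<eta> \<subseteq> {..m} \<and>
      (\<forall>g. gen (\<lambda>\<eta>. g (?A \<eta>) (?B \<eta>)) \<eta> = pair_gen a m g (?A \<eta>) (?B \<eta>))"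
    if \<eta>: "\<eta> \<in> finite_configs" for n \<eta>
  proof -
    define m where "m = Max (insert n (active \<eta> \<union> ?B \<eta>))"
    have fin: "finite (active \<eta> \<union> ?B \<eta>)"
      using finite_active[OF \<eta>] valid_pairD(1)[OF valid[OF \<eta>]] by simp
    have "active \<eta> \<subseteq> {1..m}" "?B \<eta> \<subseteq> {..m}" "n \<le> m"
      using fin by (auto simp: m_def active_def intro!: Max_ge)
    then show ?thesis using layer_gen[OF chain \<eta> c] by blast
  qed
  have f_abs: "\<bar>f \<eta>\<bar> \<le> 1" for \<eta> by (simp add: f_def)
  have lower: "h \<le> sg t f \<eta>0" if "0 \<le> t" for t
    unfolding h_def
  proof (rule harmonic_le_sg[where C = 1 and C' = 1 and H = "\<lambda>\<eta>. survival a (?A \<eta>) (?B \<eta>)"])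
    fix \<eta> assume \<eta>: "\<eta> \<in> finite_configs"
    have b: "0 \<le> survival a (?A \<eta>) (?B \<eta>)" "survival a (?A \<eta>) (?B \<eta>) \<le> f \<eta>"
      unfolding f_def using survival_bounds[OF valid[OF \<eta>] a0(2)] by auto
    then show "survival a (?A \<eta>) (?B \<eta>) \<le> f \<eta>" by simp
    show "\<bar>survival a (?A \<eta>) (?B \<eta>)\<bar> \<le> 1" using b f_abs[of \<eta>] by linarith
    obtain m where m: "?B \<eta> \<subseteq> {..m}"
      "\<And>g. gen (\<lambda>\<eta>. g (?A \<eta>) (?B \<eta>)) \<eta> = pair_gen a m g (?A \<eta>) (?B \<eta>)"
      using gen_eq[OF \<eta>, of 0] by blast
    show "gen (\<lambda>\<eta>. survival a (?A \<eta>) (?B \<eta>)) \<eta> = 0"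
      unfolding m(2)[of "survival a"] by (rule survival_harmonic[OF valid[OF \<eta>] a0(1) m(1)])
  qed (use f_abs that \<eta>0 in auto)
  have upper: "\<exists>C. \<forall>t>0. sg t f \<eta>0 \<le> k n + C / t" if n: "0 < n" for n
  proof -
    obtain L C where L: "\<And>A B. 0 \<le> L A B" "\<And>A B. L A B \<le> C"
      "\<And>A B m. valid_pair A B \<Longrightarrow> n \<le> m \<Longrightarrow> pair_gen a m L A B \<le> - of_bool (in_box n A B)"
      using lyapunov_exists[OF a0(1) a(2), of n] by metis
    have "sg t f \<eta>0 \<le> k n + C / t" if t: "0 < t" for t
      unfolding k_def
    proof (rule sg_le_superharmonic[where C = 1 and L = "\<lambda>\<eta>. L (?A \<eta>) (?B \<eta>)"
          and K = "\<lambda>\<eta>. box_survival a n (?A \<eta>) (?B \<eta>)"])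
      fix \<eta> assume \<eta>: "\<eta> \<in> finite_configs"
      note bs = box_survival_bounds[OF valid[OF \<eta>] a0(1), of n]
      then show "\<bar>box_survival a n (?A \<eta>) (?B \<eta>)\<bar> \<le> 1" by linarith
      obtain m where m: "n \<le> m"
        "\<And>g. gen (\<lambda>\<eta>. g (?A \<eta>) (?B \<eta>)) \<eta> = pair_gen a m g (?A \<eta>) (?B \<eta>)"
        using gen_eq[OF \<eta>, of n] by blast
      show "gen f \<eta> \<le> 0"
        using m(2)[of "\<lambda>A B. of_bool (A \<noteq> B)"] a0(1)
        unfolding f_def[abs_def] pair_gen_alive[OF valid[OF \<eta>] a0(1)] by simp
      show "gen (\<lambda>\<eta>. box_survival a n (?A \<eta>) (?B \<eta>)) \<eta> \<le> 0"
        unfolding m(2)[of "box_survival a n"] by (rule box_survival_superharmonic[OF valid[OF \<eta>] a0(1) n m(1)])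
      show "f \<eta> - box_survival a n (?A \<eta>) (?B \<eta>) + gen (\<lambda>\<eta>. L (?A \<eta>) (?B \<eta>)) \<eta> \<le> 0"
        unfolding m(2)[of L] using L(3)[OF valid[OF \<eta>] m(1)] bs(3) unfolding f_def by linarith
    qed (use f_abs L t \<eta>0 in auto)
    then show ?thesis by blast
  qed
  have lim: "k \<longlonglongrightarrow> h"
    unfolding k_def h_def by (rule box_survival_tendsto[OF valid[OF \<eta>0] a0(2)])
  have "((\<lambda>t. sg t f \<eta>0) \<longlongrightarrow> h) at_top"
  proof (rule order_tendstoI)
    fix y assume "y < h"
    show "\<forall>\<^sub>F t in at_top. y < sg t f \<eta>0"
      by (rule eventually_mono[OF eventually_ge_at_top[of 0]]) (use lower \<open>y < h\<close> in force)
  next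
    fix y assume y: "h < y"
    have "\<forall>\<^sub>F n in sequentially. 0 < n \<and> k n < y"
      by (intro eventually_conj eventually_gt_at_top order_tendstoD(2)[OF lim y])
    then obtain n where n: "0 < n" "k n < y" by (auto simp: eventually_sequentially)
    obtain C where C: "\<And>t. 0 < t \<Longrightarrow> sg t f \<eta>0 \<le> k n + C / t" using upper[OF n(1)] by blast
    have "((\<lambda>t. k n + C / t) \<longlongrightarrow> k n + 0) at_top"
      by (intro tendsto_add tendsto_const tendsto_divide_0[OF tendsto_const] filterlim_at_top_imp_at_infinity filterlim_ident)
    then have "\<forall>\<^sub>F t in at_top. k n + C / t < y" using n(2) by (intro order_tendstoD(2)) auto
    with eventually_gt_at_top[of 0] show "\<forall>\<^sub>F t in at_top. sg t f \<eta>0 < y"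
      by eventually_elim (use C in \<open>fastforce intro: le_less_trans\<close>)
  qed
  then show ?thesis unfolding sg_def f_def h_def .
qed


section \<open>Paths in the DEHP-tree\<close>

definition trues :: "bool list \<Rightarrow> nat" where "trues w = length (filter id w)"
definition falses :: "bool list \<Rightarrow> nat" where "falses w = length (filter Not w)"

lemma trues_simps [simp]: "trues [] = 0" "trues (b # w) = of_bool b + trues w" "trues (v @ w) = trues v + trues w"
  by (auto simp: trues_def)

lemma falses_simps [simp]: "falses [] = 0" "falses (b # w) = of_bool (\<not> b) + falses w" "falses (v @ w) = falses v + falses w"
  by (auto simp: falses_def)

lemma sum_nth_eq_sum_list_drop: "(\<Sum>j = i..<length xs. xs ! j) = sum_list (drop i (xs :: nat list))"
proof (induction xs arbitrary: i)
  case (Cons x xs)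
  show ?case
  proof (cases i)
    case 0
    then show ?thesis by (simp add: sum_list_sum_nth atLeast0LessThan)
  next
    case (Suc k)
    then show ?thesis using Cons[of k] by (simp only: length_Cons sum.atLeast_Suc_lessThan_Suc_shift drop_Suc_Cons o_def nth_Cons_Suc)
  qed
qed simp

lemma Phi_eq: "Phi \<eta> j = sum_list (drop j (gap_lengths \<eta>))"
proof -
  have "{j..num_clusters \<eta>} = {j..<length (gap_lengths \<eta>)}"
    by (auto simp: length_gap_lengths num_clusters_def)
  then show ?thesis by (simp add: Phi_def tau_def sum_nth_eq_sum_list_drop[symmetric])
qed

lemma Psi_eq: "Psi \<eta> (Suc i) = sum_list (drop i (cluster_lengths \<eta>))"
proof -
  have "Psi \<eta> (Suc i) = (\<Sum>j = Suc i..<Suc (length (cluster_lengths \<eta>)). cluster_lengths \<eta> ! (j - 1))"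
    unfolding Psi_def sigma_def num_clusters_def by (rule sum.cong) auto
  also have "\<dots> = (\<Sum>j = i..<length (cluster_lengths \<eta>). cluster_lengths \<eta> ! j)"
    by (simp only: sum.atLeast_Suc_lessThan_Suc_shift o_def diff_Suc_1)
  finally show ?thesis by (simp add: sum_nth_eq_sum_list_drop)
qed

lemma Phi_antimono: "i \<le> j \<Longrightarrow> Phi \<eta> j \<le> Phi \<eta> i"
  unfolding Phi_def by (rule sum_mono2) auto

text \<open>Peeling off the first gap u and the first cluster v shortens both lists by their heads,
  which is the step of the inductions on the length below.\<close>

lemma cluster_decomposition:
  obtains (none) "cluster_lengths \<eta> = []" "gap_lengths \<eta> = [falses \<eta>]" "trues \<eta> = 0"
  | (some) u v \<zeta> where "\<eta> = u @ v @ \<zeta>" "True \<notin> set u" "False \<notin> set v" "v \<noteq> []" "length \<zeta> < length \<eta>"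
      "cluster_lengths \<eta> = length v # cluster_lengths \<zeta>" "gap_lengths \<eta> = length u # gap_lengths \<zeta>"
proof (cases "dropWhile Not \<eta>")
  case Nil
  then have all: "\<forall>b\<in>set \<eta>. \<not> b" by (auto simp: dropWhile_eq_Nil_conv)
  then have "takeWhile Not \<eta> = \<eta>" by (simp add: takeWhile_eq_all_conv)
  moreover have "falses \<eta> = length \<eta>" "trues \<eta> = 0" using all by (auto simp: falses_def trues_def filter_empty_conv)
  moreover have "cluster_lengths \<eta> = []" "gap_lengths \<eta> = [length (takeWhile Not \<eta>)]"
    using Nil by (subst cluster_lengths.simps gap_lengths.simps; simp add: Let_def)+
  ultimately have "gap_lengths \<eta> = [falses \<eta>]" "cluster_lengths \<eta> = []" "trues \<eta> = 0"
    by (simp_all only:)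
  then show ?thesis by (intro none)
next
  case (Cons b r)
  define v where "v = takeWhile id (dropWhile Not \<eta>)"
  define \<zeta> where "\<zeta> = dropWhile id (dropWhile Not \<eta>)"
  have ne: "dropWhile Not \<eta> \<noteq> []" using Cons by simp
  then have "b" using hd_dropWhile[OF ne] Cons by simp
  then have "v \<noteq> []" using Cons by (simp add: v_def)
  moreover have "\<eta> = takeWhile Not \<eta> @ v @ \<zeta>" by (simp add: v_def \<zeta>_def)
  moreover have "True \<notin> set (takeWhile Not \<eta>)" "False \<notin> set v"
    by (auto simp: v_def dest: set_takeWhileD)
  moreover have "length \<zeta> < length \<eta>" unfolding \<zeta>_def by (rule length_dropWhile_id_less[OF ne])
  moreover have "cluster_lengths \<eta> = length v # cluster_lengths \<zeta>"
    unfolding v_def \<zeta>_def by (subst cluster_lengths.simps) (use ne in \<open>simp add: Let_def del: dropWhile_eq_Nil_conv\<close>)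
  moreover have "gap_lengths \<eta> = length (takeWhile Not \<eta>) # gap_lengths \<zeta>"
    unfolding v_def \<zeta>_def by (subst gap_lengths.simps) (use ne in \<open>simp add: Let_def del: dropWhile_eq_Nil_conv\<close>)
  ultimately show ?thesis using some by blast
qed

lemma trues_falses_const:
  "True \<notin> set u \<Longrightarrow> trues u = 0" "True \<notin> set u \<Longrightarrow> falses u = length u"
  "False \<notin> set v \<Longrightarrow> trues v = length v" "False \<notin> set v \<Longrightarrow> falses v = 0"
  by (induction u; auto)+ (induction v; auto)+

lemma Psi_Phi_total: "Psi \<eta> 1 = trues \<eta> \<and> Phi \<eta> 0 = falses \<eta>"
proof (induction "length \<eta>" arbitrary: \<eta> rule: less_induct)
  case less
  show ?case
  proof (cases rule: cluster_decomposition[of \<eta>])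
    case none
    then show ?thesis using Psi_eq[of \<eta> 0] by (simp add: Phi_eq)
  next
    case (some u v \<zeta>)
    then show ?thesis using less[of \<zeta>] Psi_eq[of \<eta> 0] Psi_eq[of \<zeta> 0]
      by (simp add: Phi_eq trues_falses_const)
  qed
qed

lemma cluster_pos: "s \<in> set (cluster_lengths \<eta>) \<Longrightarrow> 0 < s"
proof (induction "length \<eta>" arbitrary: \<eta> rule: less_induct)
  case less
  show ?case
  proof (cases rule: cluster_decomposition[of \<eta>])
    case none
    then show ?thesis using less.prems by simp
  next
    case (some u v \<zeta>)
    then show ?thesis using less.prems less.hyps[of \<zeta>] by auto
  qed
qed

lemma Psi_strict: "1 \<le> i \<Longrightarrow> i \<le> num_clusters \<eta> \<Longrightarrow> Psi \<eta> (Suc i) < Psi \<eta> i"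
proof -
  assume i: "1 \<le> i" "i \<le> num_clusters \<eta>"
  then obtain k where k: "i = Suc k" "k < length (cluster_lengths \<eta>)" by (cases i) (auto simp: num_clusters_def)
  then show ?thesis
    using cluster_pos[of "cluster_lengths \<eta> ! k" \<eta>] unfolding k(1) Psi_eq
    by (simp add: Cons_nth_drop_Suc[symmetric])
qed

lemma split_at_False:
  assumes "\<eta> = u @ v @ \<zeta>" "True \<notin> set u" "False \<notin> set v" "\<eta> = x @ False # w"
  obtains (gap) y where "w = y @ v @ \<zeta>" "True \<notin> set y" | (rest) y where "\<zeta> = y @ False # w"
proof -
  have "(u @ v) @ \<zeta> = x @ False # w" using assms by simp
  then consider us where "u @ v = x @ us" "us @ \<zeta> = False # w" | us where "\<zeta> = us @ False # w"
    unfolding append_eq_append_conv2 by blast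
  then show ?thesis
  proof cases
    case 1
    show ?thesis
    proof (cases us)
      case Nil
      then show ?thesis using 1 rest[of "[]"] by simp
    next
      case (Cons b us')
      then have us: "us = False # us'" "w = us' @ \<zeta>" using 1 by auto
      then have "u @ v = x @ False # us'" using 1 by simp
      then consider vs where "u = x @ vs" "vs @ v = False # us'" | vs where "v = vs @ False # us'"
        unfolding append_eq_append_conv2 by blast
      then show ?thesis
      proof cases
        case 1
        then show ?thesis using assms(2,3) us gap by (cases vs) auto
      next
        case 2
        then show ?thesis using assms(3) by auto
      qed
    qed
  next
    case 2
    then show ?thesis by (rule rest)
  qed
qed

text \<open>Row y of the tree belongs to the y-th zero of \<eta> from the right, here the zero just
  before w. If it lies in the gap before cluster i, then the ones behind it are those of the
  clusters i, i + 1, and so on.\<close>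

lemma False_interval:
  assumes "\<eta> = u @ False # w"
  shows "\<exists>i. 1 \<le> i \<and> i \<le> num_clusters \<eta> + 1 \<and> Psi \<eta> i = trues w \<and> Phi \<eta> i < Suc (falses w) \<and> Suc (falses w) \<le> Phi \<eta> (i - 1)"
  using assms
proof (induction "length \<eta>" arbitrary: \<eta> u rule: less_induct)
  case less
  have total: "Suc (falses w) \<le> Phi \<eta> 0" using Psi_Phi_total[of \<eta>] less.prems by simp
  show ?case
  proof (cases rule: cluster_decomposition[of \<eta>])
    case none
    then show ?thesis using total less.prems Psi_eq[of \<eta> 0]
      by (intro exI[of _ 1]) (simp add: Phi_eq num_clusters_def)
  next
    case (some u' v \<zeta>)
    have PhiS: "Phi \<eta> (Suc j) = Phi \<zeta> j" for j using some by (simp add: Phi_eq)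
    have PsiS: "Psi \<eta> (Suc (Suc j)) = Psi \<zeta> (Suc j)" for j using some by (simp add: Psi_eq)
    show ?thesis
    proof (cases rule: split_at_False[OF some(1,2,3) less.prems])
      case (1 y)
      have "Psi \<eta> 1 = trues w" using Psi_Phi_total[of \<eta>] some(1) 1 trues_falses_const(1)[OF some(2)] trues_falses_const(1)[OF 1(2)] by simp
      moreover have "Phi \<eta> 1 < Suc (falses w)" using PhiS[of 0] Psi_Phi_total[of \<zeta>] 1 by simp
      ultimately show ?thesis using total by (intro exI[of _ 1]) simp
    next
      case (2 y)
      from less.hyps[OF some(5) this] obtain i where i: "1 \<le> i" "i \<le> num_clusters \<zeta> + 1" "Psi \<zeta> i = trues w"
        "Phi \<zeta> i < Suc (falses w)" "Suc (falses w) \<le> Phi \<zeta> (i - 1)" by blast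
      obtain k where k: "i = Suc k" using i(1) by (cases i) auto
      have "num_clusters \<eta> = Suc (num_clusters \<zeta>)" using some by (simp add: num_clusters_def)
      then show ?thesis using i PhiS[of i] PhiS[of k] PsiS[of k] by (intro exI[of _ "Suc i"]) (simp add: k)
    qed
  qed
qed

text \<open>The intervals between successive values of \<open>Phi\<close> are disjoint, so the row
  determines the index i and with it the only admissible x.\<close>

lemma one_child_iff:
  assumes "\<eta> = u @ False # w"
  shows "one_child \<eta> (x, Suc (falses w)) \<longleftrightarrow> x = trues w"
proof -
  obtain i where i: "1 \<le> i" "i \<le> num_clusters \<eta> + 1" "Psi \<eta> i = trues w"
    "Phi \<eta> i < Suc (falses w)" "Suc (falses w) \<le> Phi \<eta> (i - 1)"
    using False_interval[OF assms] by blast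
  have unique: "j = i" if "1 \<le> j" "Phi \<eta> j < Suc (falses w)" "Suc (falses w) \<le> Phi \<eta> (j - 1)" for j
  proof (rule ccontr)
    assume "j \<noteq> i"
    then have "j \<le> i - 1 \<or> i \<le> j - 1" by linarith
    then show False
      using that i Phi_antimono[of j "i - 1" \<eta>] Phi_antimono[of i "j - 1" \<eta>] by linarith
  qed
  show ?thesis
  proof
    assume "one_child \<eta> (x, Suc (falses w))"
    then obtain j where "1 \<le> j" "x = Psi \<eta> j" "Phi \<eta> j < Suc (falses w)" "Suc (falses w) \<le> Phi \<eta> (j - 1)"
      unfolding one_child_def prod.case by blast
    then show "x = trues w" using unique[of j] i(3) by simp
  next
    assume "x = trues w"
    then show "one_child \<eta> (x, Suc (falses w))"
      unfolding one_child_def prod.case using i by metis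
  qed
qed

text \<open>The two cases of the definition together say that \<open>Psi \<eta> (Suc j) < x\<close>
  and \<open>x \<le> Psi \<eta> j\<close> for some j. As j varies these intervals cover (0,
  \<open>Psi \<eta> 1\<close>], and the condition on the row restricts j to j < i, that is x >
  \<open>Psi \<eta> i\<close>.\<close>

lemma two_children_iff:
  assumes "\<eta> = u @ False # w"
  shows "two_children \<eta> (x, Suc (falses w)) \<longleftrightarrow> trues w < x \<and> x \<le> Psi \<eta> 1"
proof -
  obtain i where i: "1 \<le> i" "i \<le> num_clusters \<eta> + 1" "Psi \<eta> i = trues w"
    "Phi \<eta> i < Suc (falses w)" "Suc (falses w) \<le> Phi \<eta> (i - 1)"
    using False_interval[OF assms] by blast
  have le_iff: "Suc (falses w) \<le> Phi \<eta> j \<longleftrightarrow> j < i" for j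
  proof (cases "j < i")
    case True
    then have "j \<le> i - 1" by simp
    from Phi_antimono[OF this, of \<eta>] show ?thesis using True i by simp
  next
    case False
    then show ?thesis using i Phi_antimono[of i j \<eta>] by simp
  qed
  show ?thesis
  proof
    assume "two_children \<eta> (x, Suc (falses w))"
    then obtain j where j: "1 \<le> j" "j \<le> num_clusters \<eta>" "Suc (falses w) \<le> Phi \<eta> j"
      "x = Psi \<eta> j \<or> Psi \<eta> (j + 1) < x \<and> x < Psi \<eta> j"
      unfolding two_children_def prod.case by blast
    then have "j < i" using le_iff by simp
    have "Psi \<eta> (Suc j) < x" "x \<le> Psi \<eta> j" using Psi_strict[OF j(1,2)] j(4) by auto
    then show "trues w < x \<and> x \<le> Psi \<eta> 1"
      using j(1) i(3) \<open>j < i\<close> Psi_antimono[of "Suc j" i \<eta>] Psi_antimono[of 1 j \<eta>] by auto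
  next
    assume x: "trues w < x \<and> x \<le> Psi \<eta> 1"
    have "\<exists>j\<ge>1. x \<le> Psi \<eta> j \<and> Psi \<eta> (Suc j) < x"
    proof (rule ccontr)
      assume none: "\<not> ?thesis"
      have "x \<le> Psi \<eta> (Suc k)" for k
      proof (induction k)
        case 0
        show ?case using x by simp
      next
        case (Suc k)
        then have "\<not> Psi \<eta> (Suc (Suc k)) < x" using none by (metis Suc_le_mono One_nat_def le0)
        then show ?case by simp
      qed
      from this[of "num_clusters \<eta>"] show False using x by (simp add: Psi_def)
    qed
    then obtain j where j: "1 \<le> j" "x \<le> Psi \<eta> j" and j': "Psi \<eta> (Suc j) < x" by blast
    have bound: "j \<le> num_clusters \<eta>"
    proof (rule ccontr)
      assume "\<not> j \<le> num_clusters \<eta>"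
      then have "Psi \<eta> j = 0" by (simp add: Psi_def)
      then show False using j(2) x by simp
    qed
    have "j < i" using x j i(3) Psi_antimono[of i j \<eta>] by (cases "j < i") auto
    then have "Suc (falses w) \<le> Phi \<eta> j" using le_iff by simp
    then show "two_children \<eta> (x, Suc (falses w))"
      unfolding two_children_def prod.case using j j' bound
      by (intro exI[of _ j]) (simp, linarith)
  qed
qed

section \<open>Sums over paths\<close>

definition paths_from :: "bool list \<Rightarrow> node \<Rightarrow> nat \<Rightarrow> node list set" where
  "paths_from \<eta> u k = {us. us \<noteq> [] \<and> hd us = u \<and> last us = (k, 0) \<and> successively (dehp_edge \<eta>) us}"

definition path_sum :: "real \<Rightarrow> bool list \<Rightarrow> node \<Rightarrow> nat \<Rightarrow> real" where
  "path_sum \<alpha> \<eta> u k = (\<Sum>us\<in>paths_from \<eta> u k. path_weight \<alpha> \<eta> us)"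

lemma paths_from_step:
  assumes "u \<noteq> (k, 0)"
  shows "paths_from \<eta> u k = (\<Union>v\<in>{v. dehp_edge \<eta> u v}. Cons u ` paths_from \<eta> v k)"
proof (intro equalityI subsetI)
  fix us assume us: "us \<in> paths_from \<eta> u k"
  then obtain vs where vs: "us = u # vs" unfolding paths_from_def by (cases us) auto
  with us assms have ne: "vs \<noteq> []" by (auto simp: paths_from_def)
  then have "dehp_edge \<eta> u (hd vs)" "vs \<in> paths_from \<eta> (hd vs) k"
    using us unfolding vs paths_from_def by (auto simp: successively_Cons)
  then show "us \<in> (\<Union>v\<in>{v. dehp_edge \<eta> u v}. Cons u ` paths_from \<eta> v k)" using vs by blast
qed (auto simp: paths_from_def successively_Cons)

lemma finite_paths_from: "finite (paths_from \<eta> u k)"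
proof (induction "fst u + snd u" arbitrary: u rule: less_induct)
  case less
  have dec: "fst v + snd v < fst u + snd u" if "dehp_edge \<eta> u v" for v using dehp_edge_decreases[OF that] by simp
  have "{v. dehp_edge \<eta> u v} \<subseteq> {..fst u} \<times> {..snd u}" using dehp_edge_decreases[of \<eta> u] by fastforce
  then have fin: "finite {v. dehp_edge \<eta> u v}" by (rule finite_subset) simp
  have "paths_from \<eta> u k \<subseteq> insert [u] (\<Union>v\<in>{v. dehp_edge \<eta> u v}. Cons u ` paths_from \<eta> v k)"
  proof
    fix us assume us: "us \<in> paths_from \<eta> u k"
    then obtain vs where vs: "us = u # vs" unfolding paths_from_def by (cases us) auto
    show "us \<in> insert [u] (\<Union>v\<in>{v. dehp_edge \<eta> u v}. Cons u ` paths_from \<eta> v k)"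
    proof (cases "vs = []")
      case False
      then have "dehp_edge \<eta> u (hd vs)" "vs \<in> paths_from \<eta> (hd vs) k"
        using us unfolding vs paths_from_def by (auto simp: successively_Cons)
      then show ?thesis using vs by blast
    qed (use vs in simp)
  qed
  then show ?case by (rule finite_subset) (use fin less dec in auto)
qed

lemma path_sum_step:
  assumes "u \<noteq> (k, 0)" and S: "{v. dehp_edge \<eta> u v} = S" "finite S"
  shows "path_sum \<alpha> \<eta> u k = edge_weight \<alpha> \<eta> u * (\<Sum>v\<in>S. path_sum \<alpha> \<eta> v k)"
proof -
  have "path_sum \<alpha> \<eta> u k = (\<Sum>v\<in>S. \<Sum>us\<in>Cons u ` paths_from \<eta> v k. path_weight \<alpha> \<eta> us)"
    unfolding path_sum_def paths_from_step[OF assms(1)] S(1)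
  proof (rule sum.UNION_disjoint[OF S(2)])
    show "\<forall>v\<in>S. finite (Cons u ` paths_from \<eta> v k)" by (simp add: finite_paths_from)
    show "\<forall>v\<in>S. \<forall>v'\<in>S. v \<noteq> v' \<longrightarrow> Cons u ` paths_from \<eta> v k \<inter> Cons u ` paths_from \<eta> v' k = {}"
      by (auto simp: paths_from_def)
  qed
  also have "\<dots> = (\<Sum>v\<in>S. edge_weight \<alpha> \<eta> u * path_sum \<alpha> \<eta> v k)"
  proof (rule sum.cong[OF refl])
    fix v
    have "(\<Sum>us\<in>Cons u ` paths_from \<eta> v k. path_weight \<alpha> \<eta> us) = (\<Sum>us\<in>paths_from \<eta> v k. path_weight \<alpha> \<eta> (u # us))"
      by (subst sum.reindex) auto
    also have "\<dots> = (\<Sum>us\<in>paths_from \<eta> v k. edge_weight \<alpha> \<eta> u * path_weight \<alpha> \<eta> us)"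
      by (rule sum.cong) (auto simp: paths_from_def path_weight_def)
    finally show "(\<Sum>us\<in>Cons u ` paths_from \<eta> v k. path_weight \<alpha> \<eta> us) = edge_weight \<alpha> \<eta> u * path_sum \<alpha> \<eta> v k"
      by (simp add: path_sum_def sum_distrib_left)
  qed
  finally show ?thesis by (simp add: sum_distrib_left)
qed

lemma dehp_edge_iff:
  "dehp_edge \<eta> (x, y) v \<longleftrightarrow> one_child \<eta> (x, y) \<and> v = (x, y - 1)
     \<or> two_children \<eta> (x, y) \<and> (v = (x, y - 1) \<or> v = (x - 1, y))"
  by (auto elim: dehp_edge.cases intro: dehp_edge.intros[unfolded One_nat_def])

lemma path_sum_leaf: "path_sum \<alpha> \<eta> (x, 0) k = of_bool (x = k)"
proof -
  have no: "\<not> dehp_edge \<eta> (x, 0) v" for v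
    by (auto simp: dehp_edge_iff one_child_def two_children_def)
  have "paths_from \<eta> (x, 0) k = (if x = k then {[(x, 0)]} else {})"
  proof -
    have single: "us = [(x, 0)]" if us: "us \<noteq> []" "hd us = (x, 0)" "successively (dehp_edge \<eta>) us" for us
    proof -
      obtain vs where vs: "us = (x, 0) # vs" using us(1,2) by (cases us) simp_all
      have "vs = []"
      proof (rule ccontr)
        assume "vs \<noteq> []"
        then have "dehp_edge \<eta> (x, 0) (hd vs)" using us(3) unfolding vs by (simp add: successively_Cons)
        then show False using no by blast
      qed
      then show ?thesis using vs by simp
    qed
    have "us \<in> paths_from \<eta> (x, 0) k \<longleftrightarrow> us = [(x, 0)] \<and> x = k" for us
    proof
      assume us: "us \<in> paths_from \<eta> (x, 0) k"
      then have "us = [(x, 0)]" unfolding paths_from_def by (intro single) simp_all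
      with us show "us = [(x, 0)] \<and> x = k" by (simp add: paths_from_def)
    qed (simp add: paths_from_def)
    then show ?thesis by (simp add: set_eq_iff)
  qed
  then show ?thesis by (simp add: path_sum_def path_weight_def)
qed

text \<open>
  The node \<open>(x, y)\<close> stands for the row \<open>D\<^sup>m w\<close>, where \<open>w\<close> is the suffix of \<open>\<eta>\<close> that starts at its
  \<open>y\<close>-th zero from the right and \<open>m\<close> is \<open>x\<close> minus the number of ones of \<open>w\<close>.
\<close>

lemma path_sum_word_act:
  assumes "\<eta> = u @ w" "trues w \<le> x" "x \<le> Psi \<eta> 1"
  shows "(\<Sum>k = 0..Psi \<eta> 1. path_sum \<alpha> \<eta> (x, falses w) k * t k) = word_act \<alpha> w t (x - trues w)"
  using assms
proof (induction w arbitrary: u x)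
  case Nil
  have "(\<Sum>k = 0..Psi \<eta> 1. of_bool (x = k) * t k) = (\<Sum>k\<in>{x}. of_bool (x = k) * t k)"
    by (rule sum.mono_neutral_right) (use Nil in auto)
  then show ?case by (simp add: path_sum_leaf)
next
  case (Cons b w)
  show ?case
  proof (cases b)
    case True
    have "Suc (x - Suc (trues w)) = x - trues w" using Cons.prems(2) True by simp
    then show ?thesis using Cons.IH[of "u @ [True]" x] Cons.prems True by (simp add: Dop_def)
  next
    case False
    have \<eta>: "\<eta> = u @ False # w" using Cons.prems False by simp
    have IH: "(\<Sum>k = 0..Psi \<eta> 1. path_sum \<alpha> \<eta> (x, falses w) k * t k) = word_act \<alpha> w t (x - trues w)"
      if "trues w \<le> x" "x \<le> Psi \<eta> 1" for x
      using Cons.IH[of "u @ [False]" x] \<eta> that by simp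
    \<comment> \<open>Along a row the induction on x follows the recursion of \<open>Eop\<close>:
      the node x = trues w has one child and realizes the boundary relation for
      \<open>\<langle>W| E\<close>, and every further node has two children and realizes the
      relation for D E.\<close>
    have "trues w \<le> x \<Longrightarrow> x \<le> Psi \<eta> 1 \<Longrightarrow>
        (\<Sum>k = 0..Psi \<eta> 1. path_sum \<alpha> \<eta> (x, Suc (falses w)) k * t k) = Eop \<alpha> (word_act \<alpha> w t) (x - trues w)"
    proof (induction x rule: dec_induct)
      case base
      have one: "one_child \<eta> (trues w, Suc (falses w))" "\<not> two_children \<eta> (trues w, Suc (falses w))"
        using one_child_iff[OF \<eta>] two_children_iff[OF \<eta>] by auto
      have "path_sum \<alpha> \<eta> (trues w, Suc (falses w)) k = 1 / (4 * \<alpha>) * path_sum \<alpha> \<eta> (trues w, falses w) k" for k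
      proof -
        have "{v. dehp_edge \<eta> (trues w, Suc (falses w)) v} = {(trues w, falses w)}"
          using one by (auto simp: dehp_edge_iff)
        from path_sum_step[OF _ this] show ?thesis using one by (simp add: edge_weight_def)
      qed
      then have "(\<Sum>k = 0..Psi \<eta> 1. path_sum \<alpha> \<eta> (trues w, Suc (falses w)) k * t k)
          = 1 / (4 * \<alpha>) * (\<Sum>k = 0..Psi \<eta> 1. path_sum \<alpha> \<eta> (trues w, falses w) k * t k)"
        by (simp only: sum_distrib_left mult.assoc)
      then show ?case using IH[of "trues w"] base by simp
    next
      case (step z)
      have two: "\<not> one_child \<eta> (Suc z, Suc (falses w))" "two_children \<eta> (Suc z, Suc (falses w))"
        using one_child_iff[OF \<eta>] two_children_iff[OF \<eta>] step by auto
      have "path_sum \<alpha> \<eta> (Suc z, Suc (falses w)) k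
          = 1 / 4 * (path_sum \<alpha> \<eta> (Suc z, falses w) k + path_sum \<alpha> \<eta> (z, Suc (falses w)) k)" for k
      proof -
        have "{v. dehp_edge \<eta> (Suc z, Suc (falses w)) v} = {(Suc z, falses w), (z, Suc (falses w))}"
          using two by (auto simp: dehp_edge_iff)
        from path_sum_step[OF _ this] show ?thesis using two by (simp add: edge_weight_def)
      qed
      note eq = this
      have "(\<Sum>k = 0..Psi \<eta> 1. path_sum \<alpha> \<eta> (Suc z, Suc (falses w)) k * t k)
         = (\<Sum>k = 0..Psi \<eta> 1. (path_sum \<alpha> \<eta> (Suc z, falses w) k * t k + path_sum \<alpha> \<eta> (z, Suc (falses w)) k * t k) / 4)"
        by (intro sum.cong refl) (simp only: eq, simp add: algebra_simps)
      also have "\<dots> = ((\<Sum>k = 0..Psi \<eta> 1. path_sum \<alpha> \<eta> (Suc z, falses w) k * t k)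
            + (\<Sum>k = 0..Psi \<eta> 1. path_sum \<alpha> \<eta> (z, Suc (falses w)) k * t k)) / 4"
        unfolding sum_divide_distrib[symmetric] sum.distrib ..
      also have "\<dots> = Eop \<alpha> (word_act \<alpha> w t) (Suc z - trues w)"
        using IH[of "Suc z"] step by (simp add: Suc_diff_le)
      finally show ?case .
    qed
    then show ?thesis using Cons.prems False by simp
  qed
qed

lemma Z_word_act: "(\<Sum>k = 0..Psi \<eta> 1. Z \<alpha> \<eta> k * t k) = word_act \<alpha> \<eta> t 0"
  using path_sum_word_act[of \<eta> "[]" \<eta> "trues \<eta>" \<alpha> t] Psi_Phi_total[of \<eta>]
  by (simp add: Z_def path_sum_def paths_from_def dehp_paths_def)


section \<open>Laws of the process\<close>

lemma space_config_space [simp]: "space config_space = UNIV"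
  by (simp add: config_space_def space_PiM)

lemma measurable_config_component [measurable]: "(\<lambda>\<eta>. \<eta> x) \<in> config_space \<rightarrow>\<^sub>M count_space UNIV"
  unfolding config_space_def by (rule measurable_component_singleton) simp

lemma pred_config_value [measurable]: "Measurable.pred config_space (\<lambda>\<eta>. \<eta> x = v)"
  by (rule measurable_compose[OF measurable_config_component]) simp

lemma pred_config_eq [measurable]: "Measurable.pred config_space (\<lambda>\<eta>. \<eta> = \<zeta>)"
proof -
  have "(\<lambda>\<eta>. \<eta> = \<zeta>) = (\<lambda>\<eta>. \<forall>x. \<eta> x = \<zeta> x)" by (auto simp: fun_eq_iff)
  then show ?thesis by simp
qed

lemma transition_indicator_summable:
  assumes "transition_function E p" "0 \<le> t" "i \<in> E"
  shows "(\<lambda>j. p t i j * of_bool (R j)) summable_on E"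
proof (rule summable_on_comparison_test)
  show "p t i summable_on E"
    using assms unfolding transition_function_def by (blast intro: has_sum_imp_summable)
  have "0 \<le> p t i j" if "j \<in> E" for j using assms that unfolding transition_function_def by blast
  then show "p t i j * of_bool (R j) \<le> p t i j" "0 \<le> p t i j * of_bool (R j)" if "j \<in> E" for j
    using that by simp_all
qed

text \<open>Finite sets of states bound the probabilities of Q and of its negation from below. The
  two bounds add up to 1, so both are equalities.\<close>

lemma markov_jump_process_law:
  assumes X: "markov_jump_process E q x0 config_space P X"
  obtains p where "transition_function E p" "has_jump_rates E p q"
    "\<And>t Q. 0 \<le> t \<Longrightarrow> Measurable.pred config_space Q \<Longrightarrow>
       measure P {\<omega> \<in> space P. Q (X t \<omega>)} = (\<Sum>\<^sub>\<infinity>j\<in>E. p t x0 j * of_bool (Q j))"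
proof -
  from X interpret prob_space P by (simp add: markov_jump_process_def)
  have x0: "x0 \<in> E" using X by (simp add: markov_jump_process_def)
  have meas: "X t \<in> P \<rightarrow>\<^sub>M config_space" if "0 \<le> t" for t using X that by (simp add: markov_jump_process_def)
  obtain p where p: "transition_function E p" "has_jump_rates E p q" and
    fd: "\<And>(n::nat) (t::nat \<Rightarrow> real) i. t 0 = 0 \<and> (\<forall>k<n. t k \<le> t (Suc k)) \<and> i 0 = x0 \<and> (\<forall>k\<le>n. i k \<in> E) \<Longrightarrow>
           measure P {\<omega> \<in> space P. \<forall>k\<le>n. X (t k) \<omega> = i k} = (\<Prod>k<n. p (t (Suc k) - t k) (i k) (i (Suc k)))"
    using X unfolding markov_jump_process_def by blast
  show ?thesis
  proof (rule that[OF p])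
    fix t :: real and Q assume t: "0 \<le> t" and Q: "Measurable.pred config_space Q"
    note Q[measurable] meas[OF t, measurable] meas[OF order_refl, measurable]
    \<comment> \<open>The condition at time 0 is kept because the finite-dimensional laws always
      prescribe the state there.\<close>
    define A where "A j = {\<omega> \<in> space P. X 0 \<omega> = x0 \<and> X t \<omega> = j}" for j
    have A_meas: "A j \<in> events" for j
    proof -
      have "Measurable.pred P (\<lambda>\<omega>. X 0 \<omega> = x0)" "Measurable.pred P (\<lambda>\<omega>. X t \<omega> = j)"
        by (rule measurable_compose[OF meas pred_config_eq]; use t in simp)+
      then show ?thesis unfolding A_def by measurable
    qed
    have A_prob: "prob (A j) = p t x0 j" if "j \<in> E" for j
    proof -
      let ?t = "\<lambda>k::nat. if k = 0 then 0 else t" and ?i = "\<lambda>k::nat. if k = 0 then x0 else j"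
      have "A j = {\<omega> \<in> space P. \<forall>k\<le>1. X (?t k) \<omega> = ?i k}"
        by (auto simp: A_def le_Suc_eq)
      then show ?thesis using fd[of ?t 1 ?i] t x0 that by simp
    qed
    have p_sum: "(p t x0 has_sum 1) E" using p(1) t x0 by (auto simp: transition_function_def)
    note sums = transition_indicator_summable[OF p(1) t x0]
    have lower: "(\<Sum>\<^sub>\<infinity>j\<in>E. p t x0 j * of_bool (R j)) \<le> prob {\<omega> \<in> space P. R (X t \<omega>)}"
      if R[measurable]: "Measurable.pred config_space R" for R
    proof (rule infsum_le_finite_sums[OF sums])
      fix F assume F: "finite F" "F \<subseteq> E"
      have "(\<Sum>j\<in>F. p t x0 j * of_bool (R j)) = (\<Sum>j\<in>{j \<in> F. R j}. p t x0 j)"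
        using F by (intro sum.mono_neutral_cong_right) auto
      also have "\<dots> = (\<Sum>j\<in>{j \<in> F. R j}. prob (A j))" using F A_prob by (intro sum.cong) auto
      also have "\<dots> = prob (\<Union>j\<in>{j \<in> F. R j}. A j)"
        using F A_meas by (intro finite_measure_finite_Union[symmetric]) (auto simp: disjoint_family_on_def A_def)
      also have "\<dots> \<le> prob {\<omega> \<in> space P. R (X t \<omega>)}"
      proof (rule finite_measure_mono)
        show "{\<omega> \<in> space P. R (X t \<omega>)} \<in> events"
          using measurable_compose[OF meas[OF t] R] by (simp add: pred_def)
      qed (auto simp: A_def)
      finally show "(\<Sum>j\<in>F. p t x0 j * of_bool (R j)) \<le> prob {\<omega> \<in> space P. R (X t \<omega>)}" .
    qed
    have Qm: "{\<omega> \<in> space P. Q (X t \<omega>)} \<in> events"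
      using measurable_compose[OF meas[OF t] Q] by (simp add: pred_def)
    have "(\<Sum>\<^sub>\<infinity>j\<in>E. p t x0 j * of_bool (Q j)) + (\<Sum>\<^sub>\<infinity>j\<in>E. p t x0 j * of_bool (\<not> Q j)) = (\<Sum>\<^sub>\<infinity>j\<in>E. p t x0 j)"
      by (subst infsum_add[symmetric, OF sums sums]) (auto intro!: infsum_cong)
    also have "\<dots> = 1" using p_sum by (rule infsumI)
    finally have total: "(\<Sum>\<^sub>\<infinity>j\<in>E. p t x0 j * of_bool (Q j)) + (\<Sum>\<^sub>\<infinity>j\<in>E. p t x0 j * of_bool (\<not> Q j)) = 1" .
    have "{\<omega> \<in> space P. \<not> Q (X t \<omega>)} = space P - {\<omega> \<in> space P. Q (X t \<omega>)}" by auto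
    then have compl: "prob {\<omega> \<in> space P. \<not> Q (X t \<omega>)} = 1 - prob {\<omega> \<in> space P. Q (X t \<omega>)}"
      using prob_compl[OF Qm] by simp
    have "Measurable.pred config_space (\<lambda>\<eta>. \<not> Q \<eta>)" by measurable
    from lower[OF this] lower[OF Q] total compl
    show "prob {\<omega> \<in> space P. Q (X t \<omega>)} = (\<Sum>\<^sub>\<infinity>j\<in>E. p t x0 j * of_bool (Q j))" by linarith
  qed
qed

lemma second_class_position_pos_iff: "second_class_position \<eta> > 0 \<longleftrightarrow> (\<exists>x\<ge>1. \<eta> x = 2)"
proof (cases "\<exists>x\<ge>1. \<eta> x = 2")
  case True
  then have "1 \<le> (LEAST x. 1 \<le> x \<and> \<eta> x = 2)" by (metis (mono_tags, lifting) LeastI_ex)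
  with True show ?thesis by (simp add: second_class_position_def)
next
  case False
  then have "second_class_position \<eta> = - 1" unfolding second_class_position_def by (rule if_not_P)
  with False show ?thesis by simp
qed

lemma pred_second_class_position: "Measurable.pred config_space (\<lambda>\<eta>. second_class_position \<eta> > 0)"
  unfolding second_class_position_pos_iff by measurable

text \<open>The second disjunct covers infinite sets, whose cardinality is \<open>0\<close> by convention.\<close>

lemma pred_num_color: "Measurable.pred config_space (\<lambda>\<eta>. num_color_ge c 1 \<eta> = s)"
proof -
  have "num_color_ge c 1 \<eta> = s \<longleftrightarrow>
      (\<exists>ys. (\<forall>y. (1 \<le> y \<and> \<eta> y = c) \<longleftrightarrow> y \<in> set ys) \<and> card (set ys) = s) \<or>
      (s = 0 \<and> (\<forall>ys. \<not> (\<forall>y. (1 \<le> y \<and> \<eta> y = c) \<longleftrightarrow> y \<in> set ys)))" for \<eta> :: config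
  proof -
    define S where "S = {y. 1 \<le> y \<and> \<eta> y = c}"
    have num: "num_color_ge c 1 \<eta> = card S" by (simp add: num_color_ge_def S_def)
    have iff: "(\<forall>y. (1 \<le> y \<and> \<eta> y = c) \<longleftrightarrow> y \<in> set ys) \<longleftrightarrow> S = set ys" for ys
      by (auto simp: S_def)
    show ?thesis unfolding iff num
    proof (cases "finite S")
      case True
      then obtain ys where ys: "S = set ys" using finite_list by metis
      then show "card S = s \<longleftrightarrow> (\<exists>ys. S = set ys \<and> card (set ys) = s) \<or> s = 0 \<and> (\<forall>ys. S \<noteq> set ys)" by auto
    next
      case False
      then have "S \<noteq> set ys" for ys by auto
      then show "card S = s \<longleftrightarrow> (\<exists>ys. S = set ys \<and> card (set ys) = s) \<or> s = 0 \<and> (\<forall>ys. S \<noteq> set ys)"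
        using False by auto
    qed
  qed
  then show ?thesis by simp
qed

text \<open>The ranks of the particles of color c are exactly the numbers below their count, so a
  particle of rank s exists just when there are more than s of them.\<close>

lemma layer_neq_iff:
  assumes "\<eta> \<in> finite_configs" "c \<noteq> \<infinity>"
  shows "layer c s \<eta> \<noteq> layer c (Suc s) \<eta> \<longleftrightarrow> s < card {z. \<eta> z = c}"
proof -
  define S where "S = {z. \<eta> z = c}"
  have fin: "finite S" using finite_color[OF assms, of "\<lambda>_. True"] by (simp add: S_def)
  have less: "rank_right c \<eta> y' < rank_right c \<eta> y" if "y < y'" "y' \<in> S" for y y'
    unfolding rank_right_def by (rule psubset_card_mono[OF finite_color[OF assms]]) (use that in \<open>auto simp: S_def\<close>)
  have inj: "inj_on (rank_right c \<eta>) S"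
    by (rule inj_onI) (metis less less_irrefl linorder_neqE_nat)
  have bound: "rank_right c \<eta> y < card S" if "y \<in> S" for y
    unfolding rank_right_def S_def by (rule psubset_card_mono[OF fin[unfolded S_def]]) (use that in \<open>auto simp: S_def\<close>)
  have "rank_right c \<eta> ` S = {..<card S}"
    by (rule card_subset_eq) (use bound in \<open>auto simp: card_image[OF inj]\<close>)
  moreover have "(\<exists>y. \<eta> y = c \<and> rank_right c \<eta> y = s) \<longleftrightarrow> s \<in> rank_right c \<eta> ` S"
    unfolding S_def by blast
  ultimately have "(\<exists>y. \<eta> y = c \<and> rank_right c \<eta> y = s) \<longleftrightarrow> s < card S" by simp
  moreover have "layer c s \<eta> \<noteq> layer c (Suc s) \<eta> \<longleftrightarrow> (\<exists>y. \<eta> y = c \<and> rank_right c \<eta> y = s)"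
    by (auto simp: layer_def set_eq_iff less_Suc_eq)
  ultimately show ?thesis by (simp add: S_def)
qed

lemma second_class_alive_iff:
  assumes "\<eta> \<in> finite_configs"
  shows "second_class_position \<eta> > 0 \<longleftrightarrow> layer 2 0 \<eta> \<noteq> layer 2 1 \<eta>"
proof -
  have "finite {z. \<eta> z = 2}" using finite_color[OF assms, of 2 "\<lambda>_. True"] by simp
  then have "0 < card {z. \<eta> z = 2} \<longleftrightarrow> (\<exists>x. \<eta> x = 2)" by (auto simp: card_gt_0_iff)
  moreover have "\<eta> x = 2 \<Longrightarrow> 1 \<le> x" for x using finite_configsD(2)[OF assms] by (cases x) auto
  ultimately show ?thesis
    using layer_neq_iff[OF assms, of 2 0] unfolding second_class_position_pos_iff by auto
qed

lemma num_color_eq_card: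
  assumes "\<eta> \<in> finite_configs" "c \<noteq> \<infinity>"
  shows "num_color_ge c 1 \<eta> = card {z. \<eta> z = c}"
proof -
  have "1 \<le> x" if "\<eta> x = c" for x using finite_configsD(2)[OF assms(1)] assms(2) that by (cases x) auto
  then have "{y. 1 \<le> y \<and> 1 \<le> y \<and> \<eta> y = c} = {z. \<eta> z = c}" by auto
  then show ?thesis by (simp add: num_color_ge_def)
qed

lemma second_class_limit:
  assumes "half_line_open_tasep a \<eta>0 P \<xi>" "1/2 < a" "a \<le> 1"
  shows "((\<lambda>t. measure P {\<omega> \<in> space P. second_class_position (\<xi> t \<omega>) > 0}) \<longlongrightarrow>
    survival a (layer 2 0 \<eta>0) (layer 2 1 \<eta>0)) at_top"
proof -
  note X = assms(1)[unfolded half_line_open_tasep_def]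
  have \<eta>0: "\<eta>0 \<in> finite_configs" using X by (simp add: markov_jump_process_def)
  obtain p where p: "transition_function finite_configs p" "has_jump_rates finite_configs p (tasep_rate a)" and
    law: "\<And>t Q. 0 \<le> t \<Longrightarrow> Measurable.pred config_space Q \<Longrightarrow>
       measure P {\<omega> \<in> space P. Q (\<xi> t \<omega>)} = (\<Sum>\<^sub>\<infinity>j\<in>finite_configs. p t \<eta>0 j * of_bool (Q j))"
    using markov_jump_process_law[OF X] by blast
  have "(1::enat) < 2" by (simp add: one_enat_def numeral_eq_enat)
  from survival_limit[OF p assms(2,3) \<eta>0 this, of 0]
  have lim: "((\<lambda>t. \<Sum>\<^sub>\<infinity>\<eta>\<in>finite_configs. p t \<eta>0 \<eta> * of_bool (layer 2 0 \<eta> \<noteq> layer 2 1 \<eta>)) \<longlongrightarrow>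
    survival a (layer 2 0 \<eta>0) (layer 2 1 \<eta>0)) at_top" by simp
  have "measure P {\<omega> \<in> space P. second_class_position (\<xi> t \<omega>) > 0}
      = (\<Sum>\<^sub>\<infinity>\<eta>\<in>finite_configs. p t \<eta>0 \<eta> * of_bool (layer 2 0 \<eta> \<noteq> layer 2 1 \<eta>))" if "0 \<le> t" for t
    unfolding law[OF that pred_second_class_position]
    by (rule infsum_cong) (simp only: second_class_alive_iff)
  then show ?thesis
    by (intro Lim_transform_eventually[OF lim] eventually_mono[OF eventually_ge_at_top[of 0]]) simp
qed

text \<open>There are exactly s particles when there are at least s but not at least s + 1, and each
  of these events for a positive number says that two consecutive layers differ.\<close>

lemma num_color_limit:
  assumes "half_line_open_tasep a \<eta>0 P \<xi>" "1/2 < a" "a \<le> 1" and c: "1 < c" "c \<noteq> \<infinity>"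
  shows "((\<lambda>t. measure P {\<omega> \<in> space P. num_color_ge c 1 (\<xi> t \<omega>) = s}) \<longlongrightarrow>
    (if s = 0 then 1 else survival a (layer c (s - 1) \<eta>0) (layer c s \<eta>0)) - survival a (layer c s \<eta>0) (layer c (Suc s) \<eta>0)) at_top"
proof -
  note X = assms(1)[unfolded half_line_open_tasep_def]
  have \<eta>0: "\<eta>0 \<in> finite_configs" using X by (simp add: markov_jump_process_def)
  obtain p where p: "transition_function finite_configs p" "has_jump_rates finite_configs p (tasep_rate a)" and
    law: "\<And>t Q. 0 \<le> t \<Longrightarrow> Measurable.pred config_space Q \<Longrightarrow>
       measure P {\<omega> \<in> space P. Q (\<xi> t \<omega>)} = (\<Sum>\<^sub>\<infinity>j\<in>finite_configs. p t \<eta>0 j * of_bool (Q j))"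
    using markov_jump_process_law[OF X] by blast
  define U where "U s t = (\<Sum>\<^sub>\<infinity>\<eta>\<in>finite_configs. p t \<eta>0 \<eta> * of_bool (layer c s \<eta> \<noteq> layer c (Suc s) \<eta>))" for s t
  \<comment> \<open>For s = 0 the event of at least s particles is certain; the truncated
    \<open>s - 1\<close> would name a different one.\<close>
  define W where "W t = (if s = 0 then 1 else U (s - 1) t)" for t
  have lim: "(U s \<longlongrightarrow> survival a (layer c s \<eta>0) (layer c (Suc s) \<eta>0)) at_top" for s
    unfolding U_def using survival_limit[OF p assms(2,3) \<eta>0 c] .
  have limW: "(W \<longlongrightarrow> (if s = 0 then 1 else survival a (layer c (s - 1) \<eta>0) (layer c s \<eta>0))) at_top"
    unfolding W_def using lim[of "s - 1"] by (cases "s = 0") simp_all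
  have "measure P {\<omega> \<in> space P. num_color_ge c 1 (\<xi> t \<omega>) = s} = W t - U s t" if t: "0 \<le> t" for t
  proof -
    have p_sum: "(p t \<eta>0 has_sum 1) finite_configs" using p(1) t \<eta>0 by (auto simp: transition_function_def)
    note sums = transition_indicator_summable[OF p(1) t \<eta>0]
    have "(\<Sum>\<^sub>\<infinity>\<eta>\<in>finite_configs. p t \<eta>0 \<eta> * of_bool (num_color_ge c 1 \<eta> = s)) + U s t
      = (\<Sum>\<^sub>\<infinity>\<eta>\<in>finite_configs. p t \<eta>0 \<eta> * of_bool (num_color_ge c 1 \<eta> = s)
           + p t \<eta>0 \<eta> * of_bool (layer c s \<eta> \<noteq> layer c (Suc s) \<eta>))"
      unfolding U_def by (rule infsum_add[symmetric, OF sums sums])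
    also have "\<dots> = (\<Sum>\<^sub>\<infinity>\<eta>\<in>finite_configs. p t \<eta>0 \<eta> * of_bool (s \<le> card {z. \<eta> z = c}))"
    proof (rule infsum_cong)
      fix \<eta> assume \<eta>: "\<eta> \<in> finite_configs"
      show "p t \<eta>0 \<eta> * of_bool (num_color_ge c 1 \<eta> = s) + p t \<eta>0 \<eta> * of_bool (layer c s \<eta> \<noteq> layer c (Suc s) \<eta>)
          = p t \<eta>0 \<eta> * of_bool (s \<le> card {z. \<eta> z = c})"
        unfolding layer_neq_iff[OF \<eta> c(2)] num_color_eq_card[OF \<eta> c(2)] by auto
    qed
    also have "\<dots> = W t"
    proof (cases s)
      case 0
      then show ?thesis using infsumI[OF p_sum] by (simp add: W_def)
    next
      case (Suc r)
      then have "W t = U r t" by (simp add: W_def)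
      then show ?thesis unfolding U_def Suc
        by (simp only:) (rule infsum_cong, simp only: layer_neq_iff[OF _ c(2)] Suc_le_eq)
    qed
    finally show ?thesis unfolding law[OF t pred_num_color] by simp
  qed
  note eq = this
  show ?thesis
    by (rule Lim_transform_eventually[OF tendsto_diff[OF limW lim[of s]]])
      (rule eventually_mono[OF eventually_ge_at_top[of 0]], rule eq[symmetric])
qed


section \<open>Two blocks of particles\<close>

lemma ones_from_eq_sum:
  assumes "k \<le> length w"
  shows "ones_from w k = (\<Sum>j = k..<length w. of_bool (w ! j))"
  using assms
proof (induction k rule: inc_induct)
  case base
  then show ?case by (simp add: ones_from_def)
next
  case (step k)
  show ?case
    unfolding ones_from_Suc[OF step.hyps(2)] sum.atLeast_Suc_lessThan[OF step.hyps(2)] step.IH by (rule add.commute)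
qed

definition load :: "nat set \<Rightarrow> bool list \<Rightarrow> nat \<Rightarrow> nat" where
  "load A w k = tail_count A k + k + ones_from w k"

text \<open>Passing an empty site adds 1 through k and removes at most one letter. At an occupied
  site the 1 is offset by \<open>tail_count\<close>, which reverses the inequality in
  \<open>load_full_interval\<close>.\<close>

lemma load_empty_interval:
  assumes "finite A" "j \<le> k" "k \<le> length w" "\<And>y. j < y \<Longrightarrow> y \<le> k \<Longrightarrow> y \<notin> A"
  shows "load A w j \<le> load A w k"
  using assms(2-)
proof (induction k rule: dec_induct)
  case (step k)
  then have "Suc k \<notin> A" by simp
  then have "load A w k \<le> load A w (Suc k)"
    using step ones_from_Suc[of k w] tail_count_Suc[OF assms(1), of k] by (simp add: load_def)
  with step show ?case by simp
qed simp

lemma load_full_interval: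
  assumes "finite A" "j \<le> k" "k \<le> length w" "\<And>y. j < y \<Longrightarrow> y \<le> k \<Longrightarrow> y \<in> A"
  shows "load A w k \<le> load A w j"
  using assms(2-)
proof (induction k rule: dec_induct)
  case (step k)
  then have "Suc k \<in> A" by simp
  then have "load A w (Suc k) \<le> load A w k"
    using step ones_from_Suc[of k w] tail_count_Suc[OF assms(1), of k] by (simp add: load_def)
  with step show ?case by simp
qed simp

abbreviation ones_left :: "nat \<Rightarrow> bool list \<Rightarrow> nat" where
  "ones_left k w \<equiv> ones_from w 0 - ones_from w k"

text \<open>The load rises over gaps and falls over blocks, so its minimum is taken at 0, at the end
  N + M of the first block, or at L.\<close>

lemma flux_two_blocks:
  assumes L: "length w = L" and r: "N + M \<le> r" "r \<le> L"
  shows "flux ({N+1..N+M} \<union> {r+1..L}) w =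
    min ((L - r) + ones_from w (N + M) + min (M + (ones_left (N + M) w)) (N + M)) L"
proof -
  define A where "A = {N+1..N+M} \<union> {r+1..L}"
  have A: "finite A" by (simp add: A_def)
  have tail: "tail_count A 0 = M + (L - r)" "tail_count A (N + M) = L - r" "tail_count A L = 0"
  proof -
    have "{y \<in> A. 0 < y} = {N+1..N+M} \<union> {r+1..L}" "{N+1..N+M} \<inter> {r+1..L} = {}"
      using r by (auto simp: A_def)
    then show "tail_count A 0 = M + (L - r)" by (simp add: tail_count_def card_Un_disjoint)
    have "{y \<in> A. N + M < y} = {r+1..L}" using r by (auto simp: A_def)
    then show "tail_count A (N + M) = L - r" by (simp add: tail_count_def)
    have "{y \<in> A. L < y} = {}" using r by (auto simp: A_def)
    then show "tail_count A L = 0" unfolding tail_count_def by (simp only: card.empty)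
  qed
  have mono: "ones_from w (N + M) \<le> ones_from w 0"
  proof -
    have "ones_from w k = (\<Sum>j = k..<L. of_bool (w ! j))" if "k \<le> L" for k
      using ones_from_eq_sum[of k w] that unfolding L .
    from this[of 0] this[of "N + M"] show ?thesis
      using r by (simp only: le0 le_trans[OF r]) (rule sum_mono2, auto)
  qed
  have vals: "load A w 0 = M + (L - r) + ones_from w 0"
    "load A w (N + M) = (L - r) + (N + M) + ones_from w (N + M)" "load A w L = L"
    using L by (simp_all add: load_def tail ones_from_def)
  have flux: "flux A w = Min (load A w ` {..L})" unfolding flux_def load_def L ..
  have "flux A w \<le> load A w k" if "k \<le> L" for k
    unfolding flux using that by (intro Min_le) auto
  then have upper: "flux A w \<le> load A w 0" "flux A w \<le> load A w (N + M)" "flux A w \<le> load A w L"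
    using r by auto
  have "load A w 0 \<le> load A w k \<or> load A w (N + M) \<le> load A w k \<or> load A w L \<le> load A w k" if k: "k \<le> L" for k
  proof -
    consider "k \<le> N" | "N \<le> k" "k \<le> N + M" | "N + M \<le> k" "k \<le> r" | "r \<le> k" by linarith
    then show ?thesis
    proof cases
      case 1
      then have "load A w 0 \<le> load A w k"
        using k L r by (intro load_empty_interval A) (auto simp: A_def)
      then show ?thesis by simp
    next
      case 2
      then have "load A w (N + M) \<le> load A w k"
        using k L r by (intro load_full_interval A) (auto simp: A_def)
      then show ?thesis by simp
    next
      case 3
      then have "load A w (N + M) \<le> load A w k"
        using k L r by (intro load_empty_interval A) (auto simp: A_def)
      then show ?thesis by simp
    next
      case 4
      then have "load A w L \<le> load A w k"
        using k L r by (intro load_full_interval A) (auto simp: A_def)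
      then show ?thesis by simp
    qed
  qed
  note some = this
  have "flux A w \<in> load A w ` {..L}" unfolding flux by (rule Min_in) auto
  then obtain k where "flux A w = load A w k" "k \<in> {..L}" by (rule imageE)
  with some[of k] have "load A w 0 \<le> flux A w \<or> load A w (N + M) \<le> flux A w \<or> load A w L \<le> flux A w" by simp
  then show ?thesis using upper mono unfolding A_def[symmetric] vals by (auto simp: min_def)
qed

text \<open>The minimum of the loads at 0 and N + M without their common summand L - r, the number
  of particles in the second block.\<close>

definition block_excess :: "nat \<Rightarrow> nat \<Rightarrow> bool list \<Rightarrow> nat" where
  "block_excess M N w = ones_from w (N + M) + min (M + (ones_left (N + M) w)) (N + M)"

text \<open>Adding site r raises the loads at 0 and N + M by 1 and leaves the load L at the end, so
  the flux gap is 1 exactly when the smaller of the first two is below L.\<close>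

lemma survival_two_blocks:
  assumes a: "0 < a" and r: "N + M < r" "r \<le> L"
  shows "survival a ({N+1..N+M} \<union> {r+1..L}) ({N+1..N+M} \<union> {r..L}) =
    (\<Sum>w | length w = L. word_act a w (half_line_column a) 0 * of_bool (L - r + block_excess M N w < L))"
proof -
  let ?A = "{N+1..N+M} \<union> {r+1..L}" and ?B = "{N+1..N+M} \<union> {r..L}"
  have B: "?B = {N+1..N+M} \<union> {(r - 1)+1..L}" using r by auto
  have "survival a ?A ?B = gap_mean a L (half_line_column a) ?A ?B"
    using r a by (intro gap_mean_stable[symmetric]) auto
  also have "\<dots> = (\<Sum>w | length w = L. flux_gap ?A ?B w * word_act a w (half_line_column a) 0)"
    unfolding gap_mean_def by (rule mean_eq_sum)
  also have "\<dots> = (\<Sum>w | length w = L. word_act a w (half_line_column a) 0 * of_bool (L - r + block_excess M N w < L))"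
  proof (rule sum.cong[OF refl])
    fix w :: "bool list" assume "w \<in> {w. length w = L}"
    then have w: "length w = L" by simp
    have "flux ?A w = min (L - r + block_excess M N w) L"
      using flux_two_blocks[OF w, of N M r] r by (simp add: block_excess_def add.assoc)
    moreover have "flux ?B w = min (Suc (L - r + block_excess M N w)) L"
      unfolding B using flux_two_blocks[OF w, of N M "r - 1"] r by (simp add: block_excess_def add.assoc Suc_diff_le)
    ultimately have "flux_gap ?A ?B w = of_bool (L - r + block_excess M N w < L)"
      by (auto simp: flux_gap_def)
    then show "flux_gap ?A ?B w * word_act a w (half_line_column a) 0
      = word_act a w (half_line_column a) 0 * of_bool (L - r + block_excess M N w < L)" by simp
  qed
  finally show ?thesis .
qed

lemma sum_word_act:
  assumes "a \<noteq> 0"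
  shows "(\<Sum>w | length w = L. word_act a w (half_line_column a) 0) = 1"
  using mean_eq_sum[of a L "half_line_column a" "\<lambda>_. 1" 0]
    mean_one[where t = "half_line_column a", OF half_line_column_invariant[OF assms], of L] by simp

lemma enat_color_less: "(1::enat) < 2" "(1::enat) < 3" "(2::enat) < 3"
  by (simp_all add: one_enat_def numeral_eq_enat)

lemma layer_xi_init:
  "layer 2 0 (xi_init M N) = {N+1..N+M} \<union> {(N+2*M+1)+1..2*M+2*N+1}"
  "layer 2 1 (xi_init M N) = {N+1..N+M} \<union> {N+2*M+1..2*M+2*N+1}"
proof -
  have lt: "xi_init M N y < 2 \<longleftrightarrow> y \<in> {N+1..N+M} \<union> {(N+2*M+1)+1..2*M+2*N+1}" for y
    by (auto simp: xi_init_def enat_color_less)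
  have eq: "xi_init M N y = 2 \<longleftrightarrow> y = N+2*M+1" for y
    using enat_color_less(1) by (auto simp: xi_init_def)
  have "rank_right 2 (xi_init M N) (N+2*M+1) = 0" by (simp add: rank_right_def eq)
  then have "y = N+2*M+1 \<and> rank_right 2 (xi_init M N) y < 1 \<longleftrightarrow> y = N+2*M+1" for y by auto
  then have "y \<in> layer 2 1 (xi_init M N) \<longleftrightarrow> y \<in> {N+1..N+M} \<union> {(N+2*M+1)+1..2*M+2*N+1} \<or> y = N+2*M+1" for y
    unfolding layer_def mem_Collect_eq lt eq by (simp only:)
  moreover have "y \<in> {N+1..N+M} \<union> {(N+2*M+1)+1..2*M+2*N+1} \<or> y = N+2*M+1 \<longleftrightarrow> y \<in> {N+1..N+M} \<union> {N+2*M+1..2*M+2*N+1}" for y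
    by auto
  ultimately show "layer 2 1 (xi_init M N) = {N+1..N+M} \<union> {N+2*M+1..2*M+2*N+1}" by blast
  have "y \<in> layer 2 0 (xi_init M N) \<longleftrightarrow> y \<in> {N+1..N+M} \<union> {(N+2*M+1)+1..2*M+2*N+1}" for y
    unfolding layer_def mem_Collect_eq lt eq by simp
  then show "layer 2 0 (xi_init M N) = {N+1..N+M} \<union> {(N+2*M+1)+1..2*M+2*N+1}" by (rule set_eqI)
qed

lemma layer_xi_tilde_init:
  assumes "s \<le> N + 1"
  shows "layer 3 s (xi_tilde_init M N) = {N+1..N+M} \<union> {(2*M+2*N+1-s)+1..2*M+2*N+1}"
proof -
  have lt: "xi_tilde_init M N y < 3 \<longleftrightarrow> y \<in> {N+1..N+M}" for y
    by (auto simp: xi_tilde_init_def enat_color_less)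
  have eq: "xi_tilde_init M N y = 3 \<longleftrightarrow> y \<in> {N+2*M+1..2*M+2*N+1}" for y
    using enat_color_less(3) by (auto simp: xi_tilde_init_def)
  have rank: "rank_right 3 (xi_tilde_init M N) y = 2*M+2*N+1 - y" if "y \<in> {N+2*M+1..2*M+2*N+1}" for y
  proof -
    have "{z. y < z \<and> z \<in> {N+2*M+1..2*M+2*N+1}} = {y<..2*M+2*N+1}" using that by auto
    then show ?thesis unfolding rank_right_def eq by (simp only: card_greaterThanAtMost)
  qed
  have "y \<in> layer 3 s (xi_tilde_init M N) \<longleftrightarrow> y \<in> {N+1..N+M} \<union> {(2*M+2*N+1-s)+1..2*M+2*N+1}" for y
  proof (cases "y \<in> {N+2*M+1..2*M+2*N+1}")
    case True
    have "2*M+2*N+1 - y < s \<longleftrightarrow> y \<in> {(2*M+2*N+1-s)+1..2*M+2*N+1}" using True by auto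
    then show ?thesis unfolding layer_def mem_Collect_eq lt eq rank[OF True] Un_iff using True by blast
  next
    case False
    then have "y \<notin> {(2*M+2*N+1-s)+1..2*M+2*N+1}" using assms by auto
    then show ?thesis unfolding layer_def mem_Collect_eq lt eq Un_iff using False by blast
  qed
  then show ?thesis by (rule set_eqI)
qed

section \<open>Index sets of the theorem\<close>

lemma B_ones_from:
  assumes "length w = 2*M + 2*N + 1"
  shows "w \<in> B M N m n \<longleftrightarrow> ones_left (N + M) w = m \<and> ones_from w (N + M) = n"
    "ones_from w (N + M) \<le> M + N + 1" "ones_from w (N + M) \<le> ones_from w 0"
    "ones_left (N + M) w \<le> M + N"
proof -
  let ?L = "2*M + 2*N + 1"
  have o: "ones_from w k = (\<Sum>j = k..<?L. of_bool (w ! j))" if "k \<le> ?L" for k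
    using ones_from_eq_sum[of k w] that assms by simp
  have split: "ones_from w 0 = (\<Sum>j = 0..<N + M. of_bool (w ! j)) + ones_from w (N + M)"
    using o[of 0] o[of "N + M"] sum.atLeastLessThan_concat[of 0 "N + M" ?L "\<lambda>j. of_bool (w ! j) :: nat"] by simp
  have first: "(\<Sum>i = 1..M+N. of_bool (w ! (i - 1))) = (\<Sum>j = 0..<N + M. of_bool (w ! j) :: nat)"
    by (rule sum.reindex_bij_witness[of _ Suc "\<lambda>i. i - 1"]) auto
  have second: "(\<Sum>j = M+N+1..2*M+2*N+1. of_bool (w ! (j - 1))) = (\<Sum>j = N + M..<?L. of_bool (w ! j) :: nat)"
    by (rule sum.reindex_bij_witness[of _ Suc "\<lambda>i. i - 1"]) auto
  show "w \<in> B M N m n \<longleftrightarrow> ones_left (N + M) w = m \<and> ones_from w (N + M) = n"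
    using assms o[of "N + M"] unfolding B_def mem_Collect_eq first second split by auto
  have "(\<Sum>j = N + M..<?L. of_bool (w ! j) :: nat) \<le> (\<Sum>j = N + M..<?L. 1)" by (rule sum_mono) simp
  then show "ones_from w (N + M) \<le> M + N + 1" using o[of "N + M"] by simp
  have "(\<Sum>j = 0..<N + M. of_bool (w ! j) :: nat) \<le> (\<Sum>j = 0..<N + M. 1)" by (rule sum_mono) simp
  then show "ones_left (N + M) w \<le> M + N" using split by simp
  show "ones_from w (N + M) \<le> ones_from w 0" using split by simp
qed

lemma sum_B:
  "(\<Sum>\<eta>\<in>B M N m n. g \<eta>) = (\<Sum>w | length w = 2*M + 2*N + 1.
     g w * of_bool (ones_left (N + M) w = m \<and> ones_from w (N + M) = n) :: real)"
proof -
  have fin: "finite {w :: bool list. length w = 2*M + 2*N + 1}"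
    using finite_lists_length_eq[of "UNIV :: bool set" "2*M + 2*N + 1"] by simp
  have "length w = 2*M + 2*N + 1" if "w \<in> B M N m n" for w
    using that unfolding B_def mem_Collect_eq by (rule conjunct1)
  then have "B M N m n = {w \<in> {w. length w = 2*M + 2*N + 1}.
      ones_left (N + M) w = m \<and> ones_from w (N + M) = n}"
    using B_ones_from(1) by blast
  then show ?thesis
    by (simp only: sum.inter_filter[OF fin]) (rule sum.cong, auto)
qed

lemma sum_of_bool_pair:
  "finite I \<Longrightarrow> (\<And>m. finite (J m)) \<Longrightarrow>
    (\<Sum>m\<in>I. \<Sum>n\<in>J m. of_bool (x = m \<and> y = n) :: real) = of_bool (x \<in> I \<and> y \<in> J x)"
proof -
  assume I: "finite I" and J: "\<And>m. finite (J m)"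
  have "(\<Sum>n\<in>J m. of_bool (x = m \<and> y = n) :: real) = (if m = x then of_bool (y \<in> J x) else 0)" for m
  proof (cases "m = x")
    case True
    have "(\<Sum>n\<in>J m. of_bool (x = m \<and> y = n) :: real) = (\<Sum>n\<in>J m. if n = y then 1 else 0)"
      by (rule sum.cong) (auto simp: True)
    then show ?thesis using J[of m] True by simp
  qed auto
  then show ?thesis using I by simp
qed

lemma sum_B_pairs:
  assumes "finite I" "\<And>m. finite (J m)"
  shows "(\<Sum>m\<in>I. \<Sum>n\<in>J m. \<Sum>\<eta>\<in>B M N m n. g \<eta> :: real) = (\<Sum>w | length w = 2*M + 2*N + 1.
     g w * of_bool (ones_left (N + M) w \<in> I \<and> ones_from w (N + M) \<in> J (ones_left (N + M) w)))"
proof -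
  have "(\<Sum>m\<in>I. \<Sum>n\<in>J m. \<Sum>\<eta>\<in>B M N m n. g \<eta>) = (\<Sum>w | length w = 2*M + 2*N + 1. \<Sum>m\<in>I. \<Sum>n\<in>J m.
     g w * of_bool (ones_left (N + M) w = m \<and> ones_from w (N + M) = n))"
    (is "_ = (\<Sum>w | _. \<Sum>m\<in>I. \<Sum>n\<in>J m. ?f w m n)")
  proof -
    have "(\<Sum>m\<in>I. \<Sum>n\<in>J m. \<Sum>\<eta>\<in>B M N m n. g \<eta>) = (\<Sum>m\<in>I. \<Sum>w | length w = 2*M + 2*N + 1. \<Sum>n\<in>J m. ?f w m n)"
      unfolding sum_B by (intro sum.cong refl sum.swap)
    also have "\<dots> = (\<Sum>w | length w = 2*M + 2*N + 1. \<Sum>m\<in>I. \<Sum>n\<in>J m. ?f w m n)"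
      by (rule sum.swap)
    finally show ?thesis .
  qed
  then show ?thesis
    unfolding sum_distrib_left[symmetric] sum_of_bool_pair[OF assms] .
qed

lemma DEHP_weight:
  "(\<Sum>k = 0..Psi \<eta> 1. Z \<alpha> \<eta> k / 2 ^ k * (1 + (\<alpha> - 1/2) / \<alpha> * real k)) = word_act \<alpha> \<eta> (half_line_column \<alpha>) 0"
  unfolding Z_word_act[symmetric] half_line_column_def by simp

lemma block_excess_le:
  assumes "length w = 2*M + 2*N + 1"
  shows "block_excess M N w \<le> 2*M + 2*N + 1"
  using B_ones_from(2)[OF assms] by (simp add: block_excess_def min_def)

theorem theorem1p5:
  fixes M N :: nat and \<alpha> :: real
    and P :: "'a measure" and \<xi> :: "real \<Rightarrow> 'a \<Rightarrow> config"
    and P' :: "'b measure" and \<xi>' :: "real \<Rightarrow> 'b \<Rightarrow> config"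
  assumes "0 < M" and "0 < N"
    and "0 < \<alpha>" and "\<alpha> < 1" and "1/2 < \<alpha>"
    and "half_line_open_tasep \<alpha> (xi_init M N) P \<xi>"
    and "half_line_open_tasep \<alpha> (xi_tilde_init M N) P' \<xi>'"
  shows
    "((\<lambda>t. measure P {\<omega> \<in> space P. second_class_position (\<xi> t \<omega>) > 0}) \<longlongrightarrow>
        (\<Sum>m = 0..N-1. \<Sum>n = 0..M+N-m. \<Sum>\<eta>\<in>B M N m n. \<Sum>k = 0..Psi \<eta> 1.
           Z \<alpha> \<eta> k / 2 ^ k * (1 + (\<alpha> - 1/2) / \<alpha> * real k)) +
        (\<Sum>m = N..M+N. \<Sum>n = 0..M. \<Sum>\<eta>\<in>B M N m n. \<Sum>k = 0..Psi \<eta> 1.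
           Z \<alpha> \<eta> k / 2 ^ k * (1 + (\<alpha> - 1/2) / \<alpha> * real k))) at_top
     \<and>
     (\<forall>s\<le>N.
       ((\<lambda>t. measure P' {\<omega> \<in> space P'. num_color_ge 3 1 (\<xi>' t \<omega>) = s}) \<longlongrightarrow>
        (\<Sum>n = 1..s. \<Sum>\<eta>\<in>B M N (N-n) (M+N+1-s+n). \<Sum>k = 0..Psi \<eta> 1.
           Z \<alpha> \<eta> k / 2 ^ k * (1 + (\<alpha> - 1/2) / \<alpha> * real k)) +
        (\<Sum>m = N..M+N. \<Sum>\<eta>\<in>B M N m (M+N+1-s). \<Sum>k = 0..Psi \<eta> 1.
           Z \<alpha> \<eta> k / 2 ^ k * (1 + (\<alpha> - 1/2) / \<alpha> * real k))) at_top)"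
proof -
  let ?L = "2*M + 2*N + 1"
  define g where "g w = word_act \<alpha> w (half_line_column \<alpha>) 0" for w
  have a: "\<alpha> \<le> 1" using assms(4) by simp
  have c3: "1 < (3::enat)" "(3::enat) \<noteq> \<infinity>" using enat_color_less by simp_all
  show ?thesis
  proof (intro conjI allI impI, goal_cases)
    case 1
    have "(\<Sum>m = 0..N-1. \<Sum>n = 0..M+N-m. \<Sum>\<eta>\<in>B M N m n. g \<eta>) + (\<Sum>m = N..M+N. \<Sum>n = 0..M. \<Sum>\<eta>\<in>B M N m n. g \<eta>)
        = (\<Sum>w | length w = ?L. g w * of_bool (?L - (N+2*M+1) + block_excess M N w < ?L))"
      unfolding sum_B_pairs[of "{0..N-1}" "\<lambda>m. {0..M+N-m}", OF finite_atLeastAtMost finite_atLeastAtMost]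
        sum_B_pairs[of "{N..M+N}" "\<lambda>m. {0..M}", OF finite_atLeastAtMost finite_atLeastAtMost] sum.distrib[symmetric]
    proof (rule sum.cong[OF refl])
      fix w :: "bool list" assume "w \<in> {w. length w = ?L}"
      then have "length w = ?L" by simp
      note o = B_ones_from(2-4)[OF this]
      let ?m = "ones_left (N + M) w" and ?n = "ones_from w (N + M)"
      show "g w * of_bool (?m \<in> {0..N-1} \<and> ?n \<in> {0..M+N-?m}) + g w * of_bool (?m \<in> {N..M+N} \<and> ?n \<in> {0..M})
          = g w * of_bool (?L - (N+2*M+1) + block_excess M N w < ?L)"
      \<comment> \<open>The inner minimum of \<open>block_excess\<close> is M + ?m for ?m < N and N
        + M otherwise. As ?L - (N+2*M+1) = N, the condition becomes ?n \<le> M + N - ?m in the first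
        case and ?n \<le> M in the second.\<close>
      proof (cases "?m < N")
        case True
        then have "?m \<in> {0..N-1} \<and> ?n \<in> {0..M+N-?m} \<longleftrightarrow> ?L - (N+2*M+1) + block_excess M N w < ?L"
          "\<not> (?m \<in> {N..M+N} \<and> ?n \<in> {0..M})"
          using o by (auto simp: block_excess_def min_def)
        then show ?thesis by simp
      next
        case False
        then have "?m \<in> {N..M+N} \<and> ?n \<in> {0..M} \<longleftrightarrow> ?L - (N+2*M+1) + block_excess M N w < ?L"
          "\<not> (?m \<in> {0..N-1} \<and> ?n \<in> {0..M+N-?m})"
          using o assms(2) by (auto simp: block_excess_def min_def)
        then show ?thesis by simp
      qed
    qed
    also have "\<dots> = survival \<alpha> (layer 2 0 (xi_init M N)) (layer 2 1 (xi_init M N))"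
      unfolding layer_xi_init g_def using assms(1,2,3) by (intro survival_two_blocks[symmetric]) auto
    finally show ?case
      unfolding DEHP_weight g_def[symmetric] using second_class_limit[OF assms(6,5) a] by simp
  next
    case (2 s)
    then have s: "s \<le> N" .
    have surv: "survival \<alpha> (layer 3 r (xi_tilde_init M N)) (layer 3 (Suc r) (xi_tilde_init M N))
        = (\<Sum>w | length w = ?L. g w * of_bool (r + block_excess M N w < ?L))" if "r \<le> N" for r
    proof -
      have "2*M+2*N+1 - Suc r + 1 = ?L - r" "?L - (?L - r) = r" using that by simp_all
      then show ?thesis
        unfolding g_def using that assms(1,3) survival_two_blocks[of \<alpha> N M "?L - r" ?L]
        by (simp only: layer_xi_tilde_init)
    qed
    \<comment> \<open>Indexing by the number m = N - n of ones on the left, with a singleton range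
      for the ones on the right, brings the sum into the form of \<open>sum_B_pairs\<close>.\<close>
    have "(\<Sum>n = 1..s. \<Sum>\<eta>\<in>B M N (N-n) (M+N+1-s+n). g \<eta>)
        = (\<Sum>m = N-s..<N. \<Sum>n\<in>{M+2*N+1-s-m}. \<Sum>\<eta>\<in>B M N m n. g \<eta>)"
    proof (rule sum.reindex_bij_witness[of _ "\<lambda>m. N - m" "\<lambda>n. N - n"])
      fix n assume "n \<in> {1..s}"
      then have e: "M+2*N+1-s-(N-n) = M+N+1-s+n" using s by auto
      show "(\<Sum>k\<in>{M+2*N+1-s-(N-n)}. \<Sum>\<eta>\<in>B M N (N-n) k. g \<eta>) = (\<Sum>\<eta>\<in>B M N (N-n) (M+N+1-s+n). g \<eta>)"
        unfolding e by simp
    qed (use s in auto)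
    moreover have "(\<Sum>m = N..M+N. \<Sum>\<eta>\<in>B M N m (M+N+1-s). g \<eta>)
        = (\<Sum>m = N..M+N. \<Sum>n\<in>{M+N+1-s}. \<Sum>\<eta>\<in>B M N m n. g \<eta>)"
      by simp
    moreover have "(\<Sum>m = N-s..<N. \<Sum>n\<in>{M+2*N+1-s-m}. \<Sum>\<eta>\<in>B M N m n. g \<eta>)
          + (\<Sum>m = N..M+N. \<Sum>n\<in>{M+N+1-s}. \<Sum>\<eta>\<in>B M N m n. g \<eta>)
        = (\<Sum>w | length w = ?L. g w * of_bool (s + block_excess M N w = ?L))"
      unfolding sum_B_pairs[of "{N-s..<N}" "\<lambda>m. {M+2*N+1-s-m}", OF finite_atLeastLessThan finite.insertI[OF finite.emptyI]]
        sum_B_pairs[of "{N..M+N}" "\<lambda>m. {M+N+1-s}", OF finite_atLeastAtMost finite.insertI[OF finite.emptyI]] sum.distrib[symmetric]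
    proof (rule sum.cong[OF refl])
      fix w :: "bool list" assume "w \<in> {w. length w = ?L}"
      then have "length w = ?L" by simp
      note o = B_ones_from(2-4)[OF this]
      let ?m = "ones_left (N + M) w" and ?n = "ones_from w (N + M)"
      \<comment> \<open>For ?m < N the equation reads s + ?n + M + ?m = ?L; the lower limit N - s of
        ?m follows from ?n \<le> M + N + 1.\<close>
      have "?m \<in> {N-s..<N} \<and> ?n \<in> {M+2*N+1-s-?m} \<longleftrightarrow> ?m < N \<and> s + block_excess M N w = ?L"
      proof (cases "?m < N")
        case True
        then have "block_excess M N w = ?n + (M + ?m)" by (simp add: block_excess_def)
        then show ?thesis using True o s unfolding atLeastLessThan_iff singleton_iff by linarith
      qed simp
      moreover have "?m \<in> {N..M+N} \<and> ?n \<in> {M+N+1-s} \<longleftrightarrow> \<not> ?m < N \<and> s + block_excess M N w = ?L"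
        using o s by (auto simp: block_excess_def min_def)
      ultimately show "g w * of_bool (?m \<in> {N-s..<N} \<and> ?n \<in> {M+2*N+1-s-?m}) + g w * of_bool (?m \<in> {N..M+N} \<and> ?n \<in> {M+N+1-s})
          = g w * of_bool (s + block_excess M N w = ?L)" by simp
    qed
    ultimately have "(\<Sum>n = 1..s. \<Sum>\<eta>\<in>B M N (N-n) (M+N+1-s+n). g \<eta>) + (\<Sum>m = N..M+N. \<Sum>\<eta>\<in>B M N m (M+N+1-s). g \<eta>)
        = (\<Sum>w | length w = ?L. g w * of_bool (s + block_excess M N w = ?L))" by simp
    \<comment> \<open>For s = 0 the condition on the right always holds and the weights sum to 1;
      for s > 0 the strict inequality for s - 1 is the weak one for s.\<close>
    moreover have "(if s = 0 then 1 else survival \<alpha> (layer 3 (s - 1) (xi_tilde_init M N)) (layer 3 s (xi_tilde_init M N)))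
        = (\<Sum>w | length w = ?L. g w * of_bool (s + block_excess M N w \<le> ?L))"
    proof (cases s)
      case 0
      have "(\<Sum>w | length w = ?L. g w * of_bool (s + block_excess M N w \<le> ?L)) = (\<Sum>w | length w = ?L. g w)"
        by (rule sum.cong) (use 0 block_excess_le in auto)
      also have "\<dots> = 1" unfolding g_def using assms(3) by (intro sum_word_act) simp
      finally show ?thesis using 0 by simp
    next
      case (Suc r)
      then show ?thesis using surv[of r] s by (simp add: less_eq_Suc_le)
    qed
    ultimately have "(\<Sum>n = 1..s. \<Sum>\<eta>\<in>B M N (N-n) (M+N+1-s+n). g \<eta>) + (\<Sum>m = N..M+N. \<Sum>\<eta>\<in>B M N m (M+N+1-s). g \<eta>)
        = (if s = 0 then 1 else survival \<alpha> (layer 3 (s - 1) (xi_tilde_init M N)) (layer 3 s (xi_tilde_init M N)))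
          - survival \<alpha> (layer 3 s (xi_tilde_init M N)) (layer 3 (Suc s) (xi_tilde_init M N))"
      unfolding surv[OF s] by (simp only: sum_subtractf[symmetric]) (rule sum.cong, auto)
    then show ?case
      unfolding DEHP_weight g_def[symmetric] using num_color_limit[OF assms(7,5) a c3, of s] by simp
  qed
qed

end
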